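(* Let $\mathcal{P}$ be a non-trivial hereditary property of binary matroids with $\chi_c(\mathcal{P})=k$. Then there exists a thin hereditary property $\mathcal{T}$ such that almost every matroid in $\mathcal{P}$ belongs to $\mathrm{Ext}^k(\mathcal{T})$, i.e. $\lim_{n\to\infty}|\mathcal{P}^n\cap \mathrm{Ext}^k(\mathcal{T})|/|\mathcal{P}^n|=1$.
   Context: A binary projective space is a set $V=W\setminus\{0\}$ where $W$ is a finite-dimensional $\mathbb{F}_2$-vector space; its dimension $\dim(V)$ is $\dim_{\mathbb{F}_2}(W)$. A subspace of $V$ is a set $U\setminus\{0\}$ with $U$ a linear subspace of $W$; codimension is $\dim(V)-\dim(U)$. A (simple binary) matroid is a function $M:V(M)\to\{0,1\}$ with $V(M)$ a binary projective space, $\dim(M)=\dim(V(M))$; $M[U]$ is the restriction to a subspace $U$. Matroids $M_1,M_2$ are isomorphic if $M_1=M_2\circ\phi$ for an invertible linear map $\phi$. A matroid property is a set of matroids closed under isomorphism; hereditary if closed under restriction to subspaces; non-trivial if it contains matroids of arbitrarily large dimension. $\mathcal{P}^n$ is the set of matroids in $\mathcal{P}$ on $\mathbb{F}_2^n\setminus\{0\}$. For $k\ge0$, $\mathrm{Ext}^k(M)$ is the set of matroids $M'$ with $\dim(M')\le\dim(M)+k$ such that $M$ is (isomorphic to) the restriction of $M'$ to a subspace of codimension at most $k$ in $V(M')$; $\mathrm{Ext}^k(\mathcal{P})=\bigcup_{M\in\mathcal{P}}\mathrm{Ext}^k(M)$. Let $\mathcal{O}$ (resp. $\mathcal{I}$)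 be the property of all identically $0$ (resp. $1$) matroids; $\mathcal{M}(k,0)=\mathrm{Ext}^k(\mathcal{O})$, $\mathcal{M}(k,1)=\mathrm{Ext}^k(\mathcal{I})$. The critical number $\chi_c(\mathcal{P})$ of a non-trivial hereditary property $\mathcal{P}$ is the maximum integer $k\ge0$ with $\mathcal{M}(k,i)\subseteq\mathcal{P}$ for some $i\in\{0,1\}$. A non-trivial hereditary property is thin if its critical number is $0$. *)

theory Defs
  imports Complex_Main "HOL-Library.Z2" "HOL-Library.Function_Algebras"
begin

text \<open>
  All spaces live in the single infinite-dimensional \<open>\<bbbF>\<^sub>2\<close>-vector space of sequences
  \<^typ>\<open>nat \<Rightarrow> bit\<close>. It contains a copy of every finite-dimensional \<open>\<bbbF>\<^sub>2\<close>-vector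
  space, so isomorphism-closed classes of matroids are represented by isomorphism-closed sets
  of matroids in this universe.
\<close>

type_synonym vec = "nat \<Rightarrow> bit"

definition scaleF2 :: "bit \<Rightarrow> vec \<Rightarrow> vec" where
  "scaleF2 c v = (\<lambda>i. c * v i)"

interpretation F2: vector_space scaleF2
  by unfold_locales (auto simp: scaleF2_def fun_eq_iff algebra_simps)

definition fin_dim_space :: "vec set \<Rightarrow> bool" where
  "fin_dim_space W \<longleftrightarrow> F2.subspace W \<and> (\<exists>B. finite B \<and> F2.span B = W)"

definition projective_space :: "vec set \<Rightarrow> bool" where
  "projective_space V \<longleftrightarrow> (\<exists>W. fin_dim_space W \<and> V = W - {0})"

definition proj_dim :: "vec set \<Rightarrow> nat" where
  "proj_dim V = F2.dim (insert 0 V)"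

definition proj_subspace :: "vec set \<Rightarrow> vec set \<Rightarrow> bool" where
  "proj_subspace U V \<longleftrightarrow> projective_space U \<and> U \<subseteq> V"

definition codim :: "vec set \<Rightarrow> vec set \<Rightarrow> nat" where
  "codim V U = proj_dim V - proj_dim U"

text \<open>
  A matroid is a partial function whose domain is its ground space \<open>V(M)\<close>. The restriction
  \<open>M[U]\<close> is \<open>M |` U\<close>.
\<close>

type_synonym matroid = "vec \<rightharpoonup> bit"

definition is_matroid :: "matroid \<Rightarrow> bool" where
  "is_matroid M \<longleftrightarrow> projective_space (dom M)"

definition mdim :: "matroid \<Rightarrow> nat" where
  "mdim M = proj_dim (dom M)"

text \<open>
  The invertible linear map is taken to be the restriction of a linear map of the universe; every
  linear map between subspaces arises in this way.
\<close>

definition matroid_iso :: "matroid \<Rightarrow> matroid \<Rightarrow> bool" where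
  "matroid_iso M1 M2 \<longleftrightarrow>
     (\<exists>\<phi>. Vector_Spaces.linear scaleF2 scaleF2 \<phi> \<and>
          bij_betw \<phi> (insert 0 (dom M1)) (insert 0 (dom M2)) \<and>
          (\<forall>x\<in>dom M1. M1 x = M2 (\<phi> x)))"

definition matroid_property :: "matroid set \<Rightarrow> bool" where
  "matroid_property P \<longleftrightarrow>
     (\<forall>M\<in>P. is_matroid M) \<and>
     (\<forall>M\<in>P. \<forall>M'. is_matroid M' \<and> matroid_iso M' M \<longrightarrow> M' \<in> P)"

definition hereditary :: "matroid set \<Rightarrow> bool" where
  "hereditary P \<longleftrightarrow> (\<forall>M\<in>P. \<forall>U. proj_subspace U (dom M) \<longrightarrow> M |` U \<in> P)"

definition nontrivial :: "matroid set \<Rightarrow> bool" where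
  "nontrivial P \<longleftrightarrow> (\<forall>d. \<exists>M\<in>P. mdim M \<ge> d)"

text \<open>\<open>\<bbbF>\<^sub>2\<^sup>n\<close> is the space of sequences supported on the first \<open>n\<close> coordinates.\<close>

definition F2_pow :: "nat \<Rightarrow> vec set" where
  "F2_pow n = {v. \<forall>i\<ge>n. v i = 0}"

definition on_dim :: "matroid set \<Rightarrow> nat \<Rightarrow> matroid set" where
  "on_dim P n = {M \<in> P. dom M = F2_pow n - {0}}"

definition Ext1 :: "nat \<Rightarrow> matroid \<Rightarrow> matroid set" where
  "Ext1 k M = {M'. is_matroid M' \<and> mdim M' \<le> mdim M + k \<and>
     (\<exists>U. proj_subspace U (dom M') \<and> codim (dom M') U \<le> k \<and> matroid_iso M (M' |` U))}"

definition Ext :: "nat \<Rightarrow> matroid set \<Rightarrow> matroid set" where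
  "Ext k P = (\<Union>M\<in>P. Ext1 k M)"

definition const_matroids :: "bit \<Rightarrow> matroid set" where
  "const_matroids c = {M. is_matroid M \<and> (\<forall>x\<in>dom M. M x = Some c)}"

definition ext_const :: "nat \<Rightarrow> bit \<Rightarrow> matroid set" where
  "ext_const k c = Ext k (const_matroids c)"

text \<open>
  The critical number is a maximum, which does not exist when \<open>P\<close> contains
  \<^term>\<open>ext_const k c\<close> for arbitrarily large \<open>k\<close> (e.g. when \<open>P\<close> contains every matroid).
  It is therefore stated as a relation.
\<close>

definition critical_number :: "matroid set \<Rightarrow> nat \<Rightarrow> bool" where
  "critical_number P k \<longleftrightarrow>
     (\<exists>c. ext_const k c \<subseteq> P) \<and>
     (\<forall>j. (\<exists>c. ext_const j c \<subseteq> P) \<longrightarrow> j \<le> k)"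

definition thin :: "matroid set \<Rightarrow> bool" where
  "thin P \<longleftrightarrow> matroid_property P \<and> hereditary P \<and> nontrivial P \<and> critical_number P 0"

end

theory Submission
  imports Defs "HOL-Library.FuncSet"
begin

text \<open>
  Let \<open>N = 2\<^sup>n\<close>. As \<open>P\<close> contains \<open>M(k, c)\<close> for some \<open>c\<close>, it has at least \<open>2 ^ (N - N / 2 ^ k)\<close>
  members on \<open>F2_pow n\<close>. For each \<open>c\<close> choose \<open>N\<^sub>c\<close> in \<open>M(k + 1, c)\<close> but not in \<open>P\<close>, and let \<open>T\<close> consist of
  the matroids without a copy of suitable restrictions \<open>N\<^sub>c[E\<^sub>c]\<close> in \<open>M(1, c)\<close>. If \<open>M[U]\<close> contains such
  a copy for a subspace \<open>U\<close> of codimension \<open>k\<close>, then \<open>M\<close> has to avoid linearly many (in \<open>N\<close>) disjoint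
  extensions of it to \<open>N\<^sub>c\<close>, so that given \<open>M[U]\<close> there are at most \<open>2 ^ (N - N / 2 ^ k - \<delta> N)\<close> choices
  for \<open>M\<close>.

  It remains to see that \<open>M[U]\<close> has few possibilities for some \<open>U\<close>. Fixing the values on a small set of
  points increases the energy (the mean square of the probability of value 1 at a point) of the family of
  exceptional matroids, unless the values on most random subspaces of bounded dimension are nearly
  independent. Hence a subfamily \<open>K\<close> of proportion \<open>2 ^ (- o(N))\<close> has this independence. Let \<open>S\<close> be the set of
  points where both values are frequent in \<open>K\<close>. By Ramsey's theorem, a positive proportion of
  configurations \<open>B - W \<subseteq> S\<close> with \<open>W\<close> of codimension \<open>k + 1\<close> in \<open>B\<close> would put a copy of some \<open>N\<^sub>c\<close> into
  \<open>K\<close>. By stability for the Bose-Burton theorem, either \<open>S\<close> is small and hence so is \<open>K\<close>, or \<open>S\<close>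
  almost misses a subspace \<open>U\<close> of codimension \<open>k\<close>, where then almost all values are determined.
\<close>

section \<open>Finite subspaces\<close>

text \<open>Since the lower bound for \<open>P\<close> is \<open>2 ^ (N - N / 2 ^ k)\<close>, the
  exceptional matroids have to be fewer by a factor exponential in \<open>N\<close>. Every loss on
  the way may therefore cost only \<open>2 powr (\<xi> * N)\<close>, with \<open>\<xi>\<close> far
  below the gain \<open>\<delta>\<close> of the extension step. In particular the energy argument
  may fix only \<open>o(N)\<close> values per round, and a dense set of dependent tuples does not by
  itself offer so sparse a set. It comes from one explicit tuple per point, all of whose other
  combinations lie in a fixed sparse set, moved by a random invertible map. The subspace
  \<open>E c\<close> between \<open>U c\<close> and the ground space meets three demands. It has at
  most twice the size of \<open>U c\<close>, so that \<open>T\<close> is thin. It has at least a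
  \<open>2 ^ (- k)\<close> share of the ground space, so that a copy inside codimension
  \<open>k\<close> can be extended to all of \<open>N c\<close>. It contains a point with value
  other than \<open>cc\<close>, where \<open>ext_const k cc\<close> lies in \<open>P\<close>, so
  that \<open>T\<close> keeps the matroids that are constantly \<open>cc\<close> and is non-trivial.
  The case \<open>k = 0\<close> is separate: there \<open>P\<close> itself is thin.\<close>

interpretation F2p: vector_space_pair scaleF2 scaleF2 ..

text \<open>Otherwise the simplifier unfolds sums of vectors pointwise.\<close>

declare plus_fun_apply [simp del]

lemma vec_add_self [simp]: "x + x = (0 :: vec)"
  by (auto simp: fun_eq_iff plus_fun_apply)

lemma vec_add_cancel [simp]: "x + (x + y) = (y :: vec)" "x + (y + x) = y"
proof -
  show *: "x + (x + y) = (y :: vec)"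
    by (simp add: add.assoc [symmetric])
  then show "x + (y + x) = y"
    by (simp add: add.commute [of y])
qed

lemma vec_add_eq_0 [simp]: "x + y = 0 \<longleftrightarrow> x = (y :: vec)"
  by (metis add.right_neutral vec_add_cancel(1))

lemma vec_diff [simp]: "x - y = (x + y :: vec)"
  by (metis add_diff_cancel_right' vec_add_cancel(1) add.commute)

lemma scaleF2_cases: "scaleF2 c x = (if c = 1 then x else 0)"
  by (cases c) (auto simp: scaleF2_def fun_eq_iff)

lemma subspace_iff:
  "F2.subspace W \<longleftrightarrow> 0 \<in> W \<and> (\<forall>x\<in>W. \<forall>y\<in>W. x + y \<in> W)"
  unfolding F2.subspace_def by (auto simp: scaleF2_cases)

abbreviation lin :: "(vec \<Rightarrow> vec) \<Rightarrow> bool" where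
  "lin \<equiv> Vector_Spaces.linear scaleF2 scaleF2"

lemma lin_iff: "lin g \<longleftrightarrow> (\<forall>x y. g (x + y) = g x + g y)"
proof
  assume *: "\<forall>x y. g (x + y) = g x + g y"
  then have "g 0 = 0"
    by (metis vec_add_self)
  with * show "lin g"
    unfolding Vector_Spaces.linear_iff by (auto simp: F2.vector_space_axioms scaleF2_cases)
qed (simp add: F2p.linear_add)

lemma lin_add: "lin g \<Longrightarrow> g (x + y) = g x + g y"
  by (simp add: lin_iff)

lemma lin_0: "lin g \<Longrightarrow> g 0 = 0"
  by (rule F2p.linear_0)

lemma subspace_image: "lin g \<Longrightarrow> F2.subspace W \<Longrightarrow> F2.subspace (g ` W)"
  by (rule F2p.linear_subspace_image)

lemma lin_inj_on_iff:
  assumes "lin g" "F2.subspace W"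
  shows "inj_on g W \<longleftrightarrow> (\<forall>x\<in>W. g x = 0 \<longrightarrow> x = 0)"
proof
  assume inj: "inj_on g W"
  show "\<forall>x\<in>W. g x = 0 \<longrightarrow> x = 0"
    using inj_onD [OF inj] assms lin_0 [of g] F2.subspace_0 by metis
next
  assume *: "\<forall>x\<in>W. g x = 0 \<longrightarrow> x = 0"
  show "inj_on g W"
  proof (rule inj_onI)
    fix x y assume "x \<in> W" "y \<in> W" "g x = g y"
    then have "g (x + y) = 0" "x + y \<in> W"
      using assms by (auto simp: lin_add F2.subspace_add)
    with * show "x = y" by auto
  qed
qed

text \<open>This is the span of \<open>x\<close> and \<open>W\<close>, as 0 and 1 are the only
  scalars. Subspaces are enlarged by one dimension in this form throughout.\<close>

definition adjoin :: "vec \<Rightarrow> vec set \<Rightarrow> vec set" where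
  "adjoin x W = W \<union> (+) x ` W"

lemma adjoin_iff: "y \<in> adjoin x W \<longleftrightarrow> y \<in> W \<or> x + y \<in> W"
  by (auto simp: adjoin_def image_iff) (metis vec_add_cancel(1))

lemma subspace_adjoin:
  assumes "F2.subspace W" shows "F2.subspace (adjoin x W)"
proof -
  have *: "a + b \<in> W" if "a \<in> W" "b \<in> W" for a b
    using assms that by (rule F2.subspace_add)
  have "a + b \<in> adjoin x W" if "a \<in> adjoin x W" "b \<in> adjoin x W" for a b
    using that *[of a b] *[of "x + a" b] *[of a "x + b"] *[of "x + a" "x + b"]
    by (auto simp: adjoin_iff ac_simps)
  then show ?thesis
    using assms by (auto simp: subspace_iff adjoin_iff)
qed

lemma finite_adjoin [simp]: "finite W \<Longrightarrow> finite (adjoin x W)"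
  by (simp add: adjoin_def)

lemma card_adjoin:
  assumes "F2.subspace W" "finite W" "x \<notin> W"
  shows "card (adjoin x W) = 2 * card W"
proof -
  have "W \<inter> (+) x ` W = {}"
  proof (rule ccontr)
    assume "W \<inter> (+) x ` W \<noteq> {}"
    then obtain w where "w \<in> W" "x + w \<in> W" by auto
    then have "(x + w) + w \<in> W" using F2.subspace_add [OF assms(1)] by blast
    with assms(3) show False by (simp add: add.assoc)
  qed
  moreover have "card ((+) x ` W) = card W"
    by (intro card_image) (auto intro!: inj_onI)
  ultimately show ?thesis
    using assms(2) by (simp add: adjoin_def card_Un_disjoint)
qed

lemma span_insert_eq_adjoin: "F2.span (insert x B) = adjoin x (F2.span B)"
proof -
  have "F2.span (insert x B) = {y. \<exists>k. y - scaleF2 k x \<in> F2.span B}"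
    by (rule F2.span_insert)
  also have "\<dots> = adjoin x (F2.span B)"
  proof -
    have "(\<exists>k. y - scaleF2 k x \<in> F2.span B) \<longleftrightarrow>
        y - scaleF2 0 x \<in> F2.span B \<or> y - scaleF2 1 x \<in> F2.span B" for y
      by (metis bit_not_zero_iff)
    then show ?thesis
      by (auto simp: adjoin_iff scaleF2_cases add.commute)
  qed
  finally show ?thesis .
qed

lemma card_span_independent:
  assumes "finite B" "F2.independent B"
  shows "finite (F2.span B) \<and> card (F2.span B) = 2 ^ card B"
  using assms
proof (induction B rule: finite_induct)
  case (insert x B)
  then have "x \<notin> F2.span B" "F2.independent B"
    by (auto simp: F2.independent_insert)
  with insert show ?case
    by (simp add: span_insert_eq_adjoin card_adjoin)
qed simp

lemma subspace_basis:
  assumes "F2.subspace W" "finite W"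
  obtains B where "B \<subseteq> W" "finite B" "F2.independent B" "F2.span B = W" "card W = 2 ^ card B"
proof -
  obtain B where B: "B \<subseteq> W" "F2.independent B" "W \<subseteq> F2.span B"
    by (rule F2.maximal_independent_subset)
  then have "F2.span B = W"
    using assms(1) F2.span_minimal by blast
  moreover have "finite B"
    using B(1) assms(2) finite_subset by blast
  ultimately show thesis
    using that B card_span_independent by metis
qed

lemma subspace_basis_extend:
  assumes "F2.subspace W" "finite W" "F2.independent A" "A \<subseteq> W"
  obtains B where "A \<subseteq> B" "B \<subseteq> W" "finite B" "F2.independent B" "F2.span B = W"
    "card W = 2 ^ card B"
proof -
  obtain B where B: "A \<subseteq> B" "B \<subseteq> W" "F2.independent B" "W \<subseteq> F2.span B"
    by (rule F2.maximal_independent_subset_extend [OF assms(4,3)])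
  then have "F2.span B = W"
    using assms(1) F2.span_minimal by blast
  moreover have "finite B"
    using B(2) assms(2) finite_subset by blast
  ultimately show thesis
    using that B card_span_independent by metis
qed

lemma card_subspace_dim:
  assumes "F2.subspace W" "finite W"
  shows "card W = 2 ^ F2.dim W"
proof -
  obtain B where B: "F2.independent B" "F2.span B = W" "card W = 2 ^ card B"
    by (rule subspace_basis [OF assms])
  then show ?thesis
    using F2.dim_span_eq_card_independent by auto
qed

lemma card_subspace_power:
  assumes "F2.subspace W" "finite W"
  obtains j where "card W = 2 ^ j"
  using card_subspace_dim [OF assms] by blast

text \<open>A basis of \<open>E\<close> is completed to one of \<open>A\<close>, and the new basis
  vectors go injectively to basis vectors of \<open>C\<close>, which has room for them by
  \<open>card\<close>. An element of \<open>A - E\<close> keeps a nonzero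
  \<open>C\<close>-component, which pushes it off \<open>U\<close>. Most embeddings below are made
  this way; \<open>E = {0}\<close> with \<open>U = {0}\<close> gives a plain embedding.\<close>

lemma extend_embedding:
  assumes A: "F2.subspace A" "finite A" and E: "F2.subspace E" "E \<subseteq> A"
    and th0: "lin \<theta>0" "inj_on \<theta>0 E" "\<theta>0 ` E \<subseteq> U"
    and U: "F2.subspace U" and C: "F2.subspace C" "finite C" "C \<inter> U \<subseteq> {0}"
    and card: "card A \<le> card E * card C"
  obtains \<theta> where "lin \<theta>" "inj_on \<theta> A" "\<And>x. x \<in> E \<Longrightarrow> \<theta> x = \<theta>0 x"
    "\<And>x. x \<in> A - E \<Longrightarrow> \<theta> x \<notin> U" "\<And>x. x \<in> A \<Longrightarrow> \<exists>c\<in>C. \<exists>u\<in>U. \<theta> x = c + u"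
proof -
  have finE: "finite E" using A E finite_subset by blast
  obtain BE where BE: "BE \<subseteq> E" "finite BE" "F2.independent BE" "F2.span BE = E"
    "card E = 2 ^ card BE"
    by (rule subspace_basis [OF E(1) finE])
  obtain BA where BA: "BE \<subseteq> BA" "BA \<subseteq> A" "finite BA" "F2.independent BA" "F2.span BA = A"
    "card A = 2 ^ card BA"
    by (rule subspace_basis_extend [OF A BE(3)]) (use BE E in auto)
  obtain BC where BC: "BC \<subseteq> C" "finite BC" "F2.independent BC" "F2.span BC = C"
    "card C = 2 ^ card BC"
    by (rule subspace_basis [OF C(1,2)])
  define D where "D = BA - BE"
  have "card BA \<le> card BE + card BC"
    using card by (simp add: BE BA BC flip: power_add)
  then have "card D \<le> card BC"
    using BA(1,3) BE(2) by (simp add: D_def card_Diff_subset)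
  moreover have finD: "finite D" using BA by (simp add: D_def)
  ultimately obtain \<iota> where \<iota>: "\<iota> ` D \<subseteq> BC" "inj_on \<iota> D"
    using BC(2) using card_le_inj by blast
  obtain \<theta> where \<theta>: "lin \<theta>" "\<And>x. x \<in> BA \<Longrightarrow> \<theta> x = (if x \<in> BE then \<theta>0 x else \<iota> x)"
    using F2p.linear_independent_extend [OF BA(4), of "\<lambda>x. if x \<in> BE then \<theta>0 x else \<iota> x"] by auto
  have \<theta>BE: "\<theta> b = \<theta>0 b" if "b \<in> BE" for b
    using \<theta>(2) [of b] BA(1) that by auto
  have \<theta>E: "\<theta> x = \<theta>0 x" if "x \<in> E" for x
    using F2p.linear_eq_on [OF \<theta>(1) th0(1), of x BE] that BE(4) \<theta>BE by blast
  have indD: "F2.independent D"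
    using BA(4) F2.independent_mono D_def by blast
  have \<theta>D: "\<theta> x = \<iota> x" if "x \<in> D" for x
    using that \<theta>(2) by (auto simp: D_def)
  have imD: "\<theta> ` D \<subseteq> BC" using \<theta>D \<iota> by auto
  have "inj_on \<theta> D"
    using \<iota>(2) \<theta>D by (simp add: inj_on_def)
  moreover have "F2.independent (\<theta> ` D)"
    by (rule F2.independent_mono [OF BC(3) imD])
  ultimately have injD: "inj_on \<theta> (F2.span D)"
    using F2p.linear_inj_on_span_independent_image [OF \<theta>(1)] by blast
  have imC: "\<theta> q \<in> C" if "q \<in> F2.span D" for q
  proof -
    have "\<theta> q \<in> F2.span (\<theta> ` D)"
      using F2p.linear_span_image [OF \<theta>(1)] that by blast
    then show ?thesis using F2.span_mono [OF imD] BC(4) by auto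
  qed
  have split: "\<exists>e\<in>E. \<exists>q\<in>F2.span D. x = e + q" if "x \<in> A" for x
  proof -
    have "BA = BE \<union> D" using BA(1) by (auto simp: D_def)
    then have "x \<in> F2.span (BE \<union> D)" using that BA(5) by simp
    then show ?thesis unfolding F2.span_Un using BE(4) by auto
  qed
  have notU: "\<theta> x \<notin> U" if "x \<in> A - E" for x
  proof
    assume "\<theta> x \<in> U"
    obtain e q where eq: "e \<in> E" "q \<in> F2.span D" "x = e + q"
      using split [of x] \<open>x \<in> A - E\<close> by auto
    \<comment> \<open>Adding the part in \<open>U\<close> isolates the \<open>C\<close>-component of
      the image; it lies in \<open>C \<inter> U\<close> and so vanishes.\<close>
    have "\<theta> q = \<theta> x + \<theta> e" using eq \<theta>(1) by (simp add: lin_add add.commute)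
    moreover have "\<theta> e \<in> U" using \<theta>E [OF eq(1)] th0(3) eq(1) by auto
    ultimately have "\<theta> q \<in> C \<inter> U"
      using \<open>\<theta> x \<in> U\<close> U imC [OF eq(2)] by (simp add: F2.subspace_add)
    then have "\<theta> q = \<theta> 0" using C(3) lin_0 [OF \<theta>(1)] by auto
    then have "q = 0" using injD eq(2) F2.span_zero by (auto dest: inj_onD)
    then show False using eq that by simp
  qed
  show thesis
  proof (rule that [OF \<theta>(1)])
    have "x = 0" if "x \<in> A" "\<theta> x = 0" for x
    proof -
      have "x \<in> E" using notU [of x] that F2.subspace_0 [OF U] by auto
      then have "\<theta>0 x = 0" using \<theta>E that by simp
      then show ?thesis
        using th0(2) \<open>x \<in> E\<close> lin_inj_on_iff [OF th0(1) E(1)] by blast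
    qed
    then show "inj_on \<theta> A" using lin_inj_on_iff [OF \<theta>(1) A(1)] by blast
    show "\<exists>c\<in>C. \<exists>u\<in>U. \<theta> x = c + u" if "x \<in> A" for x
    proof -
      obtain e q where eq: "e \<in> E" "q \<in> F2.span D" "x = e + q"
        using split [OF \<open>x \<in> A\<close>] by auto
      have "\<theta> e \<in> U" using \<theta>E [OF eq(1)] th0(3) eq(1) by auto
      moreover have "\<theta> x = \<theta> q + \<theta> e" using eq \<theta>(1) by (simp add: lin_add add.commute)
      ultimately show ?thesis using imC [OF eq(2)] by blast
    qed
  qed (use \<theta>E notU in auto)
qed

text \<open>\<open>C\<close> is spanned by the basis vectors of \<open>V\<close> outside a basis of
  \<open>U\<close>. The projection that fixes \<open>U\<close> and kills \<open>C\<close> shows that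
  they meet trivially.\<close>

lemma complement_exists:
  assumes V: "F2.subspace V" "finite V" and U: "F2.subspace U" "U \<subseteq> V"
  obtains C where "F2.subspace C" "C \<subseteq> V" "C \<inter> U \<subseteq> {0}" "card V = card U * card C"
proof -
  have finU: "finite U" using V U finite_subset by blast
  obtain BU where BU: "BU \<subseteq> U" "finite BU" "F2.independent BU" "F2.span BU = U"
    "card U = 2 ^ card BU"
    by (rule subspace_basis [OF U(1) finU])
  obtain B where B: "BU \<subseteq> B" "B \<subseteq> V" "finite B" "F2.independent B" "F2.span B = V"
    "card V = 2 ^ card B"
    by (rule subspace_basis_extend [OF V BU(3)]) (use BU U in auto)
  define C where "C = F2.span (B - BU)"
  have "card C = 2 ^ card (B - BU)"
    unfolding C_def using B F2.independent_mono [OF B(4), of "B - BU"]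
    by (intro card_span_independent [THEN conjunct2]) auto
  then have "card V = card U * card C"
    using B BU by (simp add: card_Diff_subset card_mono flip: power_add)
  moreover have "C \<subseteq> V"
    unfolding C_def using F2.span_mono [of "B - BU" B] B(5) by auto
  moreover have "C \<inter> U \<subseteq> {0}"
  proof
    fix x assume x: "x \<in> C \<inter> U"
    obtain g where g: "lin g" "\<And>b. b \<in> B \<Longrightarrow> g b = (if b \<in> BU then b else 0)"
      using F2p.linear_independent_extend [OF B(4), of "\<lambda>b. if b \<in> BU then b else 0"] by auto
    have "g b = id b" if "b \<in> BU" for b
      using g(2) [of b] B(1) that by auto
    then have "g x = id x"
      using F2p.linear_eq_on [OF g(1) F2.linear_id, of x BU] x BU(4) by blast
    moreover have "g x = 0"
      using F2p.linear_eq_0_on_span [OF g(1), of "B - BU" x] x g(2) by (auto simp: C_def)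
    ultimately show "x \<in> {0}" by simp
  qed
  ultimately show thesis using that C_def F2.subspace_span by blast
qed

text \<open>The support is arbitrary because, besides \<open>F2_pow n\<close>, spaces with a
  vanishing block of coordinates and spaces on coordinates beyond \<open>n\<close> have to be
  counted.\<close>

lemma card_vec_support:
  assumes "finite A" shows "finite {v :: vec. \<forall>i. i \<notin> A \<longrightarrow> v i = 0}"
    and "card {v :: vec. \<forall>i. i \<notin> A \<longrightarrow> v i = 0} = 2 ^ card A"
proof -
  have b: "bij_betw (\<lambda>I i. if i \<in> I then 1 else 0 :: bit) (Pow A) {v. \<forall>i. i \<notin> A \<longrightarrow> v i = 0}"
  proof (rule bij_betw_byWitness [where f' = "\<lambda>v. {i. v i = 1}"])
    show "\<forall>v\<in>{v :: vec. \<forall>i. i \<notin> A \<longrightarrow> v i = 0}. (\<lambda>i. if i \<in> {i. v i = 1} then 1 else 0) = v"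
      by (simp add: fun_eq_iff)
    show "(\<lambda>v. {i. v i = 1}) ` {v :: vec. \<forall>i. i \<notin> A \<longrightarrow> v i = 0} \<subseteq> Pow A"
      by force
  qed auto
  show "finite {v :: vec. \<forall>i. i \<notin> A \<longrightarrow> v i = 0}" using bij_betw_finite [OF b] assms by simp
  show "card {v :: vec. \<forall>i. i \<notin> A \<longrightarrow> v i = 0} = 2 ^ card A"
    using bij_betw_same_card [OF b] assms by (simp add: card_Pow)
qed

lemma finite_F2_pow [simp]: "finite (F2_pow n)"
  and card_F2_pow [simp]: "card (F2_pow n) = 2 ^ n"
proof -
  have "F2_pow n = {v. \<forall>i. i \<notin> {..<n} \<longrightarrow> v i = 0}" by (auto simp: F2_pow_def)
  then show "finite (F2_pow n)" "card (F2_pow n) = 2 ^ n"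
    using card_vec_support [of "{..<n}"] by simp_all
qed

lemma subspace_F2_pow [simp]: "F2.subspace (F2_pow n)"
  by (auto simp: subspace_iff F2_pow_def plus_fun_apply)

lemma zero_in_F2_pow [simp]: "0 \<in> F2_pow n"
  by (simp add: F2_pow_def)

section \<open>Dense sets in a binary space\<close>

lemma sum_card_swap:
  assumes "finite A" "finite B"
  shows "(\<Sum>x\<in>A. card {y\<in>B. R x y}) = (\<Sum>y\<in>B. card {x\<in>A. R x y})"
proof -
  have "(\<Sum>x\<in>A. card {y\<in>B. R x y}) = (\<Sum>x\<in>A. \<Sum>y\<in>B. if R x y then 1 else 0)"
    using assms by (simp add: sum.If_cases Int_def)
  also have "\<dots> = (\<Sum>y\<in>B. \<Sum>x\<in>A. if R x y then 1 else 0)"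
    by (rule sum.swap)
  also have "\<dots> = (\<Sum>y\<in>B. card {x\<in>A. R x y})"
    using assms by (simp add: sum.If_cases Int_def)
  finally show ?thesis .
qed

lemma card_translate:
  assumes "F2.subspace V" "T \<subseteq> V" "t \<in> V"
  shows "card {u\<in>V. u + t \<in> T} = card T"
proof (rule bij_betw_same_card)
  show "bij_betw (\<lambda>u. u + t) {u\<in>V. u + t \<in> T} T"
    by (rule bij_betw_byWitness [where f' = "\<lambda>u. u + t"])
      (use assms F2.subspace_add [OF assms(1)] in \<open>auto simp: add.assoc\<close>)
qed

text \<open>Double counting of pairs, as translation by \<open>t\<close> permutes \<open>V\<close>.
  It is the averaging tool: some translate of \<open>Y\<close> meets \<open>T\<close> at least as
  densely as \<open>V\<close> does.\<close>

lemma sum_overlap: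
  assumes "F2.subspace V" "finite V" "T \<subseteq> V" "Y \<subseteq> V"
  shows "(\<Sum>u\<in>V. card {t\<in>Y. u + t \<in> T}) = card Y * card T"
proof -
  have "(\<Sum>u\<in>V. card {t\<in>Y. u + t \<in> T}) = (\<Sum>t\<in>Y. card {u\<in>V. u + t \<in> T})"
    using assms finite_subset by (intro sum_card_swap) auto
  also have "\<dots> = (\<Sum>t\<in>Y. card T)"
    using assms by (intro sum.cong) (auto intro!: card_translate)
  finally show ?thesis by simp
qed

lemma exists_ge_average:
  fixes f :: "'a \<Rightarrow> real" and c :: real
  assumes "finite A" "A \<noteq> {}" "(\<Sum>x\<in>A. f x) \<ge> c * card A"
  shows "\<exists>x\<in>A. f x \<ge> c"
proof (rule ccontr)
  assume "\<not> ?thesis"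
  then have "(\<Sum>x\<in>A. f x) < (\<Sum>x\<in>A. c)"
    using assms by (intro sum_strict_mono) auto
  with assms show False by (simp add: mult.commute)
qed

text \<open>Repeatedly replacing \<open>X\<close> by \<open>X \<inter> (X + u)\<close> for a popular difference \<open>u\<close>.\<close>

lemma affine_cube_dense:
  fixes e :: real
  assumes "e > 0"
  shows "\<exists>e'>0 :: real. \<exists>w0. \<forall>W X. F2.subspace W \<and> finite W \<and> X \<subseteq> W \<and> card W \<ge> w0 \<and>
    e * card W \<le> card X \<longrightarrow> (\<exists>W' X'. F2.subspace W' \<and> W' \<subseteq> W \<and> card W' = 2 ^ m \<and> X' \<subseteq> X \<and>
      e' * card W \<le> card X' \<and> (\<forall>x\<in>X'. \<forall>w\<in>W'. x + w \<in> X))"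
proof (induction m)
  case 0
  have *: "\<exists>W' X'. F2.subspace W' \<and> W' \<subseteq> W \<and> card W' = 2 ^ 0 \<and> X' \<subseteq> X \<and>
      e * card W \<le> card X' \<and> (\<forall>x\<in>X'. \<forall>w\<in>W'. x + w \<in> X)"
    if "F2.subspace W" "e * card W \<le> card X" for W X
    by (rule exI[of _ "{0}"], rule exI[of _ X]) (use that F2.subspace_0 in auto)
  show ?case
    by (intro exI[of _ e] conjI assms exI[of _ "0::nat"] allI impI) (rule *, simp_all)
next
  case (Suc m)
  then obtain e' w0 where e': "e' > (0 :: real)"
    and IH: "\<forall>W X. F2.subspace W \<and>
      finite W \<and>
      X \<subseteq> W \<and>
      card W \<ge> w0 \<and>
      e * card W \<le> card X \<longrightarrow> (\<exists>W' X'. F2.subspace W' \<and> W' \<subseteq> W \<and> card W' = 2 ^ m \<and> X' \<subseteq> X \<and>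
        e' * card W \<le> card X' \<and> (\<forall>x\<in>X'. \<forall>w\<in>W'. x + w \<in> X))"
    by (elim exE conjE) (rule that)
  \<comment> \<open>Large enough that the \<open>2 ^ m\<close> directions already in
    \<open>W'\<close> use up less than half of the total overlap. The average overlap is at least
    \<open>e' ^ 2 * card W\<close>, so half of it is still reached by some direction outside
    \<open>W'\<close>.\<close>
  define w1 where "w1 = max w0 (nat \<lceil>2 ^ m * 2 / e'\<^sup>2\<rceil> + 1)"
  have step: "\<exists>W' X'. F2.subspace W' \<and> W' \<subseteq> W \<and> card W' = 2 ^ Suc m \<and> X' \<subseteq> X \<and>
      e'\<^sup>2 / 2 * card W \<le> card X' \<and> (\<forall>x\<in>X'. \<forall>w\<in>W'. x + w \<in> X)"
    if *: "F2.subspace W \<and> finite W \<and> X \<subseteq> W \<and> card W \<ge> w1 \<and> e * card W \<le> card X" for W X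
  proof -
    from that obtain W' X' where W': "F2.subspace W'" "W' \<subseteq> W" "card W' = 2 ^ m" "X' \<subseteq> X"
      "e' * card W \<le> card X'" "\<forall>x\<in>X'. \<forall>w\<in>W'. x + w \<in> X"
      using IH [rule_format, of W X] by (auto simp: w1_def)
    let ?f = "\<lambda>u. card {x\<in>X'. u + x \<in> X'}"
    have fin: "finite W" "finite W'" "finite X'"
      using * W'(2,4) by (auto intro: finite_subset)
    have X'W: "X' \<subseteq> W" using * W'(4) by auto
    have large: "real (card W) * e'\<^sup>2 / 2 > 2 ^ m"
    proof -
      have "real (card W) \<ge> nat \<lceil>2 ^ m * 2 / e'\<^sup>2\<rceil> + 1"
        using * by (auto simp: w1_def)
      then have "real (card W) > 2 ^ m * 2 / e'\<^sup>2"
        by linarith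
      then show ?thesis using e' by (simp add: field_simps)
    qed
    have "\<exists>u\<in>W - W'. real (?f u) \<ge> e'\<^sup>2 / 2 * card W"
    proof (rule ccontr)
      assume neg: "\<not> ?thesis"
      have pos: "real (card W) > 0" using fin F2.subspace_0 [of W] * by (auto simp: card_gt_0_iff)
      have "(e' * card W)\<^sup>2 \<le> (real (card X'))\<^sup>2"
        using W'(5) e' by (intro power_mono) auto
      also have "\<dots> = (\<Sum>u\<in>W. real (?f u))"
        using sum_overlap [of W X' X'] * X'W fin
        by (simp add: power2_eq_square flip: of_nat_sum of_nat_mult)
      also have "\<dots> = (\<Sum>u\<in>W'. real (?f u)) + (\<Sum>u\<in>W - W'. real (?f u))"
        using W'(2) fin by (metis (no_types, lifting) add.commute sum.subset_diff)
      also have "\<dots> \<le> (\<Sum>u\<in>W'. real (card W)) + (\<Sum>u\<in>W - W'. e'\<^sup>2 / 2 * card W)"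
      proof (intro add_mono sum_mono)
        fix u assume "u \<in> W'"
        show "real (?f u) \<le> card W"
          using * W'(4) fin by (intro of_nat_mono card_mono) auto
      qed (use neg in force)
      also have "\<dots> \<le> 2 ^ m * card W + card W * (e'\<^sup>2 / 2 * card W)"
        using W' fin by (intro add_mono) (auto intro!: mult_right_mono card_mono)
      finally have "real (card W) * (real (card W) * e'\<^sup>2 / 2) \<le> real (card W) * 2 ^ m"
        by (simp add: power2_eq_square algebra_simps)
      then have "real (card W) * e'\<^sup>2 / 2 \<le> 2 ^ m"
        using pos by (simp only: mult_le_cancel_left_pos)
      with large show False by simp
    qed
    then obtain u where u: "u \<in> W" "u \<notin> W'" "real (?f u) \<ge> e'\<^sup>2 / 2 * card W" by auto
    show ?thesis
    proof (rule exI[of _ "adjoin u W'"], rule exI[of _ "{x\<in>X'. u + x \<in> X'}"], intro conjI u(3) ballI)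
      show "F2.subspace (adjoin u W')" using W'(1) by (rule subspace_adjoin)
      show "adjoin u W' \<subseteq> W"
        using W'(2) u(1) * F2.subspace_add by (auto simp: adjoin_def)
      show "card (adjoin u W') = 2 ^ Suc m"
        using card_adjoin [OF W'(1) fin(2) u(2)] W'(3) by simp
      fix x w assume x: "x \<in> {x\<in>X'. u + x \<in> X'}" and w: "w \<in> adjoin u W'"
      then consider "w \<in> W'" | "u + w \<in> W'" by (auto simp: adjoin_iff)
      then show "x + w \<in> X"
      proof cases
        case 2
        then have "(u + x) + (u + w) \<in> X" using W'(6) x by blast
        then show ?thesis using vec_add_cancel(1) [of u "x + w"] by (metis add.assoc add.commute)
      qed (use W'(6) x in blast)
    qed (use W'(4) in auto)
  qed
  have "0 < e'\<^sup>2 / 2" using e' by simp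
  then show ?case
    apply (intro exI[of _ "e'\<^sup>2 / 2"] conjI exI[of _ w1] allI impI)
    apply (assumption)
    apply (rule step, assumption)
    done
qed

text \<open>Any base point in the set \<open>X'\<close> of \<open>affine_cube_dense\<close> will do;
  the density of \<open>X'\<close> served the induction there.\<close>

lemma affine_cube:
  fixes e :: real
  assumes "e > 0"
  shows "\<exists>w0. \<forall>W X. F2.subspace W \<and> finite W \<and> X \<subseteq> W \<and> card W \<ge> w0 \<and>
    e * card W \<le> card X \<longrightarrow> (\<exists>W' y. F2.subspace W' \<and> W' \<subseteq> W \<and> card W' = 2 ^ m \<and> y \<in> W \<and>
      (\<forall>w\<in>W'. y + w \<in> X))"
proof -
  obtain e' w0 where e': "e' > (0 :: real)"
    and *: "\<forall>W X. F2.subspace W \<and>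
      finite W \<and>
      X \<subseteq> W \<and>
      card W \<ge> w0 \<and>
      e * card W \<le> card X \<longrightarrow> (\<exists>W' X'. F2.subspace W' \<and> W' \<subseteq> W \<and> card W' = 2 ^ m \<and> X' \<subseteq> X \<and>
        e' * card W \<le> card X' \<and> (\<forall>x\<in>X'. \<forall>w\<in>W'. x + w \<in> X))"
    using affine_cube_dense [OF assms, of m] by (elim exE conjE) (rule that)
  show ?thesis
  proof (intro exI[of _ w0] allI impI)
    fix W X assume H: "F2.subspace W \<and> finite W \<and> X \<subseteq> W \<and> card W \<ge> w0 \<and> e * card W \<le> card X"
    then obtain W' X' where W': "F2.subspace W'" "W' \<subseteq> W" "card W' = 2 ^ m" "X' \<subseteq> X"
      "e' * card W \<le> card X'" "\<forall>x\<in>X'. \<forall>w\<in>W'. x + w \<in> X"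
      using * [rule_format, of W X] by auto
    have "real (card W) > 0" using H F2.subspace_0 [of W] by (auto simp: card_gt_0_iff)
    then have "e' * card W > 0" using e' by simp
    with W'(5) have "X' \<noteq> {}" by auto
    then show "\<exists>W' y. F2.subspace W' \<and> W' \<subseteq> W \<and> card W' = 2 ^ m \<and> y \<in> W \<and> (\<forall>w\<in>W'. y + w \<in> X)"
      using W' H by blast
  qed
qed

text \<open>Induction on \<open>a + b\<close>. One colour class is dense and so contains a coset
  \<open>y + W1\<close> of a large subspace. Inside \<open>W1\<close> the induction hypothesis is
  used with one dimension less for that colour. If it returns a \<open>W2\<close> of that colour,
  adjoining \<open>y\<close> recovers the lost dimension, because the coset \<open>y + W2\<close>
  has the colour too.\<close>

lemma subspace_ramsey:
  "\<exists>r. \<forall>W g. F2.subspace W \<and> finite W \<and> card W \<ge> r \<longrightarrow>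
    (\<exists>W'. F2.subspace W' \<and> W' \<subseteq> W \<and> ((card W' = 2 ^ a \<and> (\<forall>x\<in>W' - {0}. \<not> g x)) \<or>
       (card W' = 2 ^ b \<and> (\<forall>x\<in>W' - {0}. g x))))"
proof (induction "a + b" arbitrary: a b)
  case 0
  then show ?case
    by (intro exI[of _ 0] allI impI exI[of _ "{0}"]) (use F2.subspace_0 in auto)
next
  case (Suc s)
  show ?case
  proof (cases "a = 0 \<or> b = 0")
    case True
    then show ?thesis
      by (intro exI[of _ 0] allI impI exI[of _ "{0}"]) (use F2.subspace_0 in auto)
  next
    case False
    then obtain a' b' where ab: "a = Suc a'" "b = Suc b'"
      using not0_implies_Suc by blast
    obtain r1 where r1: "\<forall>W g. F2.subspace W \<and>
      finite W \<and>
      card W \<ge> r1 \<longrightarrow> (\<exists>W'. F2.subspace W' \<and> W' \<subseteq> W \<and> ((card W' = 2 ^ a' \<and> (\<forall>x\<in>W' - {0}. \<not> g x)) \<or>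
       (card W' = 2 ^ b \<and> (\<forall>x\<in>W' - {0}. g x))))"
      using Suc(1) [of a' b] Suc(2) ab by auto
    obtain r2 where r2: "\<forall>W g. F2.subspace W \<and>
      finite W \<and>
      card W \<ge> r2 \<longrightarrow> (\<exists>W'. F2.subspace W' \<and> W' \<subseteq> W \<and> ((card W' = 2 ^ a \<and> (\<forall>x\<in>W' - {0}. \<not> g x)) \<or>
       (card W' = 2 ^ b' \<and> (\<forall>x\<in>W' - {0}. g x))))"
      using Suc(1) [of a b'] Suc(2) ab by auto
    \<comment> \<open>The zero vector has no colour, so the larger class has at least
      \<open>(card W - 1) / 2\<close> points, which is a quarter of \<open>card W\<close> or more
      once \<open>card W \<ge> 2\<close>.\<close>
    have quarter: "(0 :: real) < 1 / 4" by simp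
    define m where "m = r1 + r2"
    have m: "2 ^ m \<ge> r1" "2 ^ m \<ge> r2"
      using less_exp [of "r1 + r2"] unfolding m_def by linarith+
    obtain w0 where w0: "\<forall>W X. F2.subspace W \<and>
      finite W \<and>
      X \<subseteq> W \<and>
      card W \<ge> w0 \<and>
      1 / 4 * real (card W) \<le> card X \<longrightarrow> (\<exists>W' y. F2.subspace W' \<and> W' \<subseteq> W \<and> card W' = 2 ^ m \<and>
        y \<in> W \<and> (\<forall>w\<in>W'. y + w \<in> X))"
      using affine_cube [OF quarter, of m] by (elim exE conjE) (rule that)
    show ?thesis
    proof (intro exI[of _ "max w0 2"] allI impI)
      fix W g assume H: "F2.subspace W \<and> finite W \<and> card W \<ge> max w0 2"
      have *: "\<exists>W'. F2.subspace W' \<and> W' \<subseteq> W \<and> card W' = 2 ^ Suc j \<and> (\<forall>x\<in>W' - {0}. P x)"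
        if W1: "F2.subspace W1" "W1 \<subseteq> W" "y \<in> W" "\<forall>w\<in>W1. y + w \<in> {x\<in>W - {0}. P x}"
          and W2: "F2.subspace W2" "W2 \<subseteq> W1" "card W2 = 2 ^ j" "\<forall>x\<in>W2 - {0}. P x"
        for P W1 y W2 j
      proof (intro exI[of _ "adjoin y W2"] conjI)
        \<comment> \<open>Otherwise \<open>y + y = 0\<close> would lie in the colour class.\<close>
        have y: "y \<notin> W2" using W1(4) W2(2) by force
        show "F2.subspace (adjoin y W2)" using W2(1) by (rule subspace_adjoin)
        show "adjoin y W2 \<subseteq> W"
          using W1 W2 H F2.subspace_add by (auto simp: adjoin_def)
        show "card (adjoin y W2) = 2 ^ Suc j"
          using card_adjoin [OF W2(1) _ y] W2(2,3) W1(2) H by (simp add: finite_subset [of W2 W])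
        show "\<forall>x\<in>adjoin y W2 - {0}. P x"
          using W1(4) W2(2,4) by (auto simp: adjoin_def)
      qed
      let ?X0 = "{x\<in>W - {0}. \<not> g x}" and ?X1 = "{x\<in>W - {0}. g x}"
      have "card (?X0 \<union> ?X1) = card ?X0 + card ?X1"
        using H by (intro card_Un_disjoint) auto
      moreover have "?X0 \<union> ?X1 = W - {0}" by auto
      ultimately have "real (card ?X0) + card ?X1 = card W - 1"
        using H F2.subspace_0 by (simp add: card_Diff_singleton)
      moreover have "real (card W) \<ge> 2" using H by simp
      ultimately consider "1 / 4 * real (card W) \<le> card ?X0" | "1 / 4 * real (card W) \<le> card ?X1"
        by force
      then show "\<exists>W'. F2.subspace W' \<and> W' \<subseteq> W \<and> ((card W' = 2 ^ a \<and> (\<forall>x\<in>W' - {0}. \<not> g x)) \<or>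
       (card W' = 2 ^ b \<and> (\<forall>x\<in>W' - {0}. g x)))"
      proof cases
        case 1
        then obtain W1 y where W1: "F2.subspace W1" "W1 \<subseteq> W" "card W1 = 2 ^ m" "y \<in> W"
          "\<forall>w\<in>W1. y + w \<in> ?X0"
          using w0 [rule_format, of W ?X0] H by auto
        then obtain W2 where W2: "F2.subspace W2" "W2 \<subseteq> W1"
          "(card W2 = 2 ^ a' \<and> (\<forall>x\<in>W2 - {0}. \<not> g x)) \<or> (card W2 = 2 ^ b \<and> (\<forall>x\<in>W2 - {0}. g x))"
          using r1 [rule_format, of W1 g] m(1) H finite_subset by metis
        from W2(3) show ?thesis
        proof (elim disjE conjE)
          assume "card W2 = 2 ^ a'" "\<forall>x\<in>W2 - {0}. \<not> g x"
          then show ?thesis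
            using *[OF W1(1,2,4,5) W2(1,2)] ab(1) by blast
        qed (use W2 W1(2) in blast)
      next
        case 2
        then obtain W1 y where W1: "F2.subspace W1" "W1 \<subseteq> W" "card W1 = 2 ^ m" "y \<in> W"
          "\<forall>w\<in>W1. y + w \<in> ?X1"
          using w0 [rule_format, of W ?X1] H by auto
        then obtain W2 where W2: "F2.subspace W2" "W2 \<subseteq> W1"
          "(card W2 = 2 ^ a \<and> (\<forall>x\<in>W2 - {0}. \<not> g x)) \<or> (card W2 = 2 ^ b' \<and> (\<forall>x\<in>W2 - {0}. g x))"
          using r2 [rule_format, of W1 g] m(2) H finite_subset by metis
        from W2(3) show ?thesis
        proof (elim disjE conjE)
          assume "card W2 = 2 ^ b'" "\<forall>x\<in>W2 - {0}. g x"
          then show ?thesis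
            using *[OF W1(1,2,4,5) W2(1,2)] ab(2) by blast
        qed (use W2 W1(2) in blast)
      qed
    qed
  qed
qed

text \<open>\<open>bose_burton S C W\<close>: the complement of \<open>W\<close> in \<open>C \<oplus> W\<close> lies in \<open>S\<close>.\<close>

definition bose_burton :: "vec set \<Rightarrow> vec set \<Rightarrow> vec set \<Rightarrow> bool" where
  "bose_burton S C W \<longleftrightarrow> F2.subspace C \<and> F2.subspace W \<and> (\<forall>c\<in>C - {0}. \<forall>w\<in>W. c + w \<in> S)"

text \<open>Averaging over translates of \<open>W\<close> finds a \<open>v\<close> for which a share
  \<open>e\<close> of \<open>v + W\<close> consists of points whose translate of \<open>C\<close>
  lies in \<open>S\<close>. A coset \<open>y + W'\<close> inside that share gives the new direction
  \<open>x = v + y\<close>, and \<open>W\<close> shrinks to \<open>W'\<close>.\<close>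

lemma bose_burton_extend:
  fixes e :: real
  assumes "e > 0"
  shows "\<exists>w0. \<forall>V S C W. F2.subspace V \<and> finite V \<and> S \<subseteq> V - {0} \<and> bose_burton S C W \<and> C \<subseteq> V \<and>
    W \<subseteq> V \<and> card W \<ge> w0 \<and> e * card V \<le> card {v\<in>V. \<forall>c\<in>C. v + c \<in> S} \<longrightarrow>
    (\<exists>C' W'. bose_burton S C' W' \<and> C \<subseteq> C' \<and> C' \<subseteq> V \<and> W' \<subseteq> V \<and> card C' = 2 * card C \<and>
      card W' = 2 ^ m)"
proof -
  obtain w0 where w0: "\<forall>W X. F2.subspace W \<and>
      finite W \<and>
      X \<subseteq> W \<and>
      card W \<ge> w0 \<and>
      e * card W \<le> card X \<longrightarrow> (\<exists>W' y. F2.subspace W' \<and> W' \<subseteq> W \<and> card W' = 2 ^ m \<and>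
        y \<in> W \<and> (\<forall>w\<in>W'. y + w \<in> X))"
    using affine_cube [OF assms, of m] by (elim exE conjE) (rule that)
  show ?thesis
  proof (intro exI[of _ w0] allI impI)
    fix V S C W
    assume H: "F2.subspace V \<and> finite V \<and> S \<subseteq> V - {0} \<and> bose_burton S C W \<and> C \<subseteq> V \<and>
      W \<subseteq> V \<and> card W \<ge> w0 \<and> e * card V \<le> card {v\<in>V. \<forall>c\<in>C. v + c \<in> S}"
    define X where "X = {v\<in>V. \<forall>c\<in>C. v + c \<in> S}"
    have V: "F2.subspace V" "finite V" and SCW: "S \<subseteq> V - {0}" "C \<subseteq> V" "W \<subseteq> V" "card W \<ge> w0"
      and dense: "e * real (card V) \<le> real (card X)" and bb: "bose_burton S C W"
      using H by (simp_all add: X_def)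
    have sub: "F2.subspace C" "F2.subspace W" "\<And>c w. c \<in> C - {0} \<Longrightarrow> w \<in> W \<Longrightarrow> c + w \<in> S"
      using bb unfolding bose_burton_def by blast+
    have fin: "finite W" "finite C" using V SCW by (auto intro: finite_subset)
    have "(\<Sum>v\<in>V. card {w\<in>W. v + w \<in> X}) = card W * card X"
      using V SCW by (intro sum_overlap) (auto simp: X_def)
    then have "(\<Sum>v\<in>V. real (card {w\<in>W. v + w \<in> X})) = real (card W) * real (card X)"
      by (simp flip: of_nat_sum of_nat_mult)
    moreover have "real (card W) * (e * real (card V)) \<le> real (card W) * real (card X)"
      using dense by (intro mult_left_mono) auto
    ultimately have "e * card W * card V \<le> (\<Sum>v\<in>V. real (card {w\<in>W. v + w \<in> X}))"
      by (simp add: ac_simps)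
    moreover have "V \<noteq> {}" using F2.subspace_0 [OF V(1)] by auto
    ultimately obtain v where v: "v \<in> V" "e * card W \<le> card {w\<in>W. v + w \<in> X}"
      using exists_ge_average [of V "e * card W" "\<lambda>v. real (card {w\<in>W. v + w \<in> X})"] V(2)
      by auto
    obtain W' y where W': "F2.subspace W'" "W' \<subseteq> W" "card W' = 2 ^ m" "y \<in> W"
      "\<forall>w\<in>W'. y + w \<in> {w\<in>W. v + w \<in> X}"
      using w0 [rule_format, of W "{w\<in>W. v + w \<in> X}"] v(2) sub(2) fin(1) SCW(4)
      by auto
    define x where "x = v + y"
    have x: "x + c + w \<in> S" if "c \<in> C" "w \<in> W'" for c w
      using W'(5) that by (auto simp: X_def x_def ac_simps)
    \<comment> \<open>For \<open>x \<in> C\<close> the translate \<open>x + C\<close> would contain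
      0, which is not in \<open>S\<close>.\<close>
    have xC: "x \<notin> C" using x [of x 0] F2.subspace_0 [OF W'(1)] SCW(1) by auto
    show "\<exists>C' W'. bose_burton S C' W' \<and> C \<subseteq> C' \<and> C' \<subseteq> V \<and> W' \<subseteq> V \<and> card C' = 2 * card C \<and>
      card W' = 2 ^ m"
    proof (rule exI[of _ "adjoin x C"], rule exI[of _ W'], intro conjI W'(3))
      show "bose_burton S (adjoin x C) W'"
        unfolding bose_burton_def
      proof (intro conjI ballI subspace_adjoin sub(1) W'(1))
        fix c w assume c: "c \<in> adjoin x C - {0}" and w: "w \<in> W'"
        then consider "c \<in> C - {0}" | "x + c \<in> C" by (auto simp: adjoin_iff)
        then show "c + w \<in> S"
        proof cases
          case 1 then show ?thesis using sub(3) w W'(2) by auto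
        next
          case 2 then show ?thesis using x [OF 2 w] by (simp add: add.assoc)
        qed
      qed
      show "card (adjoin x C) = 2 * card C" using card_adjoin [OF sub(1) fin(2) xC] .
      have "x \<in> V" using v(1) W'(4) SCW(3) F2.subspace_add [OF V(1), of v y] by (auto simp: x_def)
      then show "adjoin x C \<subseteq> V" using SCW(2) F2.subspace_add [OF V(1)] by (auto simp: adjoin_def)
    qed (use W' SCW in \<open>auto simp: adjoin_def\<close>)
  qed
qed

text \<open>There are \<open>card C * card (V - S)\<close> pairs \<open>(v, c)\<close> with
  \<open>v + c\<close> outside \<open>S\<close>. A bad \<open>v\<close> uses at least one of them
  and a member of \<open>P\<close> at least two; this surplus later carries the construction past
  the extremal density.\<close>

lemma card_good_translates:
  assumes V: "F2.subspace V" "finite V" and S: "S \<subseteq> V" and C: "F2.subspace C" "C \<subseteq> V"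
    and P: "P \<subseteq> V" "\<And>v. v \<in> P \<Longrightarrow> \<exists>c\<in>C. \<exists>d\<in>C. c \<noteq> d \<and> v + c \<notin> S \<and> v + d \<notin> S"
  shows "card V + card P \<le> card {v\<in>V. \<forall>c\<in>C. v + c \<in> S} + card C * card (V - S)"
proof -
  let ?A = "{v\<in>V. \<forall>c\<in>C. v + c \<in> S}" and ?X = "\<lambda>v. card {c\<in>C. v + c \<in> V - S}"
  have fin: "finite C" "finite P" using C(2) P(1) V(2) by (auto intro: finite_subset)
  have VC: "v + c \<in> V" if "v \<in> V" "c \<in> C" for v c
    using that C(2) F2.subspace_add [OF V(1), of v c] by auto
  have le: "1 + of_bool (v \<in> P) \<le> of_bool (v \<in> ?A) + ?X v" if v: "v \<in> V" for v
  proof (cases "v \<in> P")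
    case True
    then obtain c d where cd: "c \<in> C" "d \<in> C" "c \<noteq> d" "v + c \<notin> S" "v + d \<notin> S"
      using P(2) by blast
    then have "card {c, d} \<le> ?X v"
      using fin v VC by (intro card_mono) auto
    with cd True show ?thesis by simp
  next
    case False
    show ?thesis
    proof (cases "v \<in> ?A")
      case False
      then obtain c where "c \<in> C" "v + c \<notin> S" using v by auto
      then have "card {c} \<le> ?X v" using fin v VC by (intro card_mono) auto
      with \<open>v \<notin> P\<close> show ?thesis by simp
    qed (use False in simp)
  qed
  have "card V + card P = (\<Sum>v\<in>V. 1 + of_bool (v \<in> P))"
  proof -
    have "(\<Sum>v\<in>V. of_bool (v \<in> P)) = (card P :: nat)"
      using V(2) P(1) by (simp add: of_bool_def sum.If_cases Int_absorb1)
    then show ?thesis by (simp only: sum.distrib) simp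
  qed
  also have "\<dots> \<le> (\<Sum>v\<in>V. of_bool (v \<in> ?A) + ?X v)"
    using le by (rule sum_mono)
  also have "\<dots> = card ?A + card C * card (V - S)"
    using V C sum_overlap [of V "V - S" C]
    by (simp add: sum.distrib of_bool_def sum.If_cases Int_def)
  finally show ?thesis .
qed

text \<open>\<open>2 ^ j\<close> is the present size of \<open>C\<close> and \<open>i\<close> the
  number of doublings to come. As the size condition refers to the final \<open>C\<close>, each step
  has a factor 2 to spare: at most 3/4 of the translates are spoiled and a quarter is good. So
  \<open>V - S\<close> may exceed the critical density \<open>1 / 2 ^ (i + j)\<close> by
  half.\<close>

lemma bose_burton_chain:
  "\<exists>w0. \<forall>V S C W. F2.subspace V \<and> finite V \<and> S \<subseteq> V - {0} \<and> bose_burton S C W \<and> C \<subseteq> V \<and> W \<subseteq> V \<and>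
    card W \<ge> w0 \<and> card C = 2 ^ j \<and> 2 ^ (i + j) * real (card (V - S)) \<le> 3 / 2 * real (card V) \<longrightarrow>
    (\<exists>C' W'. bose_burton S C' W' \<and> C \<subseteq> C' \<and> C' \<subseteq> V \<and> W' \<subseteq> V \<and> card C' = 2 ^ (i + j) \<and>
      card W' \<ge> m)"
proof (induction i arbitrary: j)
  case 0
  show ?case by (intro exI[of _ m]) auto
next
  case (Suc i)
  obtain w1 where w1: "\<forall>V S C W. F2.subspace V \<and>
      finite V \<and>
      S \<subseteq> V - {0} \<and>
      bose_burton S C W \<and>
      C \<subseteq> V \<and>
      W \<subseteq> V \<and>
      card W \<ge> w1 \<and>
      card C = 2 ^ Suc j \<and>
      2 ^ (i + Suc j) * real (card (V - S)) \<le> 3 / 2 * real (card V) \<longrightarrow> (\<exists>C' W'. bose_burton S C' W' \<and> C \<subseteq> C' \<and> C' \<subseteq> V \<and> W' \<subseteq> V \<and> card C' = 2 ^ (i + Suc j) \<and>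
      card W' \<ge> m)"
    using Suc.IH [of "Suc j"] by (elim exE conjE) (rule that)
  have quarter: "(0 :: real) < 1 / 4" by simp
  have w1': "w1 \<le> 2 ^ w1" using less_exp [of w1] by simp
  obtain w0 where w0: "\<forall>V S C W. F2.subspace V \<and>
      finite V \<and>
      S \<subseteq> V - {0} \<and>
      bose_burton S C W \<and>
      C \<subseteq> V \<and>
      W \<subseteq> V \<and>
      card W \<ge> w0 \<and>
      1 / 4 * real (card V) \<le> card {v\<in>V. \<forall>c\<in>C. v + c \<in> S} \<longrightarrow> (\<exists>C' W'. bose_burton S C' W' \<and> C \<subseteq> C' \<and> C' \<subseteq> V \<and> W' \<subseteq> V \<and> card C' = 2 * card C \<and>
      card W' = 2 ^ w1)"
    using bose_burton_extend [OF quarter, of w1] by (elim exE conjE) (rule that)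
  show ?case
  proof (intro exI[of _ w0] allI impI)
    fix V S C W
    assume H: "F2.subspace V \<and> finite V \<and> S \<subseteq> V - {0} \<and> bose_burton S C W \<and> C \<subseteq> V \<and> W \<subseteq> V \<and>
      card W \<ge> w0 \<and> card C = 2 ^ j \<and> 2 ^ (Suc i + j) * real (card (V - S)) \<le> 3 / 2 * real (card V)"
    have "2 * 2 ^ j * real (card (V - S)) \<le> 2 ^ (Suc i + j) * real (card (V - S))"
      by (intro mult_right_mono) (auto simp: power_add)
    then have T: "2 ^ j * real (card (V - S)) \<le> 3 / 4 * real (card V)"
      using H by auto
    have "card V + card ({} :: vec set) \<le> card {v\<in>V. \<forall>c\<in>C. v + c \<in> S} + card C * card (V - S)"
      by (rule card_good_translates) (use H in \<open>auto simp: bose_burton_def\<close>)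
    then have "real (card V) \<le> card {v\<in>V. \<forall>c\<in>C. v + c \<in> S} + real (card C) * card (V - S)"
      by (simp flip: of_nat_mult of_nat_add)
    then have "1 / 4 * real (card V) \<le> card {v\<in>V. \<forall>c\<in>C. v + c \<in> S}"
      using T H by simp
    then obtain C1 W1 where 1: "bose_burton S C1 W1" "C \<subseteq> C1" "C1 \<subseteq> V" "W1 \<subseteq> V"
        "card C1 = 2 * card C" "card W1 = 2 ^ w1"
      using w0 [rule_format, of V S C W] H by auto
    then obtain C' W' where "bose_burton S C' W'" "C1 \<subseteq> C'" "C' \<subseteq> V" "W' \<subseteq> V"
        "card C' = 2 ^ (i + Suc j)" "card W' \<ge> m"
      using w1 [rule_format, of V S C1 W1] H w1' by auto
    then show "\<exists>C' W'. bose_burton S C' W' \<and> C \<subseteq> C' \<and> C' \<subseteq> V \<and> W' \<subseteq> V \<and>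
        card C' = 2 ^ (Suc i + j) \<and> card W' \<ge> m"
      using 1(2) by (simp only: add_Suc add_Suc_right) blast
  qed
qed

text \<open>A stability version of the geometric Erdos-Stone theorem: by \<open>card_good_translates\<close>, the
  last extension step succeeds as soon as some \<open>u \<in> C\<close> has many \<open>t, t + u\<close> outside \<open>S\<close>.\<close>

lemma bose_burton_exists:
  fixes \<xi> :: real
  assumes \<xi>: "\<xi> > 0" and k: "k \<ge> 1"
  shows "\<exists>w0. \<forall>(V :: vec set) S \<beta>. F2.subspace V \<and> finite V \<and> card V \<ge> w0 \<and> S \<subseteq> V - {0} \<and>
    2 ^ k * real (card (V - S)) \<le> 3 / 2 * real (card V) \<and>
    \<xi> * real (card V) \<le> real (card {u\<in>S. \<beta> \<le> real (card {t\<in>V - S. u + t \<in> V - S})}) \<and>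
    \<xi> * real (card V) \<le> real (card V) - 2 ^ k * real (card (V - S)) + \<beta> \<longrightarrow>
    (\<exists>C W. C \<subseteq> V \<and> W \<subseteq> V \<and> bose_burton S C W \<and> card C = 2 ^ (k + 1) \<and> card W = 2 ^ m)"
proof -
  obtain w3 where w3: "\<forall>V S C W. F2.subspace V \<and>
      finite V \<and>
      S \<subseteq> V - {0} \<and>
      bose_burton S C W \<and>
      C \<subseteq> V \<and>
      W \<subseteq> V \<and>
      card W \<ge> w3 \<and>
      \<xi> * card V \<le> card {v\<in>V. \<forall>c\<in>C. v + c \<in> S} \<longrightarrow> (\<exists>C' W'. bose_burton S C' W' \<and> C \<subseteq> C' \<and> C' \<subseteq> V \<and> W' \<subseteq> V \<and> card C' = 2 * card C \<and>
      card W' = 2 ^ m)"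
    using bose_burton_extend [OF \<xi>, of m] by (elim exE conjE) (rule that)
  obtain w2 where w2: "\<forall>V S C W. F2.subspace V \<and>
      finite V \<and>
      S \<subseteq> V - {0} \<and>
      bose_burton S C W \<and>
      C \<subseteq> V \<and>
      W \<subseteq> V \<and>
      card W \<ge> w2 \<and>
      card C = 2 ^ 1 \<and>
      2 ^ (k - 1 + 1) * real (card (V - S)) \<le> 3 / 2 * real (card V) \<longrightarrow> (\<exists>C' W'. bose_burton S C' W' \<and> C \<subseteq> C' \<and> C' \<subseteq> V \<and> W' \<subseteq> V \<and> card C' = 2 ^ (k - 1 + 1) \<and>
      card W' \<ge> w3)"
    using bose_burton_chain [of 1 "k - 1" w3] by (elim exE conjE) (rule that)
  have w2': "w2 \<le> 2 ^ w2" using less_exp [of w2] by simp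
  obtain w1 where w1: "\<forall>W X. F2.subspace W \<and>
      finite W \<and>
      X \<subseteq> W \<and>
      card W \<ge> w1 \<and>
      \<xi> * card W \<le> card X \<longrightarrow> (\<exists>W' y. F2.subspace W' \<and> W' \<subseteq> W \<and> card W' = 2 ^ w2 \<and>
        y \<in> W \<and> (\<forall>w\<in>W'. y + w \<in> X))"
    using affine_cube [OF \<xi>, of w2] by (elim exE conjE) (rule that)
  show ?thesis
  proof (intro exI[of _ w1] allI impI)
    fix V S :: "vec set" and \<beta> :: real
    define X where "X = {u\<in>S. \<beta> \<le> real (card {t\<in>V - S. u + t \<in> V - S})}"
    assume H: "F2.subspace V \<and> finite V \<and> card V \<ge> w1 \<and> S \<subseteq> V - {0} \<and>
      2 ^ k * real (card (V - S)) \<le> 3 / 2 * real (card V) \<and>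
      \<xi> * real (card V) \<le> real (card {u\<in>S. \<beta> \<le> real (card {t\<in>V - S. u + t \<in> V - S})}) \<and>
      \<xi> * real (card V) \<le> real (card V) - 2 ^ k * real (card (V - S)) + \<beta>"
    \<comment> \<open>The popular differences are dense, so they contain a coset
      \<open>y + W1\<close>. The construction starts from \<open>C = {0, y}\<close>, which already
      has the popular difference needed for the last step.\<close>
    then obtain W1 y where W1: "F2.subspace W1" "W1 \<subseteq> V" "card W1 = 2 ^ w2" "y \<in> V"
        "\<forall>w\<in>W1. y + w \<in> X"
      using w1 [rule_format, of V X] by (auto simp: X_def)
    have yX: "y \<in> X" using W1(5) F2.subspace_0 [OF W1(1)] by (metis add.right_neutral)
    then have y: "y \<noteq> 0" using H by (auto simp: X_def)
    have C1: "adjoin y {0} = {0, y}" by (auto simp: adjoin_def)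
    have "bose_burton S {0, y} W1"
      using subspace_adjoin [of "{0}" y] W1 by (auto simp: bose_burton_def C1 X_def)
    then obtain C2 W2 where 2: "bose_burton S C2 W2" "{0, y} \<subseteq> C2" "C2 \<subseteq> V" "W2 \<subseteq> V"
        "card C2 = 2 ^ k" "card W2 \<ge> w3"
      using w2 [rule_format, of V S "{0, y}" W1] H w2' W1 y k F2.subspace_0 by auto
    let ?P = "{t\<in>V - S. y + t \<in> V - S}"
    \<comment> \<open>If \<open>v\<close> and \<open>v + y\<close> are both outside
      \<open>S\<close>, two elements of \<open>v + C2\<close> are spoiled at once; such
      \<open>v\<close> form the surplus in the count.\<close>
    have "card V + card ?P \<le> card {v\<in>V. \<forall>c\<in>C2. v + c \<in> S} + card C2 * card (V - S)"
    proof (rule card_good_translates)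
      fix v assume v: "v \<in> ?P"
      show "\<exists>c\<in>C2. \<exists>d\<in>C2. c \<noteq> d \<and> v + c \<notin> S \<and> v + d \<notin> S"
        by (rule bexI[of _ 0], rule bexI[of _ y]) (use v y 2(2) in \<open>auto simp: add.commute\<close>)
    qed (use H 2 in \<open>auto simp: bose_burton_def\<close>)
    then have "real (card V) + card ?P \<le> card {v\<in>V. \<forall>c\<in>C2. v + c \<in> S} + real (card C2) * card (V - S)"
      by (simp flip: of_nat_mult of_nat_add)
    moreover have "\<beta> \<le> card ?P" using yX by (simp add: X_def)
    ultimately have "\<xi> * card V \<le> card {v\<in>V. \<forall>c\<in>C2. v + c \<in> S}"
      using H 2(5) by simp
    then obtain C' W' where "bose_burton S C' W'" "C' \<subseteq> V" "W' \<subseteq> V" "card C' = 2 * card C2"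
        "card W' = 2 ^ m"
      using w3 [rule_format, of V S C2 W2] H 2 by blast
    then show "\<exists>C W. C \<subseteq> V \<and> W \<subseteq> V \<and> bose_burton S C W \<and> card C = 2 ^ (k + 1) \<and> card W = 2 ^ m"
      using 2(5) by auto
  qed
qed

section \<open>Random tuples\<close>

text \<open>A tuple is used as a linear map: \<open>lc D v\<close> sends the \<open>i\<close>-th
  unit vector to \<open>v i\<close>. Coordinates from \<open>D\<close> on are ignored, which makes
  it linear on the whole universe. A random tuple is thus a random linear map from
  \<open>F2_pow D\<close>.\<close>

definition lc :: "nat \<Rightarrow> (nat \<Rightarrow> vec) \<Rightarrow> vec \<Rightarrow> vec" where
  "lc D v c = (\<Sum>i<D. if c i = 1 then v i else 0)"

abbreviation tup :: "nat \<Rightarrow> vec set \<Rightarrow> (nat \<Rightarrow> vec) set" where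
  "tup D V \<equiv> {..<D} \<rightarrow>\<^sub>E V"

lemma card_tup: "card (tup D V) = card V ^ D"
  by (simp add: card_PiE)

lemma finite_tup: "finite V \<Longrightarrow> finite (tup D V)"
  by (simp add: finite_PiE)

lemma bit_add_eq_1: "a + b = (1 :: bit) \<longleftrightarrow> (a = 1) \<noteq> (b = 1)"
  by (cases a; cases b) simp_all

lemma lin_lc: "lin (lc D v)"
  unfolding lin_iff
proof (intro allI)
  fix c d :: vec
  have "(if (c + d) i = 1 then v i else 0) = (if c i = 1 then v i else 0) + (if d i = 1 then v i else 0)" for i
    by (auto simp: plus_fun_apply bit_add_eq_1)
  then show "lc D v (c + d) = lc D v c + lc D v d"
    by (simp add: lc_def sum.distrib)
qed

lemma lc_0 [simp]: "lc D v 0 = 0"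
  by (simp add: lc_def)

lemma lc_cong: "(\<And>i. i < D \<Longrightarrow> v i = w i) \<Longrightarrow> lc D v c = lc D w c"
  by (auto simp: lc_def intro!: sum.cong)

lemma lc_tuple_add: "lc D (\<lambda>i. v i + w i) c = lc D v c + lc D w c"
  unfolding lc_def sum.distrib [symmetric] by (rule sum.cong) auto

lemma lc_in:
  assumes "F2.subspace V" "\<And>i. i < D \<Longrightarrow> v i \<in> V"
  shows "lc D v c \<in> V"
  unfolding lc_def using assms by (intro F2.subspace_sum) (auto simp: F2.subspace_0)

lemma lin_sum: "lin h \<Longrightarrow> h (\<Sum>i\<in>A. g i) = (\<Sum>i\<in>A. h (g i))"
  by (rule F2p.linear_sum)

lemma lin_lc_comp:
  assumes "lin h" shows "h (lc D v c) = lc D (\<lambda>i. h (v i)) c"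
  unfolding lc_def lin_sum [OF assms] by (rule sum.cong) (auto simp: lin_0 [OF assms])

definition unit_vec :: "nat \<Rightarrow> vec" where
  "unit_vec i = (\<lambda>j. if j = i then 1 else 0)"

lemma sum_vec_apply: "(\<Sum>i\<in>A. f i :: vec) j = (\<Sum>i\<in>A. f i j)"
  by (induction A rule: infinite_finite_induct) (auto simp: plus_fun_apply)

lemma lc_unit_vec:
  assumes "c \<in> F2_pow D" shows "lc D unit_vec c = c"
proof
  fix j
  have "lc D unit_vec c j = (\<Sum>i<D. if i = j then c j else 0)"
    unfolding lc_def sum_vec_apply by (rule sum.cong) (auto simp: unit_vec_def)
  also have "\<dots> = c j"
    using assms by (auto simp: F2_pow_def)
  finally show "lc D unit_vec c j = c j" .
qed

text \<open>\<open>\<phi>\<close> is equidistributed on \<open>Y\<close>: adding a suitable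
  \<open>v0\<close> permutes the tuples and exchanges the fibre over \<open>z\<close> with the one
  over any given \<open>y\<close>, so all fibres have the same size.\<close>

lemma fibre_count:
  assumes V: "F2.subspace V" "finite V" and Y: "finite Y" "\<And>v. v \<in> tup D V \<Longrightarrow> \<phi> v \<in> Y"
    and shift: "\<And>y. y \<in> Y \<Longrightarrow> \<exists>v0\<in>tup D V. \<forall>v\<in>tup D V. \<phi> (\<lambda>i\<in>{..<D}. v i + v0 i) = y \<longleftrightarrow> \<phi> v = z"
  shows "card {v\<in>tup D V. Q (\<phi> v)} * card Y = card {y\<in>Y. Q y} * card V ^ D"
proof -
  have fin: "finite (tup D V)" using V by (simp add: finite_tup)
  define \<kappa> where "\<kappa> = card {v\<in>tup D V. \<phi> v = z}"
  have \<kappa>: "card {v\<in>tup D V. \<phi> v = y} = \<kappa>" if y: "y \<in> Y" for y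
  proof -
    obtain v0 where v0: "v0 \<in> tup D V"
      "\<forall>v\<in>tup D V. \<phi> (\<lambda>i\<in>{..<D}. v i + v0 i) = y \<longleftrightarrow> \<phi> v = z"
      using shift [OF y] by auto
    let ?s = "\<lambda>v. \<lambda>i\<in>{..<D}. v i + v0 i"
    have s: "?s v \<in> tup D V" if "v \<in> tup D V" for v
      using that v0(1) F2.subspace_add [OF V(1)] by (auto simp: PiE_iff)
    have ss: "?s (?s v) = v" if "v \<in> tup D V" for v
      using that by (auto simp: fun_eq_iff PiE_iff extensional_def add.assoc restrict_def)
    have "bij_betw ?s {v\<in>tup D V. \<phi> v = z} {v\<in>tup D V. \<phi> v = y}"
    proof (rule bij_betw_byWitness [where f' = ?s])
      show "\<forall>v\<in>{v \<in> tup D V. \<phi> v = z}. ?s (?s v) = v" "\<forall>v\<in>{v \<in> tup D V. \<phi> v = y}. ?s (?s v) = v"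
        using ss by auto
      show "?s ` {v \<in> tup D V. \<phi> v = z} \<subseteq> {v \<in> tup D V. \<phi> v = y}"
      proof (rule image_subsetI)
        fix v assume v: "v \<in> {v \<in> tup D V. \<phi> v = z}"
        then have "\<phi> (?s v) = y" using v0(2) by blast
        then show "?s v \<in> {v \<in> tup D V. \<phi> v = y}" using s [of v] v by simp
      qed
      show "?s ` {v \<in> tup D V. \<phi> v = y} \<subseteq> {v \<in> tup D V. \<phi> v = z}"
      proof
        fix w assume "w \<in> ?s ` {v \<in> tup D V. \<phi> v = y}"
        then obtain v where v: "v \<in> tup D V" "\<phi> v = y" "w = ?s v" by auto
        then have "\<phi> (?s w) = y" using ss by simp
        moreover have w: "w \<in> tup D V" using s [OF v(1)] v(3) by simp
        ultimately have "\<phi> w = z" using v0(2) by blast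
        then show "w \<in> {v \<in> tup D V. \<phi> v = z}" using w by simp
      qed
    qed
    then show ?thesis by (simp add: \<kappa>_def bij_betw_same_card)
  qed
  have *: "card {v\<in>tup D V. R (\<phi> v)} = card {y\<in>Y. R y} * \<kappa>" for R
  proof -
    have "card {v\<in>tup D V. R (\<phi> v)} = (\<Sum>y\<in>{y\<in>Y. R y}. card {v\<in>{v\<in>tup D V. R (\<phi> v)}. \<phi> v = y})"
      unfolding card_eq_sum by (rule sum.group [symmetric]) (use fin Y in auto)
    also have "\<dots> = (\<Sum>y\<in>{y\<in>Y. R y}. \<kappa>)"
    proof (rule sum.cong [OF refl])
      fix y assume y: "y \<in> {y\<in>Y. R y}"
      then have "{v\<in>{v\<in>tup D V. R (\<phi> v)}. \<phi> v = y} = {v\<in>tup D V. \<phi> v = y}" by auto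
      then show "card {v\<in>{v\<in>tup D V. R (\<phi> v)}. \<phi> v = y} = \<kappa>" using \<kappa> [of y] y by simp
    qed
    finally show ?thesis by simp
  qed
  from *[of "\<lambda>_. True"] have "card V ^ D = card Y * \<kappa>" by (simp add: card_tup)
  with *[of Q] show ?thesis by simp
qed

text \<open>The prescribed values extend to a linear map \<open>h\<close> whose range they span, and
  hence stay in \<open>V\<close>; the images of the unit vectors under \<open>h\<close> form the
  tuple.\<close>

lemma lc_surj:
  assumes V: "F2.subspace V" and I: "F2.independent I" "I \<subseteq> F2_pow D" and q: "\<And>c. c \<in> I \<Longrightarrow> q c \<in> V"
  obtains v0 where "v0 \<in> tup D V" "\<And>c. c \<in> I \<Longrightarrow> lc D v0 c = q c"
proof -
  obtain h where h: "lin h" "\<forall>c\<in>I. h c = q c" "range h = F2.span (q ` I)"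
    using F2p.linear_independent_extend_subspace [OF I(1), of q] by blast
  have "range h \<subseteq> V" unfolding h(3) using q V by (intro F2.span_minimal) auto
  then have "(\<lambda>i\<in>{..<D}. h (unit_vec i)) \<in> tup D V" by auto
  moreover have "lc D (\<lambda>i\<in>{..<D}. h (unit_vec i)) c = q c" if "c \<in> I" for c
  proof -
    have "lc D (\<lambda>i\<in>{..<D}. h (unit_vec i)) c = lc D (\<lambda>i. h (unit_vec i)) c"
      by (rule lc_cong) simp
    also have "\<dots> = h (lc D unit_vec c)" by (simp add: lin_lc_comp [OF h(1)])
    also have "lc D unit_vec c = c" using I(2) that by (intro lc_unit_vec) auto
    also have "h c = q c" using h(2) that by blast
    finally show ?thesis .
  qed
  ultimately show thesis using that by blast
qed

lemma lc_shift: "lc D (\<lambda>i\<in>{..<D}. v i + w i) c = lc D v c + lc D w c"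
proof -
  have "lc D (\<lambda>i\<in>{..<D}. v i + w i) c = lc D (\<lambda>i. v i + w i) c"
    by (rule lc_cong) simp
  then show ?thesis by (simp add: lc_tuple_add)
qed

section \<open>One-point and two-point distributions of a random tuple\<close>

lemma vec_add_eq_right: "x + y = y \<longleftrightarrow> x = (0 :: vec)"
  by simp

lemma count_single:
  assumes V: "F2.subspace V" "finite V" and c: "c \<in> F2_pow D" "c \<noteq> 0"
  shows "card {v\<in>tup D V. Q (lc D v c)} * card V = card {x\<in>V. Q x} * card V ^ D"
proof (rule fibre_count [OF V V(2)])
  show "lc D v c \<in> V" if "v \<in> tup D V" for v
    using that by (intro lc_in V) auto
  fix y assume y: "y \<in> V"
  obtain v0 where v0: "v0 \<in> tup D V" "lc D v0 c = y"
    by (rule lc_surj [OF V(1), of "{c}" D "\<lambda>_. y"]) (use c y in auto)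
  show "\<exists>v0\<in>tup D V. \<forall>v\<in>tup D V. lc D (\<lambda>i\<in>{..<D}. v i + v0 i) c = y \<longleftrightarrow> lc D v c = 0"
    by (rule bexI [OF _ v0(1)]) (simp add: lc_shift v0(2) vec_add_eq_right)
qed

text \<open>Over F_2 two distinct nonzero vectors are linearly independent, so the values of a
  random tuple at them are independent and uniform. The moment arguments below need no more
  randomness than this.\<close>

lemma count_pair:
  assumes V: "F2.subspace V" "finite V"
    and c: "c \<in> F2_pow D" "c \<noteq> 0" and d: "d \<in> F2_pow D" "d \<noteq> 0" "c \<noteq> d"
  shows "card {v\<in>tup D V. Q (lc D v c) (lc D v d)} * (card V)\<^sup>2 = card {p\<in>V \<times> V. Q (fst p) (snd p)} * card V ^ D"
proof -
  have "card {v\<in>tup D V. (\<lambda>p. Q (fst p) (snd p)) (lc D v c, lc D v d)} * card (V \<times> V) =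
    card {p\<in>V \<times> V. Q (fst p) (snd p)} * card V ^ D"
  proof (rule fibre_count [OF V])
    show "(lc D v c, lc D v d) \<in> V \<times> V" if "v \<in> tup D V" for v
      using that by (intro SigmaI lc_in V) auto
    fix y assume y: "y \<in> V \<times> V"
    have "F2.independent {c, d}"
    proof -
      have "F2.span {d} = {0, d}"
        by (auto simp: span_insert_eq_adjoin adjoin_def)
      then show ?thesis using c d by (auto simp: F2.independent_insert)
    qed
    then obtain v0 where v0: "v0 \<in> tup D V" "\<And>e. e \<in> {c, d} \<Longrightarrow> lc D v0 e = (if e = c then fst y else snd y)"
      by (rule lc_surj [OF V(1), of "{c, d}" D "\<lambda>e. if e = c then fst y else snd y"]) (use c d y in auto)
    then have e: "lc D v0 c = fst y" "lc D v0 d = snd y" using d by auto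
    show "\<exists>v0\<in>tup D V. \<forall>v\<in>tup D V. (lc D (\<lambda>i\<in>{..<D}. v i + v0 i) c, lc D (\<lambda>i\<in>{..<D}. v i + v0 i) d) = y
        \<longleftrightarrow> (lc D v c, lc D v d) = (0, 0)"
      by (rule bexI [OF _ v0(1)]) (auto simp: lc_shift e prod_eq_iff vec_add_eq_right)
  qed (use V in auto)
  then show ?thesis by (simp add: power2_eq_square card_cartesian_product)
qed

lemma count_single_real:
  assumes V: "F2.subspace V" "finite V" and c: "c \<in> F2_pow D" "c \<noteq> 0" and T: "T \<subseteq> V"
  shows "real (card {v\<in>tup D V. lc D v c \<in> T}) = real (card T) / real (card V) * real (card V) ^ D"
proof -
  have "card V > 0" using V F2.subspace_0 [OF V(1)] by (auto simp: card_gt_0_iff)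
  moreover have "real (card {v\<in>tup D V. lc D v c \<in> T} * card V) = real (card {x\<in>V. x \<in> T} * card V ^ D)"
    using count_single [OF V c, of "\<lambda>x. x \<in> T"] by simp
  moreover have "{x\<in>V. x \<in> T} = T" using T by auto
  ultimately show ?thesis by (simp add: field_simps)
qed

lemma count_pair_real:
  assumes V: "F2.subspace V" "finite V"
    and c: "c \<in> F2_pow D" "c \<noteq> 0" and d: "d \<in> F2_pow D" "d \<noteq> 0" "c \<noteq> d"
  shows "real (card {v\<in>tup D V. Q (lc D v c) (lc D v d)}) =
    real (card {p\<in>V \<times> V. Q (fst p) (snd p)}) / (real (card V))\<^sup>2 * real (card V) ^ D"
proof -
  have "card V > 0" using V F2.subspace_0 [OF V(1)] by (auto simp: card_gt_0_iff)
  moreover have "real (card {v\<in>tup D V. Q (lc D v c) (lc D v d)} * (card V)\<^sup>2) = real (card {p\<in>V \<times> V. Q (fst p) (snd p)} * card V ^ D)"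
    using count_pair [OF V c d, of Q] by simp
  ultimately show ?thesis by (simp add: field_simps)
qed

text \<open>Union bound over the nonzero vectors, each of which is in the kernel with probability
  \<open>1 / card V\<close>.\<close>

lemma not_inj_count:
  assumes V: "F2.subspace V" "finite V"
  shows "real (card {v\<in>tup D V. \<not> inj_on (lc D v) (F2_pow D)}) \<le> 2 ^ D / real (card V) * real (card V) ^ D"
proof -
  have fin: "finite (tup D V)" using V by (simp add: finite_tup)
  have "{v\<in>tup D V. \<not> inj_on (lc D v) (F2_pow D)} \<subseteq> (\<Union>c\<in>F2_pow D - {0}. {v\<in>tup D V. lc D v c \<in> {0}})"
    using lin_inj_on_iff [OF lin_lc subspace_F2_pow] by auto
  then have "card {v\<in>tup D V. \<not> inj_on (lc D v) (F2_pow D)} \<le> card (\<Union>c\<in>F2_pow D - {0}. {v\<in>tup D V. lc D v c \<in> {0}})"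
    using fin by (intro card_mono) auto
  also have "\<dots> \<le> (\<Sum>c\<in>F2_pow D - {0}. card {v\<in>tup D V. lc D v c \<in> {0}})"
    by (rule card_UN_le) simp
  finally have "real (card {v\<in>tup D V. \<not> inj_on (lc D v) (F2_pow D)}) \<le> (\<Sum>c\<in>F2_pow D - {0}. real (card {v\<in>tup D V. lc D v c \<in> {0}}))"
    by (simp flip: of_nat_sum)
  also have "\<dots> = (\<Sum>c\<in>F2_pow D - {0}. real (card {0::vec}) / real (card V) * real (card V) ^ D)"
    using F2.subspace_0 [OF V(1)] by (intro sum.cong refl count_single_real V) auto
  also have "\<dots> \<le> (\<Sum>c\<in>F2_pow D. real (card {0::vec}) / real (card V) * real (card V) ^ D)"
    by (intro sum_mono2) auto
  finally show ?thesis by simp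
qed

text \<open>By pairwise independence the centred indicators are uncorrelated, so their sum has
  variance at most \<open>2 ^ D\<close>. The summand 1 in the threshold allows for
  \<open>c = 0\<close>, whose image is always 0.\<close>

lemma chebyshev_tuples:
  fixes \<gamma> :: real
  assumes V: "F2.subspace V" "finite V" and T: "T \<subseteq> V" and \<gamma>: "\<gamma> > 0"
  defines "\<tau> \<equiv> real (card T) / real (card V)"
  shows "real (card {v\<in>tup D V. real (card {c\<in>F2_pow D. lc D v c \<in> T}) > (\<tau> + \<gamma>) * 2 ^ D + 1}) \<le>
    1 / (\<gamma>\<^sup>2 * 2 ^ D) * real (card V) ^ D"
proof -
  define N where "N = real (card V)"
  have N: "N > 0" using V F2.subspace_0 [OF V(1)] by (auto simp: card_gt_0_iff N_def)
  have fin: "finite (tup D V)" using V by (simp add: finite_tup)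
  have "card T \<le> card V" using V T by (simp add: card_mono)
  then have \<tau>: "0 \<le> \<tau>" "\<tau> \<le> 1" using N by (auto simp: \<tau>_def N_def divide_le_eq)
  define I where "I = F2_pow D - {0}"
  have I: "finite I" "card I \<le> 2 ^ D" by (auto simp: I_def card_Diff_singleton)
  define a where "a = (\<lambda>v c. of_bool (lc D v c \<in> T) - \<tau>)"
  define Z where "Z = (\<lambda>v. \<Sum>c\<in>I. a v c)"
  have E1: "(\<Sum>v\<in>tup D V. of_bool (lc D v c \<in> T)) = \<tau> * N ^ D" if "c \<in> I" for c
    using count_single_real [OF V _ _ T, of c D] that fin
    by (simp add: I_def \<tau>_def N_def of_bool_def sum.If_cases Int_def)
  have E2: "(\<Sum>v\<in>tup D V. of_bool (lc D v c \<in> T) * of_bool (lc D v d \<in> T)) = \<tau>\<^sup>2 * N ^ D"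
    if "c \<in> I" "d \<in> I" "c \<noteq> d" for c d
  proof -
    have "{p\<in>V \<times> V. fst p \<in> T \<and> snd p \<in> T} = T \<times> T" using T by auto
    then have "real (card {v\<in>tup D V. lc D v c \<in> T \<and> lc D v d \<in> T}) = \<tau>\<^sup>2 * N ^ D"
      using count_pair_real [OF V, of c D d "\<lambda>x y. x \<in> T \<and> y \<in> T"] that
      by (simp add: I_def \<tau>_def N_def card_cartesian_product power2_eq_square)
    then show ?thesis
      using fin by (simp add: sum.If_cases Int_def flip: of_bool_conj)
  qed
  have off: "(\<Sum>v\<in>tup D V. a v c * a v d) = 0" if "c \<in> I" "d \<in> I" "c \<noteq> d" for c d
  proof -
    have "(\<Sum>v\<in>tup D V. a v c * a v d) = (\<Sum>v\<in>tup D V. of_bool (lc D v c \<in> T) * of_bool (lc D v d \<in> T)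
        - \<tau> * of_bool (lc D v c \<in> T) - \<tau> * of_bool (lc D v d \<in> T) + \<tau>\<^sup>2)"
      by (intro sum.cong refl) (simp add: a_def algebra_simps power2_eq_square)
    also have "\<dots> = \<tau>\<^sup>2 * N ^ D - \<tau> * (\<tau> * N ^ D) - \<tau> * (\<tau> * N ^ D) + N ^ D * \<tau>\<^sup>2"
      unfolding sum.distrib sum_subtractf sum_distrib_left [symmetric] E1 [OF that(1)] E1 [OF that(2)] E2 [OF that]
      by (simp add: card_tup N_def)
    finally show ?thesis by (simp add: power2_eq_square)
  qed
  have "(\<Sum>v\<in>tup D V. (Z v)\<^sup>2) = (\<Sum>v\<in>tup D V. \<Sum>c\<in>I. \<Sum>d\<in>I. a v c * a v d)"
    by (simp add: Z_def power2_eq_square sum_product)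
  also have "\<dots> = (\<Sum>c\<in>I. \<Sum>v\<in>tup D V. \<Sum>d\<in>I. a v c * a v d)"
    by (rule sum.swap)
  also have "\<dots> = (\<Sum>c\<in>I. \<Sum>d\<in>I. \<Sum>v\<in>tup D V. a v c * a v d)"
    by (intro sum.cong refl sum.swap)
  also have "\<dots> = (\<Sum>c\<in>I. \<Sum>d\<in>I. if d = c then \<Sum>v\<in>tup D V. a v c * a v c else 0)"
    using off by (intro sum.cong refl) auto
  also have "\<dots> = (\<Sum>c\<in>I. \<Sum>v\<in>tup D V. a v c * a v c)"
    using I by simp
  also have "\<dots> \<le> (\<Sum>c\<in>I. \<Sum>v\<in>tup D V. 1)"
    using \<tau> by (intro sum_mono) (auto simp: a_def mult_le_one abs_square_le_1 simp flip: power2_eq_square)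
  also have "\<dots> = card I * N ^ D" by (simp add: card_tup N_def)
  also have "\<dots> \<le> 2 ^ D * N ^ D" using I(2) N by (intro mult_right_mono) (auto simp: of_nat_le_iff [symmetric])
  finally have var: "(\<Sum>v\<in>tup D V. (Z v)\<^sup>2) \<le> 2 ^ D * N ^ D" .
  define B where "B = {v\<in>tup D V. real (card {c\<in>F2_pow D. lc D v c \<in> T}) > (\<tau> + \<gamma>) * 2 ^ D + 1}"
  have ZB: "(\<gamma> * 2 ^ D)\<^sup>2 \<le> (Z v)\<^sup>2" if "v \<in> B" for v
  proof -
    have "card {c\<in>F2_pow D. lc D v c \<in> T} \<le> card (insert 0 {c\<in>I. lc D v c \<in> T})"
      using I by (intro card_mono) (auto simp: I_def)
    also have "\<dots> \<le> card {c\<in>I. lc D v c \<in> T} + 1" using I by (simp add: card_insert_if)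
    finally have "real (card {c\<in>F2_pow D. lc D v c \<in> T}) \<le> card {c\<in>I. lc D v c \<in> T} + 1" by simp
    moreover have "Z v = card {c\<in>I. lc D v c \<in> T} - \<tau> * card I"
      using I by (simp add: Z_def a_def sum_subtractf of_bool_def sum.If_cases Int_def mult.commute)
    moreover have "\<tau> * card I \<le> \<tau> * 2 ^ D"
      using \<tau> I by (intro mult_left_mono) (auto simp: of_nat_le_iff [symmetric])
    ultimately have "\<gamma> * 2 ^ D \<le> Z v" using that by (simp add: B_def algebra_simps)
    then show ?thesis using \<gamma> by (intro power_mono) auto
  qed
  have "card B * (\<gamma> * 2 ^ D)\<^sup>2 = (\<Sum>v\<in>B. (\<gamma> * 2 ^ D)\<^sup>2)" by simp
  also have "\<dots> \<le> (\<Sum>v\<in>B. (Z v)\<^sup>2)" using ZB by (rule sum_mono)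
  also have "\<dots> \<le> (\<Sum>v\<in>tup D V. (Z v)\<^sup>2)" using fin by (intro sum_mono2) (auto simp: B_def)
  also note var
  finally have "(card B * (\<gamma>\<^sup>2 * 2 ^ D)) * 2 ^ D \<le> N ^ D * 2 ^ D"
    by (simp add: power_mult_distrib power2_eq_square algebra_simps)
  then have "card B * (\<gamma>\<^sup>2 * 2 ^ D) \<le> N ^ D" by (rule mult_right_le_imp_le) simp
  then have "card B \<le> N ^ D / (\<gamma>\<^sup>2 * 2 ^ D)" using \<gamma> by (simp add: pos_le_divide_eq)
  then show ?thesis by (simp add: B_def N_def)
qed

text \<open>A reverse Markov inequality. The mean number of pairs is at least
  \<open>\<rho> / 4 * 4 ^ D\<close> and the maximum is \<open>4 ^ D\<close>, so a share
  \<open>\<rho> / 8\<close> of the tuples attains half of this mean.\<close>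

lemma sum_pairs_tuples:
  fixes \<rho> :: real
  assumes V: "F2.subspace V" "finite V" and S: "S \<subseteq> V" "T \<subseteq> V" and D: "D \<ge> 2"
    and \<rho>: "\<rho> * (real (card V))\<^sup>2 \<le> (\<Sum>u\<in>S. real (card {t\<in>T. u + t \<in> T}))" and \<rho>0: "\<rho> \<ge> 0"
  defines "S' \<equiv> \<lambda>v. {c\<in>F2_pow D. lc D v c \<in> S}" and "T' \<equiv> \<lambda>v. {c\<in>F2_pow D. lc D v c \<in> T}"
  shows "\<rho> / 8 * real (card V) ^ D \<le> real (card {v\<in>tup D V. \<rho> / 8 * 4 ^ D \<le>
    (\<Sum>u\<in>S' v. real (card {t\<in>T' v. u + t \<in> T' v}))})"
proof -
  define N where "N = real (card V)"
  have N: "N > 0" using V F2.subspace_0 [OF V(1)] by (auto simp: card_gt_0_iff N_def)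
  have fin: "finite (tup D V)" using V by (simp add: finite_tup)
  have finST: "finite S" "finite T" using S V by (auto intro: finite_subset)
  let ?F = "F2_pow D"
  define Q where "Q = (\<lambda>x y. x \<in> S \<and> y \<in> T \<and> x + y \<in> T)"
  define Pr where "Pr = (\<lambda>v. \<Sum>u\<in>S' v. real (card {t\<in>T' v. u + t \<in> T' v}))"
  have PrQ: "Pr v = (\<Sum>c\<in>?F. \<Sum>d\<in>?F. of_bool (Q (lc D v c) (lc D v d)))" for v
  proof -
    have "(\<Sum>d\<in>?F. of_bool (Q (lc D v c) (lc D v d))) =
        (if lc D v c \<in> S then real (card {t\<in>T' v. c + t \<in> T' v}) else 0)" if "c \<in> ?F" for c
    proof -
      have "{d\<in>?F. Q (lc D v c) (lc D v d)} = (if lc D v c \<in> S then {t\<in>T' v. c + t \<in> T' v} else {})"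
        using F2.subspace_add [OF subspace_F2_pow that] lin_add [OF lin_lc, of D v] by (auto simp: Q_def T'_def)
      then show ?thesis by (simp add: of_bool_def sum.If_cases Int_def)
    qed
    then have "(\<Sum>c\<in>?F. \<Sum>d\<in>?F. of_bool (Q (lc D v c) (lc D v d))) =
       (\<Sum>c\<in>?F. if lc D v c \<in> S then real (card {t\<in>T' v. c + t \<in> T' v}) else 0)"
      by (rule sum.cong [OF refl])
    also have "\<dots> = Pr v" by (simp add: Pr_def S'_def sum.If_cases Int_def)
    finally show ?thesis by simp
  qed
  have cQ: "\<rho> \<le> card {p\<in>V \<times> V. Q (fst p) (snd p)} / N\<^sup>2"
  proof -
    have "{p\<in>V \<times> V. Q (fst p) (snd p)} = (SIGMA u:S. {t\<in>T. u + t \<in> T})"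
      using S by (auto simp: Q_def)
    then have "card {p\<in>V \<times> V. Q (fst p) (snd p)} = (\<Sum>u\<in>S. card {t\<in>T. u + t \<in> T})"
      using finST by (simp add: card_SigmaI)
    then show ?thesis using \<rho> N by (simp add: N_def pos_le_divide_eq)
  qed
  have lower: "\<rho> * N ^ D \<le> (\<Sum>v\<in>tup D V. of_bool (Q (lc D v c) (lc D v d)))"
    if "c \<in> ?F - {0}" "d \<in> ?F - {0} - {c}" for c d
  proof -
    have "(\<Sum>v\<in>tup D V. of_bool (Q (lc D v c) (lc D v d))) = real (card {v\<in>tup D V. Q (lc D v c) (lc D v d)})"
      using fin by (simp add: of_bool_def sum.If_cases Int_def)
    also have "\<dots> = real (card {p\<in>V \<times> V. Q (fst p) (snd p)}) / N\<^sup>2 * N ^ D"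
      unfolding N_def using that by (intro count_pair_real V) auto
    finally show ?thesis using cQ N by (simp only:) (intro mult_right_mono, auto)
  qed
  have card1: "card (?F - {0}) = 2 ^ D - 1" "\<And>c. c \<in> ?F - {0} \<Longrightarrow> card (?F - {0} - {c}) = 2 ^ D - 2"
    by (simp_all add: card_Diff_singleton)
  have four: "(4::nat) \<le> 2 ^ D" using D power_increasing [of 2 D "2::nat"] by simp
  \<comment> \<open>Only ordered pairs of distinct nonzero coefficient vectors have a known joint
    distribution; for \<open>D \<ge> 2\<close> they are at least a quarter of all pairs.\<close>
  have "4 ^ D / 4 \<le> (2 ^ D - 1) * (2 ^ D - 2 :: real)"
  proof -
    have "(4::real) ^ D = 2 ^ D * 2 ^ D" by (simp flip: power_mult_distrib)
    moreover have "(2::real) ^ D / 2 \<le> 2 ^ D - 1" "(2::real) ^ D / 2 \<le> 2 ^ D - 2"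
      using four by (simp_all flip: of_nat_le_iff [where 'a = real])
    then have "(2::real) ^ D / 2 * (2 ^ D / 2) \<le> (2 ^ D - 1) * (2 ^ D - 2)"
      by (intro mult_mono) auto
    ultimately show ?thesis by simp
  qed
  then have "\<rho> * N ^ D * (4 ^ D / 4) \<le> \<rho> * N ^ D * ((2 ^ D - 1) * (2 ^ D - 2))"
    using \<rho>0 N by (intro mult_left_mono) auto
  also have "\<dots> = (\<Sum>c\<in>?F - {0}. \<Sum>d\<in>?F - {0} - {c}. \<rho> * N ^ D)"
    using card1 four by (simp add: of_nat_diff)
  also have "\<dots> \<le> (\<Sum>c\<in>?F - {0}. \<Sum>d\<in>?F - {0} - {c}. \<Sum>v\<in>tup D V. of_bool (Q (lc D v c) (lc D v d)))"
    by (intro sum_mono lower)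
  also have "\<dots> \<le> (\<Sum>c\<in>?F - {0}. \<Sum>d\<in>?F. \<Sum>v\<in>tup D V. of_bool (Q (lc D v c) (lc D v d)))"
    by (rule sum_mono, rule sum_mono2) (simp, blast, simp add: sum_nonneg)
  also have "\<dots> \<le> (\<Sum>c\<in>?F. \<Sum>d\<in>?F. \<Sum>v\<in>tup D V. of_bool (Q (lc D v c) (lc D v d)))"
    by (rule sum_mono2) (simp, blast, simp add: sum_nonneg)
  also have "\<dots> = (\<Sum>c\<in>?F. \<Sum>v\<in>tup D V. \<Sum>d\<in>?F. of_bool (Q (lc D v c) (lc D v d)))"
    by (intro sum.cong refl sum.swap)
  also have "\<dots> = (\<Sum>v\<in>tup D V. Pr v)"
    unfolding PrQ by (rule sum.swap)
  also have "\<dots> \<le> (\<Sum>v\<in>tup D V. (if \<rho> / 8 * 4 ^ D \<le> Pr v then 4 ^ D else 0) + \<rho> / 8 * 4 ^ D)"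
  proof (rule sum_mono)
    fix v
    have "Pr v \<le> (\<Sum>c\<in>?F. \<Sum>d\<in>?F. 1)"
      unfolding PrQ by (intro sum_mono) auto
    also have "\<dots> = 4 ^ D" by (simp flip: power_mult_distrib)
    finally have "Pr v \<le> 4 ^ D" .
    moreover have "0 \<le> \<rho> / 8 * 4 ^ D" using \<rho>0 by simp
    ultimately show "Pr v \<le> (if \<rho> / 8 * 4 ^ D \<le> Pr v then 4 ^ D else 0) + \<rho> / 8 * 4 ^ D"
      by (simp only: if_splits split: if_split) linarith
  qed
  also have "\<dots> = 4 ^ D * real (card {v\<in>tup D V. \<rho> / 8 * 4 ^ D \<le> Pr v}) + \<rho> / 8 * 4 ^ D * N ^ D"
    using fin by (simp add: sum.distrib sum.If_cases Int_def card_tup N_def)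
  finally have "\<rho> * N ^ D * (4 ^ D / 4) \<le>
    4 ^ D * real (card {v\<in>tup D V. \<rho> / 8 * 4 ^ D \<le> Pr v}) + \<rho> / 8 * 4 ^ D * N ^ D" .
  moreover have "4 ^ D * (\<rho> / 8 * N ^ D) = \<rho> * N ^ D * (4 ^ D / 4) - \<rho> / 8 * 4 ^ D * N ^ D"
    by (simp add: algebra_simps)
  ultimately have "4 ^ D * (\<rho> / 8 * N ^ D) \<le> 4 ^ D * real (card {v\<in>tup D V. \<rho> / 8 * 4 ^ D \<le> Pr v})"
    by linarith
  then have "\<rho> / 8 * N ^ D \<le> card {v\<in>tup D V. \<rho> / 8 * 4 ^ D \<le> Pr v}"
    by (rule mult_left_le_imp_le) simp
  then show ?thesis by (simp add: Pr_def N_def)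
qed

text \<open>The configuration is sought in coefficient space, in the preimage of \<open>S\<close>;
  injectivity transports it to the ground space without loss of dimension.\<close>

definition sees_bb :: "nat \<Rightarrow> nat \<Rightarrow> nat \<Rightarrow> vec set \<Rightarrow> (nat \<Rightarrow> vec) \<Rightarrow> bool" where
  "sees_bb k m D S v \<longleftrightarrow> inj_on (lc D v) (F2_pow D) \<and> (\<exists>C W. C \<subseteq> F2_pow D \<and> W \<subseteq> F2_pow D \<and>
     bose_burton {c\<in>F2_pow D. lc D v c \<in> S} C W \<and> card C = 2 ^ (k + 1) \<and> card W = 2 ^ m)"

text \<open>This is \<open>bose_burton_exists\<close> for a random sample of \<open>V\<close>: Chebyshev's inequality controls the
  size of the complement of \<open>S\<close> in the sample, and a first moment bound its additive pairs.\<close>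

lemma many_bose_burton:
  fixes \<rho> :: real
  assumes \<rho>: "0 < \<rho>" "\<rho> \<le> 1" and k: "k \<ge> 1"
  shows "\<exists>D\<ge>1. \<exists>n0. \<forall>V S. F2.subspace V \<and> finite V \<and> card V \<ge> n0 \<and> S \<subseteq> V - {0} \<and>
    2 ^ k * real (card (V - S)) \<le> (1 + \<rho> / 128) * real (card V) \<and>
    (\<rho> * (real (card V))\<^sup>2 \<le> (\<Sum>u\<in>S. real (card {t\<in>V - S. u + t \<in> V - S})) \<or>
     2 ^ k * real (card (V - S)) \<le> (1 - \<rho>) * real (card V)) \<longrightarrow>
    \<rho> / 16 * real (card V) ^ D \<le> real (card {v\<in>tup D V. sees_bb k m D S v})"
proof -
  define \<xi> where "\<xi> = \<rho> / 32"
  have \<xi>: "\<xi> > 0" using \<rho> by (simp add: \<xi>_def)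
  obtain w0 where w0: "\<forall>V S \<beta>. F2.subspace V \<and> finite V \<and> card V \<ge> w0 \<and> S \<subseteq> V - {0} \<and>
    2 ^ k * real (card (V - S)) \<le> 3 / 2 * real (card V) \<and>
    \<xi> * real (card V) \<le> real (card {u\<in>S. \<beta> \<le> real (card {t\<in>V - S. u + t \<in> V - S})}) \<and>
    \<xi> * real (card V) \<le> real (card V) - 2 ^ k * real (card (V - S)) + \<beta> \<longrightarrow>
    (\<exists>C W. C \<subseteq> V \<and> W \<subseteq> V \<and> bose_burton S C W \<and> card C = 2 ^ (k + 1) \<and> card W = 2 ^ m)"
    using bose_burton_exists [OF \<xi> k, of m] by (elim exE conjE) (rule that)
  \<comment> \<open>Errors are measured in units of \<open>\<rho> / 128\<close>, relative to the
    critical density. The hypothesis allows one, \<open>2 ^ k * \<gamma>\<close> is a second, and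
    the additive 1 in \<open>chebyshev_tuples\<close> becomes a third for large \<open>D\<close>;
    together they stay below \<open>\<xi> = \<rho> / 32\<close>.\<close>
  define \<gamma> where "\<gamma> = \<rho> / (2 ^ k * 128)"
  have \<gamma>: "\<gamma> > 0" using \<rho> by (simp add: \<gamma>_def)
  define x where "x = max (2 ^ k * 128 / \<rho>) (32 / (\<rho> * \<gamma>\<^sup>2))"
  obtain D1 where D1: "x < 2 ^ D1" using real_arch_pow [of 2 x] by auto
  define D where "D = D1 + w0 + 2"
  have D: "D \<ge> 2" "w0 \<le> 2 ^ D" "x \<le> 2 ^ D"
  proof -
    show "w0 \<le> 2 ^ D"
      using less_exp [of w0] power_increasing [of w0 D "2 :: nat"] unfolding D_def by linarith
    have "(2::real) ^ D1 \<le> 2 ^ D" by (rule power_increasing) (auto simp: D_def)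
    with D1 show "x \<le> 2 ^ D" by linarith
  qed (simp add: D_def)
  have D2: "2 ^ k \<le> \<rho> / 128 * 2 ^ D" "1 / (\<gamma>\<^sup>2 * 2 ^ D) \<le> \<rho> / 32"
  proof -
    have "2 ^ k * 128 / \<rho> \<le> 2 ^ D" "32 / (\<rho> * \<gamma>\<^sup>2) \<le> 2 ^ D" using D(3) by (auto simp: x_def)
    then show "2 ^ k \<le> \<rho> / 128 * 2 ^ D" "1 / (\<gamma>\<^sup>2 * 2 ^ D) \<le> \<rho> / 32"
      using \<rho> \<gamma> by (auto simp: field_simps)
  qed
  define n0 where "n0 = nat \<lceil>2 ^ D * 32 / \<rho>\<rceil> + 1"
  show ?thesis
  proof (rule exI[of _ D], rule conjI, use D in simp, rule exI[of _ n0], intro allI impI)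
    fix V S assume H: "F2.subspace V \<and> finite V \<and> card V \<ge> n0 \<and> S \<subseteq> V - {0} \<and>
      2 ^ k * real (card (V - S)) \<le> (1 + \<rho> / 128) * real (card V) \<and>
      (\<rho> * (real (card V))\<^sup>2 \<le> (\<Sum>u\<in>S. real (card {t\<in>V - S. u + t \<in> V - S})) \<or>
       2 ^ k * real (card (V - S)) \<le> (1 - \<rho>) * real (card V))"
    then have V: "F2.subspace V" "finite V" and S: "S \<subseteq> V - {0}" and n0: "card V \<ge> n0" by simp_all
    define T where "T = V - S"
    define N where "N = real (card V)"
    define \<tau> where "\<tau> = real (card T) / N"
    have N: "N > 0" using V F2.subspace_0 [OF V(1)] by (auto simp: card_gt_0_iff N_def)
    have \<tau>_le: "2 ^ k * \<tau> \<le> x \<longleftrightarrow> 2 ^ k * real (card (V - S)) \<le> x * real (card V)" for x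
      using N by (simp add: \<tau>_def N_def T_def pos_divide_le_eq)
    have alt: "\<rho> * N\<^sup>2 \<le> (\<Sum>u\<in>S. real (card {t\<in>T. u + t \<in> T})) \<or> 2 ^ k * \<tau> \<le> 1 - \<rho>"
      and \<tau>: "2 ^ k * \<tau> \<le> 1 + \<rho> / 128"
      unfolding \<tau>_le using H by (simp_all add: N_def T_def)
    have fin: "finite (tup D V)" using V by (simp add: finite_tup)
    have TV: "T \<subseteq> V" "S \<subseteq> V" using S by (auto simp: T_def)
    have "2 ^ D * 32 / \<rho> \<le> real n0" by (simp add: n0_def) linarith
    then have "2 ^ D * 32 / \<rho> \<le> N" using n0 by (simp add: N_def)
    then have nN: "2 ^ D / N \<le> \<rho> / 32" using N \<rho> by (simp add: field_simps)
    define S' where "S' = (\<lambda>v. {c\<in>F2_pow D. lc D v c \<in> S})"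
    define T' where "T' = (\<lambda>v. {c\<in>F2_pow D. lc D v c \<in> T})"
    have S'T': "F2_pow D - S' v = T' v" "S' v \<subseteq> F2_pow D - {0}" "finite (S' v)" "finite (T' v)" if "v \<in> tup D V" for v
    proof -
      have "lc D v c \<in> V" for c using that by (intro lc_in V) auto
      then show "F2_pow D - S' v = T' v" by (auto simp: S'_def T'_def T_def)
      show "S' v \<subseteq> F2_pow D - {0}" using S by (auto simp: S'_def)
    qed (auto simp: S'_def T'_def)
    define B1 where "B1 = {v\<in>tup D V. real (card (T' v)) > (\<tau> + \<gamma>) * 2 ^ D + 1}"
    define B2 where "B2 = {v\<in>tup D V. \<not> inj_on (lc D v) (F2_pow D)}"
    \<comment> \<open>\<open>G\<close> has a share of at least \<open>\<rho> / 8\<close>, and the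
      two exceptional sets \<open>B1\<close> and \<open>B2\<close> of share
      \<open>\<rho> / 32\<close> each leave \<open>\<rho> / 16\<close>.\<close>
    define G where "G = (if 2 ^ k * \<tau> \<le> 1 - \<rho> then tup D V else
      {v\<in>tup D V. \<rho> / 8 * 4 ^ D \<le> (\<Sum>u\<in>S' v. real (card {t\<in>T' v. u + t \<in> T' v}))})"
    have B1: "real (card B1) \<le> \<rho> / 32 * N ^ D"
    proof -
      have "real (card B1) \<le> 1 / (\<gamma>\<^sup>2 * 2 ^ D) * N ^ D"
        using chebyshev_tuples [OF V TV(1) \<gamma>, of D] by (simp add: B1_def T'_def \<tau>_def N_def)
      also have "\<dots> \<le> \<rho> / 32 * N ^ D" using D2 N by (intro mult_right_mono) auto
      finally show ?thesis .
    qed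
    have B2: "real (card B2) \<le> \<rho> / 32 * N ^ D"
    proof -
      have "real (card B2) \<le> 2 ^ D / N * N ^ D"
        using not_inj_count [OF V, of D] by (simp add: B2_def N_def)
      also have "\<dots> \<le> \<rho> / 32 * N ^ D" using nN N by (intro mult_right_mono) auto
      finally show ?thesis .
    qed
    have G: "\<rho> / 8 * N ^ D \<le> real (card G)"
    proof (cases "2 ^ k * \<tau> \<le> 1 - \<rho>")
      case True
      have "\<rho> / 8 * N ^ D \<le> 1 * N ^ D" using \<rho> N by (intro mult_right_mono) auto
      with True show ?thesis by (simp add: G_def card_tup N_def)
    next
      case False
      then show ?thesis
        using sum_pairs_tuples [OF V TV(2,1) D(1), of \<rho>] alt \<rho> by (simp add: G_def S'_def T'_def N_def)
    qed
    have sees: "sees_bb k m D S v" if v: "v \<in> G - B1 - B2" for v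
    proof -
      have vt: "v \<in> tup D V" using v by (auto simp: G_def split: if_splits)
      have inj: "inj_on (lc D v) (F2_pow D)" using v vt by (auto simp: B2_def)
      let ?F = "F2_pow D"
      have cT: "2 ^ k * real (card (T' v)) \<le> (2 ^ k * \<tau> + \<rho> / 64) * 2 ^ D"
      proof -
        have "real (card (T' v)) \<le> (\<tau> + \<gamma>) * 2 ^ D + 1" using v vt by (auto simp: B1_def)
        then have "2 ^ k * real (card (T' v)) \<le> 2 ^ k * ((\<tau> + \<gamma>) * 2 ^ D + 1)" by (rule mult_left_mono) simp
        also have "\<dots> = (2 ^ k * \<tau> + \<rho> / 128) * 2 ^ D + 2 ^ k" by (simp add: \<gamma>_def algebra_simps)
        also have "\<dots> \<le> (2 ^ k * \<tau> + \<rho> / 128) * 2 ^ D + \<rho> / 128 * 2 ^ D" using D2 by simp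
        finally show ?thesis by (simp add: algebra_simps)
      qed
      have cT3: "2 ^ k * real (card (T' v)) \<le> (1 + 3 * \<rho> / 128) * 2 ^ D"
      proof -
        have "(2 ^ k * \<tau> + \<rho> / 64) * 2 ^ D \<le> (1 + 3 * \<rho> / 128) * 2 ^ D"
          using \<tau> by (intro mult_right_mono) auto
        with cT show ?thesis by linarith
      qed
      have le32: "2 ^ k * real (card (T' v)) \<le> 3 / 2 * 2 ^ D"
      proof -
        have "(1 + 3 * \<rho> / 128) * 2 ^ D \<le> (3 / 2) * (2 ^ D :: real)" using \<rho> by (intro mult_right_mono) auto
        with cT3 show ?thesis by linarith
      qed
      \<comment> \<open>If \<open>T\<close> is below the critical density by \<open>\<rho>\<close>,
        its size alone gives the slack, and \<open>\<beta> = 0\<close> makes every element of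
        \<open>S' v\<close> popular. Otherwise \<open>T' v\<close> may be slightly above the
        critical size, and differences of popularity \<open>\<rho> / 16 * 2 ^ D\<close> make up for
        it.\<close>
      have "\<exists>\<beta>. \<xi> * 2 ^ D \<le> real (card {u\<in>S' v. \<beta> \<le> real (card {t\<in>T' v. u + t \<in> T' v})}) \<and>
        \<xi> * 2 ^ D \<le> 2 ^ D - 2 ^ k * real (card (T' v)) + \<beta>"
      proof (cases "2 ^ k * \<tau> \<le> 1 - \<rho>")
        case True
        have "(2::real) * card (T' v) \<le> 2 ^ k * real (card (T' v))"
          using power_increasing [of 1 k "2::real"] k by (intro mult_right_mono) auto
        moreover have "card (S' v) + card (T' v) = 2 ^ D"
        proof -
          have "card (?F - S' v) = card ?F - card (S' v)" "card (S' v) \<le> card ?F"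
            using S'T'(2,3) [OF vt] by (auto intro!: card_Diff_subset card_mono simp del: card_F2_pow)
          then show ?thesis using S'T' [OF vt] by simp
        qed
        then have "real (card (S' v)) + card (T' v) = 2 ^ D"
          by (simp flip: of_nat_add add: of_nat_power [symmetric] del: of_nat_power)
        ultimately have "1 / 4 * 2 ^ D \<le> real (card (S' v))" using le32 by simp
        moreover have "\<xi> * 2 ^ D \<le> 1 / 4 * 2 ^ D" using \<rho> by (intro mult_right_mono) (auto simp: \<xi>_def)
        ultimately have 1: "\<xi> * 2 ^ D \<le> real (card (S' v))" by linarith
        have "(2 ^ k * \<tau> + \<rho> / 64) * 2 ^ D \<le> (1 - \<xi>) * 2 ^ D"
          using True \<rho> by (intro mult_right_mono) (auto simp: \<xi>_def)
        have 2: "\<xi> * 2 ^ D \<le> 2 ^ D - 2 ^ k * real (card (T' v))"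
        proof -
          have "(1 - \<xi>) * 2 ^ D = 2 ^ D - \<xi> * 2 ^ D" by (simp add: algebra_simps)
          with cT \<open>_ \<le> (1 - \<xi>) * 2 ^ D\<close> show ?thesis by linarith
        qed
        show ?thesis by (rule exI[of _ 0]) (use 1 2 in simp)
      next
        case False
        define \<beta> where "\<beta> = \<rho> / 16 * 2 ^ D"
        define f where "f = (\<lambda>u. real (card {t\<in>T' v. u + t \<in> T' v}))"
        have f: "f u \<le> 2 ^ D" for u
        proof -
          have "card {t\<in>T' v. u + t \<in> T' v} \<le> card ?F" by (intro card_mono) (auto simp: T'_def)
          then show ?thesis by (simp add: f_def)
        qed
        have cS: "card (S' v) \<le> 2 ^ D"
          using card_mono [OF _ S'T'(2) [OF vt]] by (simp add: card_Diff_singleton)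
        have "\<rho> / 8 * 4 ^ D \<le> (\<Sum>u\<in>S' v. f u)"
          using v False by (auto simp: G_def f_def)
        also have "\<dots> \<le> (\<Sum>u\<in>S' v. (if \<beta> \<le> f u then 2 ^ D else 0) + \<beta>)"
        proof (rule sum_mono)
          fix u show "f u \<le> (if \<beta> \<le> f u then 2 ^ D else 0) + \<beta>"
            using f [of u] \<rho> by (auto simp: \<beta>_def intro: add_increasing2)
        qed
        also have "\<dots> = 2 ^ D * real (card {u\<in>S' v. \<beta> \<le> f u}) + real (card (S' v)) * \<beta>"
          using S'T' [OF vt] by (simp add: sum.distrib sum.If_cases Int_def)
        also have "real (card (S' v)) * \<beta> \<le> 2 ^ D * \<beta>"
          using of_nat_mono [OF cS, where 'a = real] \<rho> by (intro mult_right_mono) (simp_all add: \<beta>_def)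
        finally have "\<rho> / 8 * 4 ^ D \<le> 2 ^ D * real (card {u\<in>S' v. \<beta> \<le> f u}) + 2 ^ D * \<beta>" by simp
        moreover have "\<rho> / 8 * 4 ^ D = 2 ^ D * (2 * \<beta>)"
          by (simp add: \<beta>_def flip: power_mult_distrib)
        ultimately have "2 ^ D * \<beta> \<le> 2 ^ D * real (card {u\<in>S' v. \<beta> \<le> f u})" by (simp add: algebra_simps)
        then have "\<beta> \<le> real (card {u\<in>S' v. \<beta> \<le> f u})" by (rule mult_left_le_imp_le) simp
        moreover have "\<xi> * 2 ^ D \<le> \<beta>" using \<rho> by (simp add: \<xi>_def \<beta>_def)
        ultimately have 1: "\<xi> * 2 ^ D \<le> real (card {u\<in>S' v. \<beta> \<le> f u})" by linarith
        have "(1 + 3 * \<rho> / 128) * 2 ^ D \<le> (1 - \<xi> + \<rho> / 16) * 2 ^ D"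
          using \<rho> by (intro mult_right_mono) (auto simp: \<xi>_def)
        have 2: "\<xi> * 2 ^ D \<le> 2 ^ D - 2 ^ k * real (card (T' v)) + \<beta>"
        proof -
          have "(1 - \<xi> + \<rho> / 16) * 2 ^ D = 2 ^ D - \<xi> * 2 ^ D + \<beta>" by (simp add: \<beta>_def algebra_simps)
          with cT3 \<open>_ \<le> (1 - \<xi> + \<rho> / 16) * 2 ^ D\<close> show ?thesis by linarith
        qed
        show ?thesis by (rule exI[of _ \<beta>]) (use 1 2 in \<open>simp add: f_def\<close>)
      qed
      then obtain \<beta> where \<beta>: "\<xi> * 2 ^ D \<le> real (card {u\<in>S' v. \<beta> \<le> real (card {t\<in>T' v. u + t \<in> T' v})})"
        "\<xi> * 2 ^ D \<le> 2 ^ D - 2 ^ k * real (card (T' v)) + \<beta>" by (elim exE conjE) (rule that)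
      have "\<exists>C W. C \<subseteq> ?F \<and> W \<subseteq> ?F \<and> bose_burton (S' v) C W \<and> card C = 2 ^ (k + 1) \<and> card W = 2 ^ m"
        by (rule w0 [rule_format, of ?F "S' v" \<beta>])
          (use S'T' [OF vt] D(2) le32 \<beta> in \<open>simp\<close>)
      then show ?thesis using inj by (simp add: sees_bb_def S'_def)
    qed
    have "card G \<le> card ((G - B1 - B2) \<union> B1 \<union> B2)"
      using fin by (intro card_mono) (auto simp: G_def B1_def B2_def split: if_splits)
    also have "\<dots> \<le> card (G - B1 - B2) + card B1 + card B2"
      using card_Un_le [of "(G - B1 - B2) \<union> B1" B2] card_Un_le [of "G - B1 - B2" B1] by simp
    finally have "real (card G) \<le> card (G - B1 - B2) + card B1 + card B2" by simp
    then have "\<rho> / 16 * N ^ D \<le> card (G - B1 - B2)"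
      using G B1 B2 by simp
    also have "card (G - B1 - B2) \<le> card {v\<in>tup D V. sees_bb k m D S v}"
      using fin sees by (intro card_mono) (auto simp: G_def split: if_splits)
    finally show "\<rho> / 16 * real (card V) ^ D \<le> real (card {v\<in>tup D V. sees_bb k m D S v})"
      by (simp add: N_def)
  qed
qed

text \<open>The popular differences form a set \<open>A\<close> with \<open>|A + A| < 3/2 |A|\<close>, so \<open>A + A\<close> is a subspace.\<close>

lemma near_subspace:
  fixes \<eta> :: real
  assumes V: "F2.subspace V" "finite V" and T: "T \<subseteq> V" "0 \<in> T"
    and \<eta>: "0 < \<eta>" "\<eta> \<le> 1 / 10"
    and few: "(\<Sum>u\<in>V - T. real (card {t\<in>T. u + t \<in> T})) \<le> \<eta>\<^sup>2 * (real (card T))\<^sup>2"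
  shows "\<exists>U. F2.subspace U \<and> U \<subseteq> V \<and> 9 / 10 * real (card T) \<le> card U \<and> card U \<le> 5 / 4 * real (card T) \<and>
    real (card (U - T)) \<le> 4 * \<eta> * real (card T)"
proof -
  define M where "M = real (card T)"
  define f where "f = (\<lambda>u. real (card {t\<in>T. u + t \<in> T}))"
  have finT: "finite T" using T V by (auto intro: finite_subset)
  have M: "M > 0" using T finT by (auto simp: M_def card_gt_0_iff)
  have fM: "f u \<le> M" for u unfolding f_def M_def using finT by (simp add: card_mono)
  have tot: "(\<Sum>u\<in>V. f u) = M\<^sup>2"
    using sum_overlap [OF V T(1) T(1)] by (simp add: f_def M_def power2_eq_square flip: of_nat_sum of_nat_mult)
  have "(\<Sum>u\<in>V. f u) = (\<Sum>u\<in>V - T. f u) + (\<Sum>u\<in>T. f u)"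
    using V T by (intro sum.subset_diff) auto
  then have sumT: "(1 - \<eta>\<^sup>2) * M\<^sup>2 \<le> (\<Sum>u\<in>T. f u)"
    using few tot by (simp add: f_def M_def algebra_simps)
  \<comment> \<open>All but a share \<open>\<eta> ^ 2\<close> of the \<open>M ^ 2\<close> pairs
    counted by \<open>f\<close> belong to some \<open>u \<in> T\<close>; hence all but a share
    \<open>\<eta>\<close> of \<open>T\<close> has popularity at least
    \<open>(1 - \<eta>) * M\<close>.\<close>
  define A where "A = {u\<in>T. (1 - \<eta>) * M \<le> f u}"
  have finA: "finite A" using finT by (simp add: A_def)
  have "(1 - \<eta>\<^sup>2) * M\<^sup>2 \<le> (\<Sum>u\<in>T. if u \<in> A then M else (1 - \<eta>) * M)"
    by (rule order_trans [OF sumT sum_mono]) (use fM in \<open>auto simp: A_def\<close>)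
  also have "\<dots> = real (card A) * M + real (card (T - A)) * ((1 - \<eta>) * M)"
  proof -
    have "T \<inter> {u. u \<in> A} = A" "T \<inter> - {u. u \<in> A} = T - A" by (auto simp: A_def)
    then show ?thesis using finT by (simp add: sum.If_cases)
  qed
  also have "real (card (T - A)) = M - real (card A)"
    using finT by (subst card_Diff_subset) (auto simp: A_def M_def of_nat_diff card_mono)
  finally have "\<eta> * M * ((1 - \<eta>) * M) \<le> \<eta> * M * real (card A)"
    by (simp add: algebra_simps power2_eq_square)
  then have cA: "(1 - \<eta>) * M \<le> card A" using \<eta> M by (subst (asm) mult_le_cancel_left_pos) auto
  \<comment> \<open>Sums of two members of \<open>A\<close> have at least this popularity, and as
    the popularities add up to \<open>M ^ 2\<close>, there are few such points. The bound
    \<open>\<eta> \<le> 1 / 10\<close> is exactly what lets \<open>1 + 5 / 2 * \<eta>\<close>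
    replace \<open>1 / (1 - 2 * \<eta>)\<close>.\<close>
  define U2 where "U2 = {u\<in>V. (1 - 2 * \<eta>) * M \<le> f u}"
  have "real (card U2) * ((1 - 2 * \<eta>) * M) \<le> M * M"
  proof -
    have "real (card U2) * ((1 - 2 * \<eta>) * M) = (\<Sum>u\<in>U2. (1 - 2 * \<eta>) * M)" by simp
    also have "\<dots> \<le> (\<Sum>u\<in>U2. f u)" by (intro sum_mono) (auto simp: U2_def)
    also have "\<dots> \<le> (\<Sum>u\<in>V. f u)" using V by (intro sum_mono2) (auto simp: U2_def f_def)
    finally show ?thesis by (simp add: tot power2_eq_square)
  qed
  then have "real (card U2) * (1 - 2 * \<eta>) \<le> M" using M by (simp add: mult.assoc [symmetric])
  moreover have "1 \<le> (1 + 5 / 2 * \<eta>) * (1 - 2 * \<eta>)"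
  proof -
    have "0 \<le> \<eta> * (1 / 2 - 5 * \<eta>)" using \<eta> by simp
    then show ?thesis by (simp add: algebra_simps)
  qed
  then have "M * 1 \<le> M * ((1 + 5 / 2 * \<eta>) * (1 - 2 * \<eta>))" using M by (intro mult_left_mono) auto
  moreover have "M * ((1 + 5 / 2 * \<eta>) * (1 - 2 * \<eta>)) = ((1 + 5 / 2 * \<eta>) * M) * (1 - 2 * \<eta>)"
    by (simp only: ac_simps)
  ultimately have "real (card U2) * (1 - 2 * \<eta>) \<le> ((1 + 5 / 2 * \<eta>) * M) * (1 - 2 * \<eta>)" by linarith
  then have cU2: "card U2 \<le> (1 + 5 / 2 * \<eta>) * M" using \<eta> by (subst (asm) mult_le_cancel_right_pos) auto
  define U where "U = (\<Union>a\<in>A. (+) a ` A)"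
  have UI: "a + b \<in> U" if "a \<in> A" "b \<in> A" for a b using that unfolding U_def by blast
  have A0: "0 \<in> A" using T \<eta> M by (simp add: A_def f_def M_def)
  have AU: "A \<subseteq> U" using UI [OF A0] by auto
  have inter: "card X + card Y - M \<le> card (X \<inter> Y)" if "X \<subseteq> Z" "Y \<subseteq> Z" "finite Z" "card Z \<le> M" for X Y Z :: "vec set" and M :: real
  proof -
    have "finite X" "finite Y" using that by (auto intro: finite_subset)
    then have "card X + card Y = card (X \<union> Y) + card (X \<inter> Y)" by (rule card_Un_Int)
    moreover have "card (X \<union> Y) \<le> card Z" using that by (intro card_mono) auto
    ultimately show ?thesis using that by simp
  qed
  have UU2: "U \<subseteq> U2"
  proof
    fix u assume "u \<in> U"
    then obtain a b where ab: "a \<in> A" "b \<in> A" "u = a + b" by (auto simp: U_def)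
    let ?X = "{t\<in>T. a + t \<in> T}" and ?Y = "{t\<in>T. b + t \<in> T}"
    have "(1 - 2 * \<eta>) * M \<le> card (?X \<inter> ?Y)"
      using inter [of ?X T ?Y M] finT ab by (simp add: A_def f_def M_def algebra_simps)
    also have "card (?X \<inter> ?Y) = card ((+) a ` (?X \<inter> ?Y))"
      by (rule card_image [symmetric]) (auto intro: inj_onI)
    also have "\<dots> \<le> card {t\<in>T. u + t \<in> T}"
    proof (rule card_mono)
      show "(+) a ` (?X \<inter> ?Y) \<subseteq> {t\<in>T. u + t \<in> T}"
        using ab(3) by (auto simp: add.assoc add.left_commute [of b a])
    qed (use finT in auto)
    finally have "(1 - 2 * \<eta>) * M \<le> f u" by (simp add: f_def)
    moreover have "u \<in> V" using ab T(1) F2.subspace_add [OF V(1), of a b] by (auto simp: A_def)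
    ultimately show "u \<in> U2" by (simp add: U2_def)
  qed
  have finU: "finite U" using finA by (simp add: U_def)
  have "card U \<le> card U2" using UU2 V by (intro card_mono) (auto simp: U2_def)
  then have cU: "card U \<le> (1 + 5 / 2 * \<eta>) * M" using cU2 by simp
  also have "\<dots> < 3 / 2 * ((1 - \<eta>) * M)" using \<eta> M by simp
  finally have cU': "2 * card U < 3 * real (card A)" using cA by simp
  \<comment> \<open>For \<open>x = a + b\<close> both \<open>a + A\<close> and \<open>b + A\<close>
    lie in \<open>U\<close>, which is smaller than \<open>3 / 2 * card A\<close>. They overlap in
    more than half of \<open>card A\<close> points, and each of these yields a way to write
    \<open>x\<close> as a sum of two members of \<open>A\<close>.\<close>
  have pop: "2 * card {a\<in>A. x + a \<in> A} > card A" if x: "x \<in> U" for x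
  proof -
    obtain a b where ab: "a \<in> A" "b \<in> A" "x = a + b" using x unfolding U_def by blast
    let ?X = "(+) a ` A" and ?Y = "(+) b ` A"
    have "card ?X = card A" "card ?Y = card A" by (auto intro!: card_image inj_onI)
    then have "2 * real (card A) - card U \<le> card (?X \<inter> ?Y)"
      using inter [of ?X U ?Y "card U"] UI ab finU by auto
    also have "card (?X \<inter> ?Y) = card ((+) a ` (?X \<inter> ?Y))"
      by (rule card_image [symmetric]) (auto intro: inj_onI)
    also have "\<dots> \<le> card {a\<in>A. x + a \<in> A}"
    proof (rule card_mono)
      show "(+) a ` (?X \<inter> ?Y) \<subseteq> {a\<in>A. x + a \<in> A}"
      proof (rule image_subsetI)
        fix y assume "y \<in> ?X \<inter> ?Y"
        then obtain p q where pq: "p \<in> A" "q \<in> A" "y = a + p" "y = b + q" by blast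
        have "a + y = p" unfolding pq(3) by simp
        moreover have "b + y = q" unfolding pq(4) by simp
        ultimately have "a + y \<in> A" "b + y \<in> A" using pq by simp_all
        moreover have eq: "x + (a + y) = b + y"
          unfolding ab(3) by (simp add: add.assoc add.left_commute [of b a])
        ultimately show "a + y \<in> {a\<in>A. x + a \<in> A}"
          unfolding mem_Collect_eq eq by blast
      qed
    qed (use finA in auto)
    finally show ?thesis using cU' by simp
  qed
  have "F2.subspace U"
    unfolding subspace_iff
  proof (intro conjI ballI)
    show "0 \<in> U" using AU A0 by auto
    fix x y assume xy: "x \<in> U" "y \<in> U"
    \<comment> \<open>Two majorities of \<open>A\<close> share some \<open>a\<close>, and
      \<open>x + y\<close> is the sum of \<open>x + a\<close> and \<open>y + a\<close>, both in
      \<open>A\<close>.\<close>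
    let ?X = "{a\<in>A. x + a \<in> A}" and ?Y = "{a\<in>A. y + a \<in> A}"
    have "real (card ?X + card ?Y) - card A \<le> card (?X \<inter> ?Y)"
      using inter [of ?X A ?Y "card A"] finA by auto
    then have "card (?X \<inter> ?Y) > 0" using pop [OF xy(1)] pop [OF xy(2)] by simp
    then obtain a where "x + a \<in> A" "y + a \<in> A" by (auto simp: card_gt_0_iff)
    then have "(x + a) + (y + a) \<in> U" by (rule UI)
    moreover have "(x + a) + (y + a) = x + y" by (simp add: add.assoc add.left_commute [of a y])
    ultimately show "x + y \<in> U" by (simp only:)
  qed
  moreover have "U \<subseteq> V" using UU2 by (auto simp: U2_def)
  moreover have "9 / 10 * M \<le> card U"
  proof -
    have "9 / 10 * M \<le> (1 - \<eta>) * M" using \<eta> M by (intro mult_right_mono) auto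
    moreover have "card A \<le> card U" using AU finU by (rule card_mono [rotated])
    ultimately show ?thesis using cA by simp
  qed
  moreover have "card U \<le> 5 / 4 * M"
  proof -
    have "(1 + 5 / 2 * \<eta>) * M \<le> 5 / 4 * M" using \<eta> M by (intro mult_right_mono) auto
    then show ?thesis using cU by simp
  qed
  moreover have "real (card (U - T)) \<le> 4 * \<eta> * M"
  proof -
    have "card (U - T) \<le> card (U - A)" using finU by (intro card_mono) (auto simp: A_def)
    also have "\<dots> = card U - card A" using finA AU by (rule card_Diff_subset)
    finally have "real (card (U - T)) \<le> real (card U) - card A"
      using card_mono [OF finU AU] by simp
    moreover have "0 \<le> \<eta> * M" using \<eta> M by simp
    ultimately show ?thesis using cU cA by (simp add: algebra_simps)
  qed
  ultimately show ?thesis unfolding M_def by blast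
qed

section \<open>Energy increment\<close>

definition pr :: "(vec \<Rightarrow> bool) set \<Rightarrow> vec \<Rightarrow> real" where
  "pr F x = real (card {f\<in>F. f x}) / real (card F)"

definition agree :: "(vec \<Rightarrow> bool) set \<Rightarrow> vec set \<Rightarrow> (vec \<Rightarrow> bool) \<Rightarrow> (vec \<Rightarrow> bool) set" where
  "agree F Z h = {f\<in>F. \<forall>y\<in>Z. f y = h y}"

definition dep :: "real \<Rightarrow> real \<Rightarrow> (vec \<Rightarrow> bool) set \<Rightarrow> vec \<Rightarrow> vec set \<Rightarrow> bool" where
  "dep \<epsilon> \<beta> F x Y \<longleftrightarrow> (\<exists>Z\<subseteq>Y. \<exists>h. \<beta> * real (card F) \<le> real (card (agree F Z h)) \<and>
     \<epsilon> < \<bar>pr (agree F Z h) x - pr F x\<bar>)"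

lemma dep_mono: "dep \<epsilon> \<beta> F x Y \<Longrightarrow> Y \<subseteq> Y' \<Longrightarrow> dep \<epsilon> \<beta> F x Y'"
  unfolding dep_def by (meson order_trans)

lemma pr_bounds:
  assumes "finite F" shows "0 \<le> pr F x" "pr F x \<le> 1"
proof -
  have "card {f\<in>F. f x} \<le> card F" using assms by (intro card_mono) auto
  then show "pr F x \<le> 1" by (simp add: pr_def divide_le_eq)
qed (simp add: pr_def)

lemma card_pr: "finite F \<Longrightarrow> real (card F) * pr F x = real (card {f\<in>F. f x})"
  by (cases "F = {}") (auto simp: pr_def)

text \<open>The partition of \<open>F\<close> by restriction to \<open>R\<close>; as an image of
  \<open>F\<close> it has no empty part.\<close>

definition classes :: "(vec \<Rightarrow> bool) set \<Rightarrow> vec set \<Rightarrow> (vec \<Rightarrow> bool) set set" where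
  "classes F R = agree F R ` F"

lemma finite_classes: "finite F \<Longrightarrow> finite (classes F R)"
  by (simp add: classes_def)

lemma Union_classes: "\<Union> (classes F R) = F"
  by (auto simp: classes_def agree_def)

lemma classes_disjoint: "K \<in> classes F R \<Longrightarrow> K' \<in> classes F R \<Longrightarrow> K \<noteq> K' \<Longrightarrow> K \<inter> K' = {}"
  by (auto simp: classes_def agree_def)

lemma card_classes:
  assumes "finite R" shows "card (classes F R) \<le> 2 ^ card R"
proof -
  have "classes F R = (\<lambda>P. {f\<in>F. {y\<in>R. f y} = P}) ` (\<lambda>f. {y\<in>R. f y}) ` F"
    unfolding classes_def agree_def image_image by (rule image_cong [OF refl]) auto
  also have "card \<dots> \<le> card ((\<lambda>f. {y\<in>R. f y}) ` F)"
    by (rule card_image_le, rule finite_subset [of _ "Pow R"]) (use assms in auto)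
  also have "\<dots> \<le> card (Pow R)" using assms by (intro card_mono) auto
  finally show ?thesis using assms by (simp add: card_Pow)
qed

lemma sum_classes:
  fixes g :: "(vec \<Rightarrow> bool) \<Rightarrow> real"
  assumes "finite F" "\<K> \<subseteq> classes F R"
  shows "(\<Sum>K\<in>\<K>. \<Sum>f\<in>K. g f) = (\<Sum>f\<in>\<Union>\<K>. g f)"
proof (rule sum.Union_disjoint [symmetric, unfolded comp_def])
  show "\<forall>A\<in>\<K>. finite A"
    using assms by (auto simp: classes_def agree_def dest!: subsetD)
  show "\<forall>A\<in>\<K>. \<forall>B\<in>\<K>. A \<noteq> B \<longrightarrow> A \<inter> B = {}"
    using assms(2) classes_disjoint by blast
qed

text \<open>The right-hand side exceeds the first term by the variance of the class probabilities
  about \<open>pr F x\<close>, scaled by \<open>card F\<close>. Since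
  \<open>Z \<subseteq> R\<close>, the family \<open>G\<close> is a union of classes, and convexity
  of the square on these classes alone gives the second term.\<close>

lemma energy_gain:
  fixes h :: "vec \<Rightarrow> bool"
  assumes F: "finite F" and Z: "Z \<subseteq> R"
  defines "G \<equiv> agree F Z h"
  shows "real (card F) * (pr F x)\<^sup>2 + real (card G) * (pr G x - pr F x)\<^sup>2 \<le>
    (\<Sum>K\<in>classes F R. real (card K) * (pr K x)\<^sup>2)"
proof -
  have finK: "finite K" if "K \<in> classes F R" for K
    using that F by (auto simp: classes_def agree_def)
  have size: "(\<Sum>K\<in>\<K>. real (card K)) = real (card (\<Union>\<K>))" if "\<K> \<subseteq> classes F R" for \<K>
    using sum_classes [OF F that, where g = "\<lambda>_. 1"] by simp
  have tot: "(\<Sum>K\<in>\<K>. real (card K) * pr K x) = real (card (\<Union>\<K>)) * pr (\<Union>\<K>) x" if \<K>: "\<K> \<subseteq> classes F R" for \<K>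
  proof -
    have fU: "finite (\<Union>\<K>)"
      using Union_mono [OF \<K>] F unfolding Union_classes by (rule finite_subset)
    have *: "real (card {f\<in>K. f x}) = (\<Sum>f\<in>K. of_bool (f x))" if "finite K" for K
      using that by (simp add: of_bool_def sum.If_cases Int_def)
    have "(\<Sum>K\<in>\<K>. real (card K) * pr K x) = (\<Sum>K\<in>\<K>. \<Sum>f\<in>K. of_bool (f x))"
      using \<K> finK by (intro sum.cong refl) (auto simp only: card_pr * dest!: subsetD)
    also have "\<dots> = (\<Sum>f\<in>\<Union>\<K>. of_bool (f x))" by (rule sum_classes [OF F \<K>])
    finally show ?thesis unfolding card_pr [OF fU] *[OF fU] .
  qed
  define p where "p = pr F x"
  define q where "q = pr G x"
  define \<G> where "\<G> = {K\<in>classes F R. K \<subseteq> G}"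
  have \<G>: "\<G> \<subseteq> classes F R" by (auto simp: \<G>_def)
  have "\<Union>\<G> = G"
  proof (rule equalityI)
    show "G \<subseteq> \<Union>\<G>"
    proof
      fix f assume f: "f \<in> G"
      then have "agree F R f \<in> \<G>" using Z by (auto simp: \<G>_def classes_def G_def agree_def)
      moreover have "f \<in> agree F R f" using f by (auto simp: G_def agree_def)
      ultimately show "f \<in> \<Union>\<G>" by blast
    qed
  qed (auto simp: \<G>_def)
  then have G1: "(\<Sum>K\<in>\<G>. real (card K)) = real (card G)" "(\<Sum>K\<in>\<G>. real (card K) * pr K x) = real (card G) * q"
    using size [OF \<G>] tot [OF \<G>] by (simp_all add: q_def)
  have F1: "(\<Sum>K\<in>classes F R. real (card K)) = real (card F)"
    "(\<Sum>K\<in>classes F R. real (card K) * pr K x) = real (card F) * p"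
    using size [of "classes F R"] tot [of "classes F R"] by (simp_all add: p_def Union_classes)
  have "real (card G) * (q - p)\<^sup>2 = (q - p)\<^sup>2 * real (card G) + 2 * (q - p) * (real (card G) * q) - 2 * (q - p) * q * real (card G)"
    by (simp add: algebra_simps)
  also have "\<dots> = (\<Sum>K\<in>\<G>. (q - p)\<^sup>2 * real (card K) + 2 * (q - p) * (real (card K) * pr K x) - 2 * (q - p) * q * real (card K))"
    unfolding sum.distrib sum_subtractf sum_distrib_left [symmetric] G1 ..
  also have "\<dots> \<le> (\<Sum>K\<in>\<G>. real (card K) * (pr K x - p)\<^sup>2)"
  proof (rule sum_mono)
    fix K
    \<comment> \<open>Expanded, this says that the parabola \<open>(t - p) ^ 2\<close> lies above
      its tangent at \<open>q\<close>.\<close>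
    have "0 \<le> real (card K) * (pr K x - q)\<^sup>2" by simp
    then show "(q - p)\<^sup>2 * real (card K) + 2 * (q - p) * (real (card K) * pr K x) - 2 * (q - p) * q * real (card K)
        \<le> real (card K) * (pr K x - p)\<^sup>2"
      by (simp add: algebra_simps power2_eq_square)
  qed
  also have "\<dots> \<le> (\<Sum>K\<in>classes F R. real (card K) * (pr K x - p)\<^sup>2)"
    using \<G> F by (intro sum_mono2) (auto simp: finite_classes)
  also have "\<dots> = (\<Sum>K\<in>classes F R. real (card K) * (pr K x)\<^sup>2 - 2 * p * (real (card K) * pr K x) + p\<^sup>2 * real (card K))"
    by (intro sum.cong refl) (simp add: algebra_simps power2_eq_square)
  also have "\<dots> = (\<Sum>K\<in>classes F R. real (card K) * (pr K x)\<^sup>2) - 2 * p * (real (card F) * p) + p\<^sup>2 * real (card F)"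
    unfolding sum.distrib sum_subtractf sum_distrib_left [symmetric] F1 ..
  also have "\<dots> = (\<Sum>K\<in>classes F R. real (card K) * (pr K x)\<^sup>2) - real (card F) * p\<^sup>2"
    by (simp add: power2_eq_square)
  finally show ?thesis by (simp add: p_def q_def)
qed

text \<open>Averaged over the classes of \<open>R\<close>, weighted by size, the energy exceeds that
  of \<open>F\<close> by \<open>2 * \<iota> * card V\<close>. There are at most
  \<open>2 ^ card R\<close> classes, so those with less than a share
  \<open>\<iota> / 2 / 2 ^ card R\<close> of \<open>F\<close> account for at most
  \<open>\<iota> / 2 * card V\<close> of this; some larger class must gain
  \<open>\<iota> * card V\<close>.\<close>

lemma energy_increment:
  fixes \<epsilon> \<beta> \<eta> :: real and V :: "vec set"
  assumes pos: "\<epsilon> > 0" "\<beta> > 0" "\<eta> > 0" and F: "finite F" "F \<noteq> {}" and V: "finite V" "V \<noteq> {}"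
    and R: "finite R" and X: "\<eta> * real (card V) \<le> real (card {x\<in>V. dep \<epsilon> \<beta> F x R})"
  defines "\<iota> \<equiv> \<eta> * \<beta> * \<epsilon>\<^sup>2 / 2" and "E \<equiv> \<lambda>K. \<Sum>x\<in>V. (pr K x)\<^sup>2"
  obtains K where "K \<subseteq> F" "K \<noteq> {}" "\<iota> / 2 / 2 ^ card R * real (card F) \<le> real (card K)"
    "E F + \<iota> * real (card V) \<le> E K"
proof (rule ccontr)
  note found = that
  define N where "N = real (card V)"
  define M where "M = real (card F)"
  have N: "N > 0" and M: "M > 0" using V F by (auto simp: N_def M_def card_gt_0_iff)
  have \<iota>: "\<iota> > 0" using pos by (simp add: \<iota>_def)
  define \<theta> where "\<theta> = \<iota> / 2 / 2 ^ card R"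
  have \<theta>: "\<theta> > 0" using \<iota> by (simp add: \<theta>_def)
  have KF: "K \<subseteq> F" "K \<noteq> {}" "finite K" if "K \<in> classes F R" for K
    using that F(1) by (auto simp: classes_def agree_def)
  assume no: "\<not> thesis"
  have neg: "E K < E F + \<iota> * N" if "K \<in> classes F R" "\<theta> * M \<le> real (card K)" for K
  proof (rule ccontr)
    assume "\<not> E K < E F + \<iota> * N"
    with no show False
      using found [OF KF(1,2) [OF that(1)] that(2) [unfolded \<theta>_def M_def]] by (simp add: N_def)
  qed
  let ?X = "{x\<in>V. dep \<epsilon> \<beta> F x R}"
  have gain: "M * (pr F x)\<^sup>2 + (if x \<in> ?X then \<beta> * M * \<epsilon>\<^sup>2 else 0) \<le> (\<Sum>K\<in>classes F R. real (card K) * (pr K x)\<^sup>2)" for x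
  proof (cases "x \<in> ?X")
    case True
    then obtain Z h where Z: "Z \<subseteq> R" "\<beta> * M \<le> real (card (agree F Z h))" "\<epsilon> < \<bar>pr (agree F Z h) x - pr F x\<bar>"
      by (auto simp: dep_def M_def)
    have "\<epsilon>\<^sup>2 \<le> \<bar>pr (agree F Z h) x - pr F x\<bar>\<^sup>2" using Z(3) pos by (intro power_mono) auto
    then have "(\<beta> * M) * \<epsilon>\<^sup>2 \<le> real (card (agree F Z h)) * (pr (agree F Z h) x - pr F x)\<^sup>2"
      using Z(2) by (intro mult_mono) auto
    then show ?thesis using energy_gain [OF F(1) Z(1), where x = x and h = h] True by (simp add: M_def)
  next
    case False
    have "M * (pr F x)\<^sup>2 \<le> (\<Sum>K\<in>classes F R. real (card K) * (pr K x)\<^sup>2)"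
      using energy_gain [OF F(1), where Z = "{}" and R = R and x = x] by (simp add: agree_def M_def)
    then show ?thesis unfolding if_not_P [OF False] by simp
  qed
  have "M * E F + \<eta> * N * (\<beta> * M * \<epsilon>\<^sup>2) \<le> M * E F + real (card ?X) * (\<beta> * M * \<epsilon>\<^sup>2)"
    using X pos M by (intro add_left_mono mult_right_mono) (auto simp: N_def)
  also have "\<dots> = (\<Sum>x\<in>V. M * (pr F x)\<^sup>2 + (if x \<in> ?X then \<beta> * M * \<epsilon>\<^sup>2 else 0))"
  proof -
    have "V \<inter> ?X = ?X" by auto
    then have "(\<Sum>x\<in>V. if x \<in> ?X then \<beta> * M * \<epsilon>\<^sup>2 else 0) = real (card ?X) * (\<beta> * M * \<epsilon>\<^sup>2)"
      using V by (subst sum.If_cases) simp_all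
    then show ?thesis unfolding sum.distrib E_def by (simp add: sum_distrib_left)
  qed
  also have "\<dots> \<le> (\<Sum>x\<in>V. \<Sum>K\<in>classes F R. real (card K) * (pr K x)\<^sup>2)"
    by (intro sum_mono gain)
  also have "\<dots> = (\<Sum>K\<in>classes F R. real (card K) * E K)"
    unfolding E_def sum_distrib_left by (rule sum.swap)
  also have "\<dots> \<le> (\<Sum>K\<in>classes F R. real (card K) * (E F + \<iota> * N) + \<theta> * M * N)"
  proof (rule sum_mono)
    fix K assume K: "K \<in> classes F R"
    have E0: "0 \<le> E F" by (simp add: E_def sum_nonneg)
    show "real (card K) * E K \<le> real (card K) * (E F + \<iota> * N) + \<theta> * M * N"
    proof (cases "\<theta> * M \<le> real (card K)")
      case True
      then have "real (card K) * E K \<le> real (card K) * (E F + \<iota> * N)"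
        using neg [OF K] by (intro mult_left_mono) auto
      then show ?thesis using \<theta> M N by (simp add: add_increasing2)
    next
      case False
      have "E K \<le> (\<Sum>x\<in>V. 1)"
        unfolding E_def using pr_bounds [OF KF(3) [OF K]] by (intro sum_mono) (simp add: power_le_one)
      then have "real (card K) * E K \<le> \<theta> * M * N"
        using False \<theta> M by (intro mult_mono) (auto simp: N_def E_def intro: sum_nonneg)
      moreover have "0 \<le> real (card K) * (E F + \<iota> * N)" using E0 \<iota> N by simp
      ultimately show ?thesis by simp
    qed
  qed
  also have "\<dots> = M * (E F + \<iota> * N) + real (card (classes F R)) * (\<theta> * M * N)"
    using sum_classes [OF F(1) order_refl, where R = R and g = "\<lambda>_. 1"]
    by (simp add: sum.distrib Union_classes M_def flip: sum_distrib_right)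
  also have "real (card (classes F R)) * (\<theta> * M * N) \<le> 2 ^ card R * (\<theta> * M * N)"
    using of_nat_mono [OF card_classes [OF R, of F], where 'a = real] \<theta> M N by (intro mult_right_mono) auto
  also have "2 ^ card R * (\<theta> * M * N) = \<iota> / 2 * M * N" by (simp add: \<theta>_def)
  finally have "M * E F + \<eta> * N * (\<beta> * M * \<epsilon>\<^sup>2) \<le> M * (E F + \<iota> * N) + \<iota> / 2 * M * N" by simp
  moreover have "M * (E F + \<iota> * N) = M * E F + \<iota> * M * N" by (simp add: algebra_simps)
  moreover have "\<iota> / 2 * M * N = (\<iota> * M * N) / 2" by simp
  moreover have "\<eta> * N * (\<beta> * M * \<epsilon>\<^sup>2) = 2 * (\<iota> * M * N)" by (simp add: \<iota>_def)
  moreover have "\<iota> * M * N > 0" using \<iota> M N by simp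
  ultimately show False by linarith
qed

text \<open>The energy lies between 0 and \<open>card V\<close>, so about \<open>1 / \<iota>\<close>
  rounds suffice. This number does not depend on \<open>V\<close>; up to a constant, the total loss
  is a fixed power of \<open>2 ^ r\<close>.\<close>

lemma energy_iteration:
  fixes \<epsilon> \<beta> \<eta> :: real and V :: "vec set" and r :: nat
  assumes pos: "\<epsilon> > 0" "\<beta> > 0" "\<eta> > 0" "\<epsilon> \<le> 1" "\<beta> \<le> 1" "\<eta> \<le> 1"
    and F: "finite F" "F \<noteq> {}" and V: "finite V" "V \<noteq> {}"
    and step: "\<And>K. K \<subseteq> F \<Longrightarrow> K \<noteq> {} \<Longrightarrow> \<not> Q K \<Longrightarrow>
      \<exists>R\<subseteq>V. card R \<le> r \<and> \<eta> * real (card V) \<le> real (card {x\<in>V. dep \<epsilon> \<beta> K x R})"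
  defines "\<iota> \<equiv> \<eta> * \<beta> * \<epsilon>\<^sup>2 / 2"
  shows "\<exists>K\<subseteq>F. K \<noteq> {} \<and> Q K \<and> (\<iota> / 2 / 2 ^ r) ^ (nat \<lceil>1 / \<iota>\<rceil> + 1) * real (card F) \<le> real (card K)"
proof -
  define E where "E = (\<lambda>K. \<Sum>x\<in>V. (pr K x)\<^sup>2)"
  define N where "N = real (card V)"
  have N: "N > 0" using V by (auto simp: N_def card_gt_0_iff)
  have \<iota>: "\<iota> > 0" using pos by (simp add: \<iota>_def)
  have "\<eta> * \<beta> * \<epsilon>\<^sup>2 \<le> 1 * 1 * 1" using pos by (intro mult_mono power_le_one) auto
  then have \<iota>1: "\<iota> \<le> 1" by (simp add: \<iota>_def)
  define \<theta> where "\<theta> = \<iota> / 2 / 2 ^ r"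
  have "\<iota> / 2 / 2 ^ r \<le> 1 / 1" using \<iota> \<iota>1 by (intro frac_le) auto
  then have \<theta>: "0 < \<theta>" "\<theta> \<le> 1" using \<iota> by (auto simp: \<theta>_def)
  have *: "(\<exists>K\<subseteq>F. K \<noteq> {} \<and> Q K \<and> \<theta> ^ j * real (card F) \<le> real (card K)) \<or>
    (\<exists>K\<subseteq>F. K \<noteq> {} \<and> \<theta> ^ j * real (card F) \<le> real (card K) \<and> real j * \<iota> * N \<le> E K)" for j
  proof (induction j)
    case 0
    have "0 \<le> E F" by (simp add: E_def sum_nonneg)
    then show ?case using F by auto
  next
    case (Suc j)
    have mono: "\<theta> ^ Suc j * real (card F) \<le> real (card K)" if "\<theta> ^ j * real (card F) \<le> real (card K)" for K
    proof -
      have "\<theta> ^ Suc j * real (card F) \<le> \<theta> ^ j * real (card F)"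
        using \<theta> by (intro mult_right_mono power_decreasing) auto
      with that show ?thesis by linarith
    qed
    from Suc.IH show ?case
    proof (elim disjE exE conjE)
      fix K assume "K \<subseteq> F" "K \<noteq> {}" "Q K" "\<theta> ^ j * real (card F) \<le> real (card K)"
      then show ?thesis using mono by blast
    next
      fix K assume K: "K \<subseteq> F" "K \<noteq> {}" "\<theta> ^ j * real (card F) \<le> real (card K)" "real j * \<iota> * N \<le> E K"
      show ?thesis
      proof (cases "Q K")
        case True then show ?thesis using K mono by blast
      next
        case False
        obtain R where R: "R \<subseteq> V" "card R \<le> r" "\<eta> * real (card V) \<le> real (card {x\<in>V. dep \<epsilon> \<beta> K x R})"
          using step [OF K(1,2) False] by blast
        have finR: "finite R" "finite K" using R V K F by (auto intro: finite_subset)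
        obtain K' where K': "K' \<subseteq> K" "K' \<noteq> {}" "\<iota> / 2 / 2 ^ card R * real (card K) \<le> real (card K')"
          "E K + \<iota> * N \<le> E K'"
          by (rule energy_increment [OF pos(1-3) finR(2) K(2) V finR(1) R(3)])
            (auto simp: \<iota>_def E_def N_def)
        have "\<theta> ^ Suc j * real (card F) = \<theta> * (\<theta> ^ j * real (card F))" by simp
        also have "\<dots> \<le> \<theta> * real (card K)" using K(3) \<theta> by (intro mult_left_mono) auto
        also have "\<dots> \<le> \<iota> / 2 / 2 ^ card R * real (card K)"
          unfolding \<theta>_def using R(2) \<iota> by (intro mult_right_mono divide_left_mono power_increasing) auto
        also note K'(3)
        finally have "\<theta> ^ Suc j * real (card F) \<le> real (card K')" .
        moreover have "real (Suc j) * \<iota> * N \<le> E K'" using K(4) K'(4) by (simp add: algebra_simps)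
        ultimately show ?thesis using K' K by (intro disjI2 exI[of _ K']) auto
      qed
    qed
  qed
  let ?J = "nat \<lceil>1 / \<iota>\<rceil> + 1"
  from *[of ?J] show ?thesis
  proof (elim disjE exE conjE)
    fix K assume K: "K \<subseteq> F" "K \<noteq> {}" "real ?J * \<iota> * N \<le> E K"
    have "finite K" using K F by (auto intro: finite_subset)
    have "E K \<le> (\<Sum>x\<in>V. 1)"
      unfolding E_def using pr_bounds [OF \<open>finite K\<close>] by (intro sum_mono) (simp add: power_le_one)
    then have "real ?J * \<iota> * N \<le> 1 * N" using K(3) by (simp add: N_def)
    then have "real ?J * \<iota> \<le> 1" using N by (simp only: mult_le_cancel_right_pos)
    moreover have "1 / \<iota> < real ?J" by linarith
    then have "1 < real ?J * \<iota>" using \<iota> by (simp add: divide_less_eq)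
    ultimately show ?thesis by simp
  qed (use \<theta>_def in blast)
qed

text \<open>The points of \<open>B\<close> are fixed one after another. While the functions still in
  agreement form a share of at least \<open>\<beta>\<close>, independence lowers the probability of
  the wanted value from at least \<open>2 * \<epsilon>\<close> to no less than
  \<open>\<epsilon>\<close>. So after \<open>j\<close> points a share \<open>\<epsilon> ^ j\<close>
  is left, which never drops below \<open>\<beta>\<close>.\<close>

lemma realize_pattern:
  fixes \<epsilon> \<beta> :: real
  assumes K: "finite K" "K \<noteq> {}" and B: "finite B" "card B \<le> b" and \<epsilon>: "0 < \<epsilon>" "\<epsilon> \<le> 1" and \<beta>: "\<beta> \<le> \<epsilon> ^ b"
    and indep: "\<And>x. x \<in> B \<Longrightarrow> \<not> dep \<epsilon> \<beta> K x (B - {x})"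
    and h: "\<And>x. x \<in> B \<Longrightarrow> 2 * \<epsilon> \<le> (if h x then pr K x else 1 - pr K x)"
  shows "\<exists>f\<in>K. \<forall>x\<in>B. f x = h x"
proof -
  have cK: "real (card K) > 0" using K by (simp add: card_gt_0_iff)
  have main: "\<epsilon> ^ card Z * real (card K) \<le> real (card (agree K Z h))" if "Z \<subseteq> B" for Z
    using finite_subset [OF that B(1)] that
  proof (induction Z rule: finite_induct)
    case empty
    then show ?case by (simp add: agree_def)
  next
    case (insert x Z)
    define G where "G = agree K Z h"
    have IH: "\<epsilon> ^ card Z * real (card K) \<le> real (card G)" using insert by (simp add: G_def)
    have finG: "finite G" using K by (simp add: G_def agree_def)
    have "card Z \<le> card B" using insert B by (intro card_mono) auto
    then have "\<beta> \<le> \<epsilon> ^ card Z"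
      using \<beta> \<epsilon> B power_decreasing [of "card Z" b \<epsilon>] by linarith
    then have "\<beta> * real (card K) \<le> \<epsilon> ^ card Z * real (card K)"
      using cK by (intro mult_right_mono) auto
    with IH have big: "\<beta> * real (card K) \<le> real (card G)" by linarith
    have Zx: "Z \<subseteq> B - {x}" using insert.hyps(2) insert.prems by auto
    have close: "\<bar>pr G x - pr K x\<bar> \<le> \<epsilon>"
    proof (rule ccontr)
      assume "\<not> \<bar>pr G x - pr K x\<bar> \<le> \<epsilon>"
      then have "\<epsilon> < \<bar>pr G x - pr K x\<bar>" by simp
      then have "dep \<epsilon> \<beta> K x (B - {x})"
        unfolding dep_def using big Zx G_def by blast
      then show False using indep [of x] insert.prems by simp
    qed
    have hx: "2 * \<epsilon> \<le> (if h x then pr K x else 1 - pr K x)" using h insert by auto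
    have split: "card G = card {f\<in>G. f x} + card {f\<in>G. \<not> f x}"
    proof -
      have "card ({f\<in>G. f x} \<union> {f\<in>G. \<not> f x}) = card {f\<in>G. f x} + card {f\<in>G. \<not> f x}"
        using finG by (intro card_Un_disjoint) auto
      moreover have "{f\<in>G. f x} \<union> {f\<in>G. \<not> f x} = G" by auto
      ultimately show ?thesis by simp
    qed
    have "real (card (agree K (insert x Z) h)) = real (card G) * (if h x then pr G x else 1 - pr G x)"
    proof (cases "h x")
      case True
      then have "agree K (insert x Z) h = {f\<in>G. f x}" by (auto simp: agree_def G_def)
      with True show ?thesis using card_pr [OF finG, of x] by simp
    next
      case False
      then have "agree K (insert x Z) h = {f\<in>G. \<not> f x}" by (auto simp: agree_def G_def)
      with False show ?thesis using card_pr [OF finG, of x] split by (simp add: algebra_simps)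
    qed
    moreover have "\<epsilon> \<le> (if h x then pr G x else 1 - pr G x)" using close hx by (auto split: if_splits)
    ultimately have "real (card G) * \<epsilon> \<le> real (card (agree K (insert x Z) h))"
      by (simp only:) (rule mult_left_mono, auto)
    moreover have "\<epsilon> ^ card (insert x Z) * real (card K) \<le> real (card G) * \<epsilon>"
      using insert IH \<epsilon> by (simp add: mult.commute mult.left_commute)
    ultimately show ?case by linarith
  qed
  have "real (card (agree K B h)) > 0"
  proof -
    have "0 < \<epsilon> ^ card B * real (card K)" using cK \<epsilon> by simp
    with main [OF order_refl] show ?thesis by linarith
  qed
  then have "agree K B h \<noteq> {}" by (metis card.empty less_irrefl of_nat_0)
  then show ?thesis by (auto simp: agree_def)
qed

section \<open>Random invertible maps and sparse pinning sets\<close>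

lemma lc_tup:
  assumes "v \<in> tup D (F2_pow n)" shows "lc D v c \<in> F2_pow n"
  by (rule lc_in [OF subspace_F2_pow]) (use assms PiE_mem in blast)

text \<open>The general linear group of \<open>F2_pow n\<close>, each element given by the images of
  the unit vectors.\<close>

definition gl :: "nat \<Rightarrow> (nat \<Rightarrow> vec) set" where
  "gl n = {g\<in>tup n (F2_pow n). inj_on (lc n g) (F2_pow n)}"

lemma gl_image:
  assumes "g \<in> gl n" shows "x \<in> F2_pow n \<Longrightarrow> lc n g x \<in> F2_pow n"
  using assms by (simp add: gl_def lc_tup)

text \<open>\<open>lc D w\<close> after a left inverse of \<open>lc D v\<close> carries one span to
  the other; it is extended along a complement of the target span.\<close>

lemma inj_tuple_transitive:
  assumes v: "v \<in> tup D (F2_pow n)" "inj_on (lc D v) (F2_pow D)"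
    and w: "w \<in> tup D (F2_pow n)" "inj_on (lc D w) (F2_pow D)"
  obtains h where "lin h" "inj_on h (F2_pow n)" "h ` F2_pow n \<subseteq> F2_pow n" "\<And>i. i < D \<Longrightarrow> h (v i) = w i"
proof -
  let ?V = "F2_pow n" and ?F = "F2_pow D"
  define E where "E = lc D v ` ?F"
  define U where "U = lc D w ` ?F"
  have EV: "E \<subseteq> ?V" unfolding E_def using lc_tup [OF v(1)] by blast
  have UV: "U \<subseteq> ?V" unfolding U_def using lc_tup [OF w(1)] by blast
  have sub: "F2.subspace E" "F2.subspace U" unfolding E_def U_def by (intro subspace_image lin_lc subspace_F2_pow)+
  have cE: "card E = 2 ^ D" "card U = 2 ^ D" using card_image [OF v(2)] card_image [OF w(2)] by (simp_all add: E_def U_def)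
  obtain l where l: "lin l" "\<forall>c\<in>?F. l (lc D v c) = c"
    using F2p.linear_exists_left_inverse_on [OF lin_lc subspace_F2_pow v(2)] by (elim exE conjE) (rule that)
  define \<theta>0 where "\<theta>0 = (\<lambda>x. lc D w (l x))"
  have \<theta>0: "lin \<theta>0" using l(1) lin_lc [of D w] by (simp add: lin_iff \<theta>0_def)
  have \<theta>0v: "\<theta>0 (lc D v c) = lc D w c" if "c \<in> ?F" for c using l(2) that by (simp add: \<theta>0_def)
  have inj0: "inj_on \<theta>0 E"
    unfolding E_def using w(2) \<theta>0v by (auto simp: inj_on_def)
  obtain C where C: "F2.subspace C" "C \<subseteq> ?V" "C \<inter> U \<subseteq> {0}" "card ?V = card U * card C"
    by (rule complement_exists [OF subspace_F2_pow finite_F2_pow sub(2) UV])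
  have finC: "finite C" using C(2) by (rule finite_subset) simp
  obtain h where h: "lin h" "inj_on h ?V" "\<And>x. x \<in> E \<Longrightarrow> h x = \<theta>0 x"
    "\<And>x. x \<in> ?V \<Longrightarrow> \<exists>c\<in>C. \<exists>u\<in>U. h x = c + u"
    by (rule extend_embedding [OF subspace_F2_pow finite_F2_pow sub(1) EV \<theta>0 inj0 _ sub(2) C(1) finC C(3)])
      (use \<theta>0v cE C(4) in \<open>auto simp: E_def U_def\<close>)
  show thesis
  proof (rule that [OF h(1,2)])
    show "h ` ?V \<subseteq> ?V"
    proof (rule image_subsetI)
      fix x assume "x \<in> ?V"
      then obtain c u where "c \<in> C" "u \<in> U" "h x = c + u" using h(4) by blast
      then show "h x \<in> ?V" using C(2) UV F2.subspace_add [OF subspace_F2_pow, of c n u] by auto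
    qed
    fix i assume i: "i < D"
    have ui: "unit_vec i \<in> ?F" using i by (auto simp: unit_vec_def F2_pow_def)
    have lu: "lc D z (unit_vec i) = z i" for z :: "nat \<Rightarrow> vec"
    proof -
      have "lc D z (unit_vec i) = (\<Sum>j<D. if j = i then z j else 0)"
        unfolding lc_def by (rule sum.cong) (auto simp: unit_vec_def)
      then show ?thesis using i by simp
    qed
    have "h (v i) = \<theta>0 (v i)" using h(3) [of "v i"] ui lu [of v] by (auto simp: E_def image_iff) metis
    also have "\<dots> = w i" using \<theta>0v [OF ui] by (simp add: lu)
    finally show "h (v i) = w i" .
  qed
qed

lemma finite_gl: "finite (gl n)"
  unfolding gl_def using finite_tup [OF finite_F2_pow] by simp

text \<open>Composition with an \<open>h\<close> that carries \<open>v\<close> to \<open>w\<close>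
  injects the first fibre into the second.\<close>

lemma gl_fibre_le:
  assumes v: "v \<in> tup D (F2_pow n)" "inj_on (lc D v) (F2_pow D)"
    and w: "w \<in> tup D (F2_pow n)" "inj_on (lc D w) (F2_pow D)"
  shows "card {g\<in>gl n. \<forall>i<D. lc n g (e i) = v i} \<le> card {g\<in>gl n. \<forall>i<D. lc n g (e i) = w i}"
proof -
  obtain h where h: "lin h" "inj_on h (F2_pow n)" "h ` F2_pow n \<subseteq> F2_pow n" "\<And>i. i < D \<Longrightarrow> h (v i) = w i"
    by (rule inj_tuple_transitive [OF v w]) blast
  let ?s = "\<lambda>g. \<lambda>i\<in>{..<n}. h (g i)"
  have s: "lc n (?s g) x = h (lc n g x)" for g x
  proof -
    have "lc n (?s g) x = lc n (\<lambda>i. h (g i)) x" by (rule lc_cong) simp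
    then show ?thesis by (simp add: lin_lc_comp [OF h(1)])
  qed
  show ?thesis
  proof (rule card_inj_on_le [where f = ?s])
    show "?s ` {g\<in>gl n. \<forall>i<D. lc n g (e i) = v i} \<subseteq> {g\<in>gl n. \<forall>i<D. lc n g (e i) = w i}"
    proof (rule image_subsetI)
      fix g assume g: "g \<in> {g\<in>gl n. \<forall>i<D. lc n g (e i) = v i}"
      then have gt: "g \<in> tup n (F2_pow n)" "inj_on (lc n g) (F2_pow n)" "g \<in> gl n" by (auto simp: gl_def)
      have "?s g \<in> tup n (F2_pow n)" using h(3) gt(1) by (auto simp: PiE_iff)
      moreover have "inj_on (lc n (?s g)) (F2_pow n)"
        unfolding s using gt(2) gl_image [OF gt(3)] h(2) by (auto simp: inj_on_def)
      ultimately show "?s g \<in> {g\<in>gl n. \<forall>i<D. lc n g (e i) = w i}"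
        using g h(4) by (simp add: gl_def s)
    qed
    show "inj_on ?s {g\<in>gl n. \<forall>i<D. lc n g (e i) = v i}"
    proof (rule inj_onI)
      fix g g' assume g: "g \<in> {g\<in>gl n. \<forall>i<D. lc n g (e i) = v i}" "g' \<in> {g\<in>gl n. \<forall>i<D. lc n g (e i) = v i}"
        and eq: "?s g = ?s g'"
      have gt: "g \<in> tup n (F2_pow n)" "g' \<in> tup n (F2_pow n)" using g by (auto simp: gl_def)
      show "g = g'"
      proof (rule PiE_ext [OF gt])
        fix i assume i: "i \<in> {..<n}"
        have "h (g i) = h (g' i)" using fun_cong [OF eq, of i] i by simp
        then show "g i = g' i" using h(2) gt i by (auto simp: inj_on_def PiE_iff)
      qed
    qed
    show "finite {g\<in>gl n. \<forall>i<D. lc n g (e i) = w i}" using finite_gl by simp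
  qed
qed

text \<open>The fibres over injective tuples cover \<open>gl n\<close>, are at most
  \<open>(2 ^ n) ^ D\<close> in number and no larger than the one over \<open>v\<close>. So a random
  invertible map carries \<open>e\<close> to \<open>v\<close> with probability at least
  \<open>1 / (2 ^ n) ^ D\<close>.\<close>

lemma gl_fibre_average:
  assumes e: "e \<in> tup D (F2_pow n)" "inj_on (lc D e) (F2_pow D)"
    and v: "v \<in> tup D (F2_pow n)" "inj_on (lc D v) (F2_pow D)"
  shows "card (gl n) \<le> (2 ^ n) ^ D * card {g\<in>gl n. \<forall>i<D. lc n g (e i) = v i}"
proof -
  let ?I = "{w\<in>tup D (F2_pow n). inj_on (lc D w) (F2_pow D)}"
  have finI: "finite ?I" using finite_tup [OF finite_F2_pow] by simp
  have "gl n \<subseteq> (\<Union>w\<in>?I. {g\<in>gl n. \<forall>i<D. lc n g (e i) = w i})"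
  proof
    fix g assume g: "g \<in> gl n"
    define w where "w = (\<lambda>i\<in>{..<D}. lc n g (e i))"
    have "w \<in> tup D (F2_pow n)" using gl_image [OF g] e(1) by (auto simp: w_def PiE_iff)
    moreover have "lc D w c = lc n g (lc D e c)" for c
    proof -
      have "lc D w c = lc D (\<lambda>i. lc n g (e i)) c" by (rule lc_cong) (simp add: w_def)
      then show ?thesis by (simp add: lin_lc_comp [OF lin_lc])
    qed
    moreover have "lc D e c \<in> F2_pow n" for c using e(1) by (rule lc_tup)
    ultimately have "w \<in> ?I" using g e(2) by (auto simp: gl_def inj_on_def)
    moreover have "g \<in> {g\<in>gl n. \<forall>i<D. lc n g (e i) = w i}" using g by (simp add: w_def)
    ultimately show "g \<in> (\<Union>w\<in>?I. {g\<in>gl n. \<forall>i<D. lc n g (e i) = w i})" by blast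
  qed
  then have "card (gl n) \<le> card (\<Union>w\<in>?I. {g\<in>gl n. \<forall>i<D. lc n g (e i) = w i})"
    using finI finite_gl by (intro card_mono) auto
  also have "\<dots> \<le> (\<Sum>w\<in>?I. card {g\<in>gl n. \<forall>i<D. lc n g (e i) = w i})"
    by (rule card_UN_le [OF finI])
  also have "\<dots> \<le> (\<Sum>w\<in>?I. card {g\<in>gl n. \<forall>i<D. lc n g (e i) = v i})"
    by (rule sum_mono) (use gl_fibre_le v in auto)
  also have "\<dots> = card ?I * card {g\<in>gl n. \<forall>i<D. lc n g (e i) = v i}" by simp
  also have "\<dots> \<le> card (tup D (F2_pow n)) * card {g\<in>gl n. \<forall>i<D. lc n g (e i) = v i}"
    using finite_tup [OF finite_F2_pow] by (intro mult_right_mono card_mono) auto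
  finally show ?thesis by (simp add: card_tup)
qed

lemma gl_nonempty: "gl n \<noteq> {}"
proof -
  have *: "lc n (\<lambda>i\<in>{..<n}. unit_vec i) c = c" if "c \<in> F2_pow n" for c
  proof -
    have "lc n (\<lambda>i\<in>{..<n}. unit_vec i) c = lc n unit_vec c" by (rule lc_cong) simp
    then show ?thesis by (simp add: lc_unit_vec [OF that])
  qed
  have "(\<lambda>i\<in>{..<n}. unit_vec i) \<in> tup n (F2_pow n)" by (auto simp: unit_vec_def F2_pow_def)
  moreover have "inj_on (lc n (\<lambda>i\<in>{..<n}. unit_vec i)) (F2_pow n)" using * by (simp add: inj_on_def)
  ultimately have "(\<lambda>i\<in>{..<n}. unit_vec i) \<in> gl n" unfolding gl_def by blast
  then show ?thesis by blast
qed

text \<open>Coordinates are grouped into \<open>D\<close> blocks of size at least \<open>a\<close>. A vector is the sum of its block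
  parts, while every other combination of block parts has a vanishing block.\<close>

definition block :: "nat \<Rightarrow> nat \<Rightarrow> nat \<Rightarrow> nat" where
  "block a D i = min (i div a) (D - 1)"

definition block_part :: "nat \<Rightarrow> nat \<Rightarrow> vec \<Rightarrow> nat \<Rightarrow> vec" where
  "block_part a D x j = (\<lambda>i. if block a D i = j then x i else 0)"

definition block_zero :: "nat \<Rightarrow> nat \<Rightarrow> nat \<Rightarrow> vec set" where
  "block_zero a D n = {x\<in>F2_pow n. \<exists>j<D. \<forall>i\<in>{j * a..<(j + 1) * a}. x i = 0}"

definition ones :: "nat \<Rightarrow> vec" where
  "ones D = (\<lambda>i. if i < D then 1 else 0)"

lemma lc_block_part:
  assumes "D \<ge> 1" shows "lc D (block_part a D x) d i = (if d (block a D i) = 1 then x i else 0)"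
proof -
  have b: "block a D i < D" using assms by (auto simp: block_def)
  have "lc D (block_part a D x) d i = (\<Sum>j<D. if j = block a D i then (if d j = 1 then x i else 0) else 0)"
    unfolding lc_def sum_vec_apply by (rule sum.cong) (auto simp: block_part_def)
  then show ?thesis using b by simp
qed

lemma block_eq:
  assumes "a \<ge> 1" "j < D" "i \<in> {j * a..<(j + 1) * a}" shows "block a D i = j"
proof -
  have "i div a = j" using assms by (intro div_nat_eqI) (auto simp: mult.commute)
  then show ?thesis using assms by (auto simp: block_def)
qed

text \<open>Union bound over the vanishing block. For fixed \<open>D\<close> the share
  \<open>D / 2 ^ a\<close> of the space can be made as small as desired, which makes it affordable
  to fix all values on this set.\<close>

lemma card_block_zero:
  assumes "D * a \<le> n" shows "card (block_zero a D n) \<le> D * 2 ^ (n - a)"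
proof -
  have eq: "{x\<in>F2_pow n. \<forall>i\<in>{j * a..<(j + 1) * a}. x i = 0} =
    {x. \<forall>i. i \<notin> {..<n} - {j * a..<(j + 1) * a} \<longrightarrow> x i = 0}" if "j < D" for j
    by (auto simp: F2_pow_def not_less)
  have "block_zero a D n = (\<Union>j\<in>{..<D}. {x\<in>F2_pow n. \<forall>i\<in>{j * a..<(j + 1) * a}. x i = 0})"
    by (auto simp: block_zero_def)
  then have "card (block_zero a D n) \<le> (\<Sum>j\<in>{..<D}. card {x\<in>F2_pow n. \<forall>i\<in>{j * a..<(j + 1) * a}. x i = 0})"
    by (simp only:) (rule card_UN_le, simp)
  also have "\<dots> = (\<Sum>j\<in>{..<D}. 2 ^ (n - a))"
  proof (rule sum.cong [OF refl])
    fix j assume j: "j \<in> {..<D}"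
    have "(j + 1) * a \<le> D * a" using j by (intro mult_right_mono) auto
    then have "{j * a..<(j + 1) * a} \<subseteq> {..<n}" using assms by auto
    then have "card ({..<n} - {j * a..<(j + 1) * a}) = n - a"
      by (subst card_Diff_subset) auto
    then show "card {x\<in>F2_pow n. \<forall>i\<in>{j * a..<(j + 1) * a}. x i = 0} = 2 ^ (n - a)"
      using j eq [of j] card_vec_support(2) [of "{..<n} - {j * a..<(j + 1) * a}"] by simp
  qed
  finally show ?thesis by simp
qed

text \<open>For the all-ones coefficient vector the block parts of \<open>x\<close> would do; a
  linear change of coefficients moves \<open>c\<close> into that place. No block of \<open>x\<close>
  vanishes, so the tuple is injective.\<close>

lemma block_tuple:
  assumes D: "D \<ge> 1" and a: "a \<ge> 1" and c: "c \<in> F2_pow D" "c \<noteq> 0"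
    and x: "x \<in> F2_pow n - block_zero a D n"
  obtains e where "e \<in> tup D (F2_pow n)" "inj_on (lc D e) (F2_pow D)" "lc D e c = x"
    "lc D e ` (F2_pow D - {0, c}) \<subseteq> block_zero a D n"
proof -
  obtain i0 where i0: "c i0 = 1" "i0 < D"
  proof -
    obtain i where "c i \<noteq> 0" using c(2) by (auto simp: fun_eq_iff)
    moreover have "i < D" using \<open>c i \<noteq> 0\<close> c(1) by (force simp: F2_pow_def not_le [symmetric])
    ultimately show thesis using that [of i] by simp
  qed
  define b where "b = block_part a D x"
  define s where "s = x + lc D b c"
  define e where "e = (\<lambda>i\<in>{..<D}. b i + (if i = i0 then s else 0))"
  have bV: "b i \<in> F2_pow n" for i using x by (auto simp: b_def block_part_def F2_pow_def)
  have sV: "s \<in> F2_pow n"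
    unfolding s_def using x bV by (intro F2.subspace_add lc_in) auto
  have ones: "lc D b (ones D) = x"
  proof
    fix i
    have "block a D i < D" using D by (auto simp: block_def)
    then show "lc D b (ones D) i = x i" by (simp add: b_def lc_block_part [OF D] ones_def)
  qed
  \<comment> \<open>Adding \<open>s\<close> to the entry \<open>i0\<close> amounts to this change of
    coefficients. It preserves the coordinate \<open>i0\<close>, hence is injective, and it sends
    \<open>c\<close> to \<open>ones D\<close>, so that no coefficient vector but \<open>c\<close>
    produces \<open>x\<close>.\<close>
  define \<tau> where "\<tau> = (\<lambda>d :: vec. if d i0 = 1 then d + ones D + c else d)"
  have lce: "lc D e d = lc D b (\<tau> d)" for d
  proof -
    have "lc D e d = lc D (\<lambda>i. b i + (if i = i0 then s else 0)) d" by (rule lc_cong) (simp add: e_def)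
    also have "\<dots> = lc D b d + lc D (\<lambda>i. if i = i0 then s else 0) d" by (rule lc_tuple_add)
    also have "lc D (\<lambda>i. if i = i0 then s else 0) d = (\<Sum>i<D. if i = i0 then (if d i = 1 then s else 0) else 0)"
      unfolding lc_def by (rule sum.cong) auto
    also have "\<dots> = (if d i0 = 1 then s else 0)" using i0 by simp
    finally show ?thesis
      using ones by (auto simp: \<tau>_def s_def lin_add [OF lin_lc] add.assoc)
  qed
  have onesF: "ones D \<in> F2_pow D" by (auto simp: ones_def F2_pow_def)
  have \<tau>F: "\<tau> d \<in> F2_pow D" if "d \<in> F2_pow D" for d
    unfolding \<tau>_def using that onesF c(1) F2.subspace_add [OF subspace_F2_pow] by simp
  have \<tau>i0: "\<tau> d i0 = d i0" for d
    using i0 by (auto simp: \<tau>_def plus_fun_apply ones_def)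
  have \<tau>0: "d = 0" if "\<tau> d = 0" for d
  proof -
    have "d i0 = 0" using \<tau>i0 [of d] that by simp
    then show ?thesis using that by (simp add: \<tau>_def)
  qed
  have \<tau>ones: "d = c" if "\<tau> d = ones D" for d
  proof -
    have "d i0 = 1" using \<tau>i0 [of d] that i0 by (simp add: ones_def)
    then have "\<tau> d = d + ones D + c" unfolding \<tau>_def by (rule if_P)
    with that have "d + ones D + c = ones D" by (simp only:)
    then have "(d + c) + ones D = ones D" by (simp only: ac_simps)
    then have "d + c = 0" by (rule vec_add_eq_right [THEN iffD1])
    then show ?thesis by (rule vec_add_eq_0 [THEN iffD1])
  qed
  have zero: "lc D b d \<in> block_zero a D n" if "d \<in> F2_pow D" "d \<noteq> ones D" for d
  proof -
    obtain j where "d j \<noteq> ones D j" using \<open>d \<noteq> ones D\<close> by (auto simp: fun_eq_iff)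
    then have j: "j < D" "d j = 0" using that(1) by (auto simp: ones_def F2_pow_def not_less split: if_splits)
    have "lc D b d i = 0" if "i \<in> {j * a..<(j + 1) * a}" for i
      using block_eq [OF a j(1) that] j(2) by (simp add: b_def lc_block_part [OF D])
    moreover have "lc D b d \<in> F2_pow n" using bV by (intro lc_in) auto
    ultimately show ?thesis using j(1) by (auto simp: block_zero_def)
  qed
  have inj0: "d = 0" if "d \<in> F2_pow D" "lc D b d = 0" for d
  proof
    fix j
    show "d j = 0 j"
    proof (cases "j < D")
      case True
      then have "\<not> (\<forall>i\<in>{j * a..<(j + 1) * a}. x i = 0)" using x unfolding block_zero_def by blast
      then obtain i where i: "i \<in> {j * a..<(j + 1) * a}" "x i \<noteq> 0" by blast
      have "lc D b d i = (if d j = 1 then x i else 0)"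
        using block_eq [OF a True i(1)] by (simp add: b_def lc_block_part [OF D])
      then show ?thesis using that(2) i(2) by (auto split: if_splits)
    next
      case False
      then show ?thesis using that(1) by (auto simp: F2_pow_def)
    qed
  qed
  show thesis
  proof (rule that)
    show "e \<in> tup D (F2_pow n)"
      using bV sV F2.subspace_add [OF subspace_F2_pow] by (auto simp: e_def)
    show "inj_on (lc D e) (F2_pow D)"
      unfolding lin_inj_on_iff [OF lin_lc subspace_F2_pow] lce using inj0 \<tau>F \<tau>0 by blast
    have "\<tau> c = ones D" using i0 by (simp add: \<tau>_def add.assoc add.left_commute [of c])
    then show "lc D e c = x" by (simp add: lce ones)
    show "lc D e ` (F2_pow D - {0, c}) \<subseteq> block_zero a D n"
      unfolding lce using zero \<tau>F \<tau>ones by blast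
  qed
qed

text \<open>Each \<open>x\<close> outside the sparse set carries a tuple from
  \<open>block_tuple\<close>. A random invertible map moves this tuple into \<open>Bd\<close> with
  probability at least \<open>\<xi>\<close>, so some single map \<open>g\<close> does so for a share
  \<open>\<xi>\<close> of these \<open>x\<close>. The image of the sparse set under this
  \<open>g\<close> then serves as \<open>R\<close> for all of them.\<close>

lemma pinning_set:
  fixes \<xi> :: real
  assumes D: "D \<ge> 1" and a: "a \<ge> 1" "D * a \<le> n" and c: "c \<in> F2_pow D" "c \<noteq> 0"
    and Bd: "Bd \<subseteq> {v\<in>tup D (F2_pow n). inj_on (lc D v) (F2_pow D)}"
    and \<xi>: "\<xi> * (2 ^ n) ^ D \<le> real (card Bd)" "0 \<le> \<xi>" "\<xi> \<le> 1"
  shows "\<exists>R\<subseteq>F2_pow n. card R \<le> D * 2 ^ (n - a) \<and> \<xi> * 2 ^ n - real (D * 2 ^ (n - a)) \<le>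
    real (card {y\<in>F2_pow n. \<exists>v\<in>Bd. lc D v c = y \<and> lc D v ` (F2_pow D - {0, c}) \<subseteq> R})"
proof -
  let ?V = "F2_pow n" and ?R0 = "block_zero a D n"
  define e where "e = (\<lambda>x. SOME e. e \<in> tup D ?V \<and> inj_on (lc D e) (F2_pow D) \<and> lc D e c = x \<and>
    lc D e ` (F2_pow D - {0, c}) \<subseteq> ?R0)"
  have e: "e x \<in> tup D ?V" "inj_on (lc D (e x)) (F2_pow D)" "lc D (e x) c = x"
    "lc D (e x) ` (F2_pow D - {0, c}) \<subseteq> ?R0" if x: "x \<in> ?V - ?R0" for x
  proof -
    have "\<exists>e. e \<in> tup D ?V \<and> inj_on (lc D e) (F2_pow D) \<and> lc D e c = x \<and> lc D e ` (F2_pow D - {0, c}) \<subseteq> ?R0"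
      by (rule block_tuple [OF D a(1) c x]) blast
    from someI_ex [OF this] show "e x \<in> tup D ?V" "inj_on (lc D (e x)) (F2_pow D)" "lc D (e x) c = x"
      "lc D (e x) ` (F2_pow D - {0, c}) \<subseteq> ?R0" by (simp_all add: e_def)
  qed
  define mv where "mv = (\<lambda>g x. \<lambda>i\<in>{..<D}. lc n g (e x i))"
  have finBd: "finite Bd" using Bd finite_tup [OF finite_F2_pow, of D n] by (auto intro: finite_subset)
  have sub0: "?R0 \<subseteq> ?V" by (auto simp: block_zero_def)
  have cR0: "card ?R0 \<le> D * 2 ^ (n - a)" by (rule card_block_zero [OF a(2)])
  have cG: "card (gl n) > 0" using gl_nonempty finite_gl by (simp add: card_gt_0_iff)
  have one: "\<xi> * real (card (gl n)) \<le> real (card {g\<in>gl n. mv g x \<in> Bd})" if x: "x \<in> ?V - ?R0" for x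
  proof -
    have iff: "mv g x = v \<longleftrightarrow> (\<forall>i<D. lc n g (e x i) = v i)" if "v \<in> Bd" for v g
    proof -
      have "v \<in> tup D ?V" using that Bd by auto
      then show ?thesis by (auto simp: mv_def fun_eq_iff PiE_iff extensional_def)
    qed
    have "{g\<in>gl n. mv g x \<in> Bd} = (\<Union>v\<in>Bd. {g\<in>gl n. \<forall>i<D. lc n g (e x i) = v i})"
    proof (rule set_eqI)
      fix g
      have "mv g x \<in> Bd \<longleftrightarrow> (\<exists>v\<in>Bd. \<forall>i<D. lc n g (e x i) = v i)"
      proof
        assume "mv g x \<in> Bd"
        then show "\<exists>v\<in>Bd. \<forall>i<D. lc n g (e x i) = v i" using iff [of "mv g x" g] by (intro bexI) simp_all
      next
        assume "\<exists>v\<in>Bd. \<forall>i<D. lc n g (e x i) = v i"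
        then obtain v where v: "v \<in> Bd" "\<forall>i<D. lc n g (e x i) = v i" ..
        then have "mv g x = v" using iff [of v g] by simp
        with v show "mv g x \<in> Bd" by simp
      qed
      then show "g \<in> {g\<in>gl n. mv g x \<in> Bd} \<longleftrightarrow> g \<in> (\<Union>v\<in>Bd. {g\<in>gl n. \<forall>i<D. lc n g (e x i) = v i})" by simp
    qed
    moreover have "card (\<Union>v\<in>Bd. {g\<in>gl n. \<forall>i<D. lc n g (e x i) = v i}) =
      (\<Sum>v\<in>Bd. card {g\<in>gl n. \<forall>i<D. lc n g (e x i) = v i})"
    proof (rule card_UN_disjoint [OF finBd])
      show "\<forall>v\<in>Bd. \<forall>w\<in>Bd. v \<noteq> w \<longrightarrow> {g\<in>gl n. \<forall>i<D. lc n g (e x i) = v i} \<inter> {g\<in>gl n. \<forall>i<D. lc n g (e x i) = w i} = {}"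
      proof (intro ballI impI)
        fix v w assume vw: "v \<in> Bd" "w \<in> Bd" "v \<noteq> w"
        then have "v \<in> tup D ?V" "w \<in> tup D ?V" using Bd by auto
        with vw(3) obtain i where "i < D" "v i \<noteq> w i" by (metis PiE_ext lessThan_iff)
        then show "{g\<in>gl n. \<forall>i<D. lc n g (e x i) = v i} \<inter> {g\<in>gl n. \<forall>i<D. lc n g (e x i) = w i} = {}"
          by fastforce
      qed
    qed (use finite_gl in auto)
    ultimately have eq: "card {g\<in>gl n. mv g x \<in> Bd} = (\<Sum>v\<in>Bd. card {g\<in>gl n. \<forall>i<D. lc n g (e x i) = v i})"
      by simp
    have "real (card Bd) * real (card (gl n)) = (\<Sum>v\<in>Bd. real (card (gl n)))" by simp
    also have "\<dots> \<le> (\<Sum>v\<in>Bd. real ((2 ^ n) ^ D * card {g\<in>gl n. \<forall>i<D. lc n g (e x i) = v i}))"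
      using Bd by (intro sum_mono of_nat_mono gl_fibre_average e [OF x]) auto
    also have "\<dots> = (2 ^ n) ^ D * real (card {g\<in>gl n. mv g x \<in> Bd})"
      by (simp add: eq sum_distrib_left)
    finally have "real (card Bd) * real (card (gl n)) \<le> (2 ^ n) ^ D * real (card {g\<in>gl n. mv g x \<in> Bd})" .
    moreover have "\<xi> * (2 ^ n) ^ D * real (card (gl n)) \<le> real (card Bd) * real (card (gl n))"
      using \<xi>(1) by (intro mult_right_mono) auto
    moreover have "(2 ^ n) ^ D * (\<xi> * real (card (gl n))) = \<xi> * (2 ^ n) ^ D * real (card (gl n))"
      by (simp only: ac_simps)
    ultimately have "(2 ^ n) ^ D * (\<xi> * real (card (gl n))) \<le> (2 ^ n) ^ D * real (card {g\<in>gl n. mv g x \<in> Bd})"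
      by linarith
    then show ?thesis by (rule mult_left_le_imp_le) simp
  qed
  have fin: "finite (?V - ?R0)" by simp
  have "(\<Sum>g\<in>gl n. card {x\<in>?V - ?R0. mv g x \<in> Bd}) = (\<Sum>x\<in>?V - ?R0. card {g\<in>gl n. mv g x \<in> Bd})"
    by (rule sum_card_swap [OF finite_gl fin])
  then have "(\<Sum>g\<in>gl n. real (card {x\<in>?V - ?R0. mv g x \<in> Bd})) = (\<Sum>x\<in>?V - ?R0. real (card {g\<in>gl n. mv g x \<in> Bd}))"
    by (simp flip: of_nat_sum)
  also have "\<dots> \<ge> (\<Sum>x\<in>?V - ?R0. \<xi> * real (card (gl n)))" by (rule sum_mono) (rule one)
  finally have "(\<xi> * real (card (?V - ?R0))) * card (gl n) \<le> (\<Sum>g\<in>gl n. real (card {x\<in>?V - ?R0. mv g x \<in> Bd}))"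
    by (simp add: ac_simps)
  then obtain g where g: "g \<in> gl n" "\<xi> * real (card (?V - ?R0)) \<le> real (card {x\<in>?V - ?R0. mv g x \<in> Bd})"
    using exists_ge_average [OF finite_gl gl_nonempty] by blast
  have ginj: "inj_on (lc n g) ?V" using g(1) by (simp add: gl_def)
  define R where "R = lc n g ` ?R0"
  let ?X = "{x\<in>?V - ?R0. mv g x \<in> Bd}"
  have "lc n g ` ?X \<subseteq> {y\<in>?V. \<exists>v\<in>Bd. lc D v c = y \<and> lc D v ` (F2_pow D - {0, c}) \<subseteq> R}"
  proof (rule image_subsetI)
    fix x assume x: "x \<in> ?X"
    have m: "lc D (mv g x) d = lc n g (lc D (e x) d)" for d
    proof -
      have "lc D (mv g x) d = lc D (\<lambda>i. lc n g (e x i)) d" by (rule lc_cong) (simp add: mv_def)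
      then show ?thesis by (simp add: lin_lc_comp [OF lin_lc])
    qed
    have "lc D (mv g x) c = lc n g x" using e(3) [of x] x by (simp add: m)
    moreover have "lc D (mv g x) ` (F2_pow D - {0, c}) \<subseteq> R"
      unfolding m R_def using e(4) [of x] x by blast
    moreover have "lc n g x \<in> ?V" using gl_image [OF g(1)] x by simp
    ultimately show "lc n g x \<in> {y\<in>?V. \<exists>v\<in>Bd. lc D v c = y \<and> lc D v ` (F2_pow D - {0, c}) \<subseteq> R}"
      using x by blast
  qed
  then have "card (lc n g ` ?X) \<le> card {y\<in>?V. \<exists>v\<in>Bd. lc D v c = y \<and> lc D v ` (F2_pow D - {0, c}) \<subseteq> R}"
    by (intro card_mono) auto
  moreover have "card (lc n g ` ?X) = card ?X"
    by (rule card_image) (rule inj_on_subset [OF ginj], auto)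
  ultimately have 1: "real (card ?X) \<le> real (card {y\<in>?V. \<exists>v\<in>Bd. lc D v c = y \<and> lc D v ` (F2_pow D - {0, c}) \<subseteq> R})"
    by simp
  have "card (?V - ?R0) = 2 ^ n - card ?R0" using sub0 by (subst card_Diff_subset) (auto intro: finite_subset)
  moreover have "card ?R0 \<le> 2 ^ n" using card_mono [OF _ sub0] by simp
  ultimately have "real (card (?V - ?R0)) = 2 ^ n - real (card ?R0)" by (simp add: of_nat_diff)
  then have "\<xi> * real (card (?V - ?R0)) = \<xi> * 2 ^ n - \<xi> * real (card ?R0)"
    by (simp only: right_diff_distrib)
  \<comment> \<open>The loss accounts for the points of the sparse set itself, which carry no
    tuple.\<close>
  moreover have "\<xi> * real (card ?R0) \<le> 1 * real (D * 2 ^ (n - a))"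
    using \<xi> of_nat_mono [OF cR0, where 'a = real] by (intro mult_mono) auto
  ultimately have "\<xi> * 2 ^ n - real (D * 2 ^ (n - a)) \<le> real (card ?X)" using g(2) by linarith
  moreover have "R \<subseteq> ?V" using gl_image [OF g(1)] sub0 by (auto simp: R_def)
  moreover have "card R \<le> D * 2 ^ (n - a)"
    using card_image_le [of ?R0 "lc n g"] cR0 finite_subset [OF sub0] by (simp add: R_def)
  moreover have "\<xi> * 2 ^ n - real (D * 2 ^ (n - a)) \<le>
    real (card {y\<in>?V. \<exists>v\<in>Bd. lc D v c = y \<and> lc D v ` (F2_pow D - {0, c}) \<subseteq> R})"
    if "\<xi> * 2 ^ n - real (D * 2 ^ (n - a)) \<le> real (card ?X)"
    using that 1 by (rule order_trans)
  ultimately show ?thesis by (intro exI[of _ R]) simp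
qed

text \<open>Only injective tuples count, since only these are moved around by invertible maps. The
  tuples later compared with bad ones are injective through \<open>sees_bb\<close>.\<close>

definition bad_tuple :: "real \<Rightarrow> real \<Rightarrow> nat \<Rightarrow> (vec \<Rightarrow> bool) set \<Rightarrow> (nat \<Rightarrow> vec) \<Rightarrow> bool" where
  "bad_tuple \<epsilon> \<beta> D K v \<longleftrightarrow> inj_on (lc D v) (F2_pow D) \<and>
    (\<exists>c\<in>F2_pow D - {0}. dep \<epsilon> \<beta> K (lc D v c) (lc D v ` (F2_pow D - {0, c})))"

text \<open>While a share \<open>\<eta>\<close> of the tuples is bad, a single coefficient vector
  \<open>c\<close> is responsible for a share \<open>\<xi>\<close>, and \<open>pinning_set\<close>
  turns these into an energy increment at the price of fixing \<open>r\<close> values. The number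
  \<open>J\<close> of rounds is independent of \<open>a\<close>, so \<open>a\<close> can be chosen
  after it to keep \<open>r * J\<close> small.\<close>

lemma container:
  fixes \<epsilon> \<beta> \<eta> \<zeta> :: real
  assumes pos: "\<epsilon> > 0" "\<beta> > 0" "\<eta> > 0" "\<epsilon> \<le> 1" "\<beta> \<le> 1" "\<eta> \<le> 1" and \<zeta>: "\<zeta> > 0" and D: "D \<ge> 1"
  shows "\<exists>n0. \<forall>n F. n \<ge> n0 \<and> finite F \<and> F \<noteq> {} \<longrightarrow> (\<exists>K\<subseteq>F. K \<noteq> {} \<and>
    real (card {v\<in>tup D (F2_pow n). bad_tuple \<epsilon> \<beta> D K v}) < \<eta> * (2 ^ n) ^ D \<and>
    2 powr (- \<zeta> * 2 ^ n) * real (card F) \<le> real (card K))"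
proof -
  define \<xi> where "\<xi> = \<eta> / 2 ^ D"
  have "\<eta> \<le> 1 * 2 ^ D" using pos(6) one_le_power [of "2::real" D] by linarith
  then have \<xi>: "0 < \<xi>" "\<xi> \<le> 1" using pos by (auto simp: \<xi>_def divide_le_eq)
  define \<iota> where "\<iota> = \<xi> / 2 * \<beta> * \<epsilon>\<^sup>2 / 2"
  have \<iota>: "\<iota> > 0" using \<xi> pos by (simp add: \<iota>_def)
  define J where "J = nat \<lceil>1 / \<iota>\<rceil> + 1"
  \<comment> \<open>The first bound keeps \<open>r\<close> below half of
    \<open>\<xi> * 2 ^ n\<close> in a single round, the second keeps \<open>r * J\<close> below half
    of \<open>\<zeta> * 2 ^ n\<close>.\<close>
  define x where "x = max (2 * real D / \<xi>) (2 * real D * real J / \<zeta>)"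
  obtain a0 where a0: "x < 2 ^ a0" using real_arch_pow [of 2 x] by auto
  define a where "a = a0 + 1"
  have a1: "a \<ge> 1" "a0 \<le> a" by (auto simp: a_def)
  have "(2::real) ^ a0 \<le> 2 ^ a" using a1(2) by (rule power_increasing) simp
  then have a: "a \<ge> 1" "x \<le> 2 ^ a" using a0 a1 by linarith+
  have "2 * real D / \<xi> \<le> 2 ^ a" "2 * real D * real J / \<zeta> \<le> 2 ^ a" using a(2) by (auto simp: x_def)
  then have Da: "real D / 2 ^ a \<le> \<xi> / 2" "real D * real J / 2 ^ a \<le> \<zeta> / 2"
    using \<xi> \<zeta> by (auto simp: field_simps)
  \<comment> \<open>\<open>2 powr (- L)\<close> is the part of the loss that does not depend on
    \<open>n\<close>; the other half of \<open>\<zeta>\<close> absorbs it for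
    \<open>n \<ge> n1\<close>.\<close>
  define L where "L = - real J * log 2 (\<iota> / 2)"
  obtain n1 where n1: "2 * L / \<zeta> < 2 ^ n1" using real_arch_pow [of 2 "2 * L / \<zeta>"] by auto
  show ?thesis
  proof (rule exI[of _ "max n1 (D * a)"], intro allI impI)
    fix n and F :: "(vec \<Rightarrow> bool) set" assume "n \<ge> max n1 (D * a) \<and> finite F \<and> F \<noteq> {}"
    then have n: "n \<ge> n1" "D * a \<le> n" and F: "finite F" "F \<noteq> {}" by auto
    define r where "r = D * 2 ^ (n - a)"
    have "a \<le> D * a" using D by simp
    then have "a \<le> n" using n by linarith
    then have "(2::real) ^ (n - a) = 2 ^ n / 2 ^ a" by (simp add: power_diff)
    then have r: "real r = real D / 2 ^ a * 2 ^ n" by (simp add: r_def)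
    let ?V = "F2_pow n"
    have "\<exists>K\<subseteq>F. K \<noteq> {} \<and> real (card {v\<in>tup D ?V. bad_tuple \<epsilon> \<beta> D K v}) < \<eta> * (2 ^ n) ^ D \<and>
      (\<xi> / 2 * \<beta> * \<epsilon>\<^sup>2 / 2 / 2 / 2 ^ r) ^ (nat \<lceil>1 / (\<xi> / 2 * \<beta> * \<epsilon>\<^sup>2 / 2)\<rceil> + 1) * real (card F) \<le> real (card K)"
    proof (rule energy_iteration [where V = ?V])
      fix K assume K: "K \<subseteq> F" "K \<noteq> {}" "\<not> real (card {v\<in>tup D ?V. bad_tuple \<epsilon> \<beta> D K v}) < \<eta> * (2 ^ n) ^ D"
      define Bc where "Bc = (\<lambda>c. {v\<in>tup D ?V. inj_on (lc D v) (F2_pow D) \<and>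
        dep \<epsilon> \<beta> K (lc D v c) (lc D v ` (F2_pow D - {0, c}))})"
      have fin: "finite (tup D ?V)" by (rule finite_tup) simp
      have "{v\<in>tup D ?V. bad_tuple \<epsilon> \<beta> D K v} = (\<Union>c\<in>F2_pow D - {0}. Bc c)"
        by (auto simp: bad_tuple_def Bc_def)
      then have "card {v\<in>tup D ?V. bad_tuple \<epsilon> \<beta> D K v} \<le> (\<Sum>c\<in>F2_pow D - {0}. card (Bc c))"
        by (simp only:) (rule card_UN_le, simp)
      then have "real (card {v\<in>tup D ?V. bad_tuple \<epsilon> \<beta> D K v}) \<le> (\<Sum>c\<in>F2_pow D - {0}. real (card (Bc c)))"
        by (simp flip: of_nat_sum)
      then have "\<eta> * (2 ^ n) ^ D \<le> (\<Sum>c\<in>F2_pow D - {0}. real (card (Bc c)))" using K(3) by linarith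
      moreover have "\<xi> * (2 ^ n) ^ D * real (card (F2_pow D - {0})) \<le> \<xi> * (2 ^ n) ^ D * 2 ^ D"
        using \<xi> by (intro mult_left_mono) (auto simp: card_Diff_singleton of_nat_diff)
      moreover have "\<xi> * (2 ^ n) ^ D * 2 ^ D = \<eta> * (2 ^ n) ^ D" by (simp add: \<xi>_def)
      ultimately have "\<xi> * (2 ^ n) ^ D * real (card (F2_pow D - {0})) \<le> (\<Sum>c\<in>F2_pow D - {0}. real (card (Bc c)))"
        by linarith
      moreover have "unit_vec 0 \<in> F2_pow D - {0}"
        using D by (auto simp: unit_vec_def F2_pow_def fun_eq_iff)
      then have "F2_pow D - {0} \<noteq> {}" by blast
      ultimately obtain c where c: "c \<in> F2_pow D - {0}" "\<xi> * (2 ^ n) ^ D \<le> real (card (Bc c))"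
        using exists_ge_average [of "F2_pow D - {0}" "\<xi> * (2 ^ n) ^ D" "\<lambda>c. real (card (Bc c))"] by auto
      have "\<exists>R\<subseteq>?V. card R \<le> D * 2 ^ (n - a) \<and> \<xi> * 2 ^ n - real (D * 2 ^ (n - a)) \<le>
        real (card {y\<in>?V. \<exists>v\<in>Bc c. lc D v c = y \<and> lc D v ` (F2_pow D - {0, c}) \<subseteq> R})"
        using c \<xi> by (intro pinning_set [OF D a(1) n(2)]) (auto simp: Bc_def)
      then obtain R where R: "R \<subseteq> ?V" "card R \<le> r"
        "\<xi> * 2 ^ n - real r \<le> real (card {y\<in>?V. \<exists>v\<in>Bc c. lc D v c = y \<and> lc D v ` (F2_pow D - {0, c}) \<subseteq> R})"
        by (auto simp: r_def)
      have "{y\<in>?V. \<exists>v\<in>Bc c. lc D v c = y \<and> lc D v ` (F2_pow D - {0, c}) \<subseteq> R} \<subseteq> {x\<in>?V. dep \<epsilon> \<beta> K x R}"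
        using dep_mono by (auto simp: Bc_def)
      then have "card {y\<in>?V. \<exists>v\<in>Bc c. lc D v c = y \<and> lc D v ` (F2_pow D - {0, c}) \<subseteq> R} \<le> card {x\<in>?V. dep \<epsilon> \<beta> K x R}"
        by (intro card_mono) auto
      moreover have "real r \<le> \<xi> / 2 * 2 ^ n" unfolding r using Da(1) by (rule mult_right_mono) simp
      ultimately have "\<xi> / 2 * real (card ?V) \<le> real (card {x\<in>?V. dep \<epsilon> \<beta> K x R})"
        using R(3) by simp
      then show "\<exists>R\<subseteq>?V. card R \<le> r \<and> \<xi> / 2 * real (card ?V) \<le> real (card {x\<in>?V. dep \<epsilon> \<beta> K x R})"
        using R by blast
    qed (use pos \<xi> F in \<open>auto intro: zero_in_F2_pow\<close>)
    then obtain K where K: "K \<subseteq> F" "K \<noteq> {}" "real (card {v\<in>tup D ?V. bad_tuple \<epsilon> \<beta> D K v}) < \<eta> * (2 ^ n) ^ D"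
      "(\<iota> / 2 / 2 ^ r) ^ J * real (card F) \<le> real (card K)"
      unfolding J_def \<iota>_def by blast
    have "2 powr (- \<zeta> * 2 ^ n) \<le> 2 powr (- L - real (r * J))"
    proof (rule powr_mono)
      have "(2::real) ^ n1 \<le> 2 ^ n" using n by (intro power_increasing) auto
      then have "2 * L / \<zeta> \<le> 2 ^ n" using n1 by linarith
      then have "L \<le> \<zeta> / 2 * 2 ^ n" using \<zeta> by (simp add: field_simps)
      moreover have "real (r * J) = real D * real J / 2 ^ a * 2 ^ n" by (simp add: r)
      moreover have "\<dots> \<le> \<zeta> / 2 * 2 ^ n" using Da(2) by (rule mult_right_mono) simp
      ultimately show "- \<zeta> * 2 ^ n \<le> - L - real (r * J)" by linarith
    qed simp
    also have "\<dots> = (\<iota> / 2 / 2 ^ r) ^ J"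
    proof -
      have "(\<iota> / 2) ^ J = (2 powr log 2 (\<iota> / 2)) ^ J" using \<iota> by simp
      also have "\<dots> = 2 powr (- L)" by (simp add: powr_power L_def mult.commute)
      finally have "(\<iota> / 2) ^ J = 2 powr (- L)" .
      moreover have "(\<iota> / 2 / 2 ^ r) ^ J = (\<iota> / 2) ^ J / 2 ^ (r * J)"
        by (simp only: power_divide power_mult)
      moreover have "2 powr real (r * J) = (2 :: real) ^ (r * J)" by (rule powr_realpow) simp
      ultimately show ?thesis by (simp only: powr_diff)
    qed
    finally have "2 powr (- \<zeta> * 2 ^ n) * real (card F) \<le> (\<iota> / 2 / 2 ^ r) ^ J * real (card F)"
      by (rule mult_right_mono) simp
    then have "2 powr (- \<zeta> * 2 ^ n) * real (card F) \<le> real (card K)" using K(4) by linarith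
    with K show "\<exists>K\<subseteq>F. K \<noteq> {} \<and> real (card {v\<in>tup D ?V. bad_tuple \<epsilon> \<beta> D K v}) < \<eta> * (2 ^ n) ^ D \<and>
      2 powr (- \<zeta> * 2 ^ n) * real (card F) \<le> real (card K)" by blast
  qed
qed

section \<open>Counting\<close>

lemma sum_Pow_power_card:
  assumes "finite A" shows "(\<Sum>X\<in>Pow A. (t :: real) ^ card X) = (1 + t) ^ card A"
  using assms
proof (induction A rule: finite_induct)
  case (insert a A)
  have "(\<Sum>X\<in>insert a ` Pow A. t ^ card X) = (\<Sum>X\<in>Pow A. t ^ card (insert a X))"
    using insert(2) by (intro sum.reindex_cong [of "insert a"]) (auto simp: inj_on_def)
  also have "\<dots> = (\<Sum>X\<in>Pow A. t * t ^ card X)"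
    using insert(1,2) by (intro sum.cong refl) (auto simp: card_insert_if finite_subset)
  finally have *: "(\<Sum>X\<in>insert a ` Pow A. t ^ card X) = t * (1 + t) ^ card A"
    by (simp add: insert.IH flip: sum_distrib_left)
  have "(\<Sum>X\<in>Pow (insert a A). t ^ card X) = (\<Sum>X\<in>Pow A. t ^ card X) + (\<Sum>X\<in>insert a ` Pow A. t ^ card X)"
    unfolding Pow_insert using insert(1,2) by (intro sum.union_disjoint) auto
  then show ?case using insert(1,2) by (simp add: * insert.IH algebra_simps)
qed simp

text \<open>Exponential weights: all subsets together weigh \<open>(1 + t) ^ card A\<close>, while
  each small one weighs at least \<open>t powr (l * card A)\<close>. First \<open>t\<close> and then
  \<open>l\<close> is chosen, each at the cost of half of \<open>\<xi>\<close>.\<close>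

lemma small_subsets:
  fixes \<xi> :: real
  assumes "\<xi> > 0"
  shows "\<exists>l>0. \<forall>A :: 'a set. finite A \<longrightarrow> real (card {X. X \<subseteq> A \<and> real (card X) \<le> l * real (card A)}) \<le> 2 powr (\<xi> * real (card A))"
proof -
  define t where "t = min 1 (2 powr (\<xi> / 2) - 1)"
  have "2 powr (\<xi> / 2) > (1::real)" using powr_less_mono [of 0 "\<xi> / 2" "2::real"] assms by simp
  then have t: "0 < t" "t \<le> 1" "1 + t \<le> 2 powr (\<xi> / 2)" by (auto simp: t_def)
  \<comment> \<open>The lower bound 1 keeps the division by \<open>m\<close> meaningful for
    \<open>t = 1\<close>, where the logarithm vanishes.\<close>
  define m where "m = max 1 (- log 2 t)"
  define l where "l = \<xi> / 2 / m"
  have m: "m \<ge> 1" "- log 2 t \<le> m" by (auto simp: m_def)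
  have l: "l > 0" using assms m by (simp add: l_def)
  show ?thesis
  proof (intro exI[of _ l] conjI l allI impI)
    fix A :: "'a set" assume A: "finite A"
    define N where "N = real (card A)"
    let ?S = "{X. X \<subseteq> A \<and> real (card X) \<le> l * real (card A)}"
    have tX: "t powr (l * N) \<le> t ^ card X" if "X \<in> ?S" for X
    proof -
      have "t powr (l * N) \<le> t powr (real (card X))"
        using that t by (intro powr_mono') (auto simp: N_def)
      then show ?thesis using t by (simp add: powr_realpow)
    qed
    have "real (card ?S) * t powr (l * N) = (\<Sum>X\<in>?S. t powr (l * N))" by simp
    also have "\<dots> \<le> (\<Sum>X\<in>?S. t ^ card X)" using tX by (rule sum_mono)
    also have "\<dots> \<le> (\<Sum>X\<in>Pow A. t ^ card X)" using A t by (intro sum_mono2) auto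
    also have "\<dots> = (1 + t) ^ card A" by (rule sum_Pow_power_card [OF A])
    also have "\<dots> \<le> (2 powr (\<xi> / 2)) ^ card A" using t by (intro power_mono) auto
    also have "\<dots> = 2 powr (\<xi> / 2 * N)" by (simp add: powr_power N_def mult.commute)
    finally have 1: "real (card ?S) * t powr (l * N) \<le> 2 powr (\<xi> / 2 * N)" .
    have "t powr (l * N) = 2 powr (log 2 t * (l * N))" using t by (simp flip: powr_powr)
    moreover have "2 powr (- (\<xi> / 2 * N)) \<le> 2 powr (log 2 t * (l * N))"
    proof (rule powr_mono)
      have "- log 2 t * (l * N) \<le> m * (l * N)" using m l by (intro mult_right_mono) (auto simp: N_def)
      also have "m * (l * N) = \<xi> / 2 * N" using m by (simp add: l_def)
      finally show "- (\<xi> / 2 * N) \<le> log 2 t * (l * N)" by simp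
    qed simp
    ultimately have "2 powr (- (\<xi> / 2 * N)) \<le> t powr (l * N)" by simp
    then have "real (card ?S) * 2 powr (- (\<xi> / 2 * N)) \<le> real (card ?S) * t powr (l * N)"
      by (rule mult_left_mono) simp
    with 1 have "real (card ?S) * 2 powr (- (\<xi> / 2 * N)) \<le> 2 powr (\<xi> / 2 * N)" by linarith
    then have "real (card ?S) * 2 powr (- (\<xi> / 2 * N)) * 2 powr (\<xi> / 2 * N) \<le> 2 powr (\<xi> / 2 * N) * 2 powr (\<xi> / 2 * N)"
      by (rule mult_right_mono) simp
    then have "real (card ?S) \<le> 2 powr (\<xi> / 2 * N + \<xi> / 2 * N)"
      by (simp add: mult.assoc powr_add flip: powr_add)
    then show "real (card ?S) \<le> 2 powr (\<xi> * real (card A))" by (simp add: N_def)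
  qed
qed

text \<open>Markov's inequality: on average a member of \<open>K\<close> departs from
  \<open>maj\<close> at no more than \<open>2 * \<epsilon> * card V\<close> points, so at most half
  of them do so at more than twice as many.\<close>

lemma typical_members:
  fixes \<epsilon> :: real
  assumes K: "finite K" and V: "finite V" "V \<noteq> {}" and T: "T \<subseteq> V" and \<epsilon>: "\<epsilon> > 0"
    and maj: "\<And>x. x \<in> T \<Longrightarrow> real (card {f\<in>K. f x \<noteq> maj x}) \<le> 2 * \<epsilon> * real (card K)"
  shows "real (card K) \<le> 2 * real (card {f\<in>K. real (card {x\<in>T. f x \<noteq> maj x}) \<le> 4 * \<epsilon> * real (card V)})"
proof -
  let ?G = "{f\<in>K. real (card {x\<in>T. f x \<noteq> maj x}) \<le> 4 * \<epsilon> * real (card V)}"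
  have finT: "finite T" using T V finite_subset by blast
  have cV: "real (card V) > 0" using V by (simp add: card_gt_0_iff)
  have "real (card (K - ?G)) * (4 * \<epsilon> * real (card V)) = (\<Sum>f\<in>K - ?G. 4 * \<epsilon> * real (card V))" by simp
  also have "\<dots> \<le> (\<Sum>f\<in>K - ?G. real (card {x\<in>T. f x \<noteq> maj x}))" by (rule sum_mono) auto
  also have "\<dots> \<le> (\<Sum>f\<in>K. real (card {x\<in>T. f x \<noteq> maj x}))" using K by (intro sum_mono2) auto
  also have "\<dots> = (\<Sum>x\<in>T. real (card {f\<in>K. f x \<noteq> maj x}))"
    using sum_card_swap [OF K finT, of "\<lambda>f x. f x \<noteq> maj x"] by (simp flip: of_nat_sum)
  also have "\<dots> \<le> (\<Sum>x\<in>T. 2 * \<epsilon> * real (card K))" using maj by (rule sum_mono)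
  also have "\<dots> = real (card T) * (2 * \<epsilon> * real (card K))" by simp
  also have "\<dots> \<le> real (card V) * (2 * \<epsilon> * real (card K))"
    using T V \<epsilon> by (intro mult_right_mono) (auto intro: card_mono)
  finally have "(2 * \<epsilon> * real (card V)) * (2 * real (card (K - ?G))) \<le> (2 * \<epsilon> * real (card V)) * real (card K)"
    by (simp add: ac_simps)
  then have "2 * real (card (K - ?G)) \<le> real (card K)"
    by (rule mult_left_le_imp_le) (use \<epsilon> cV in simp)
  moreover have "card K = card (K - ?G) + card ?G"
  proof -
    have "card ?G \<le> card K" using K by (intro card_mono) auto
    then show ?thesis using K by (subst card_Diff_subset) auto
  qed
  ultimately show ?thesis by simp
qed

text \<open>On \<open>Y\<close> a member is given by its values outside \<open>T\<close> and by its
  small set of exceptions to \<open>maj\<close> inside \<open>T\<close>.\<close>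

lemma restriction_count:
  fixes V :: "'a set"
  assumes V: "finite V" and T: "T \<subseteq> V" and Y: "Y \<subseteq> V"
    and K: "\<And>f. f \<in> K \<Longrightarrow> real (card {x\<in>T. f x \<noteq> maj x}) \<le> l * real (card V)"
  shows "card ((\<lambda>f. {x\<in>Y. f x}) ` K) \<le> 2 ^ card (Y - T) * card {X. X \<subseteq> V \<and> real (card X) \<le> l * real (card V)}"
proof -
  let ?S = "{X. X \<subseteq> V \<and> real (card X) \<le> l * real (card V)}"
  let ?m = "\<lambda>(B, X). B \<union> {x\<in>Y \<inter> T. maj x \<noteq> (x \<in> X)}"
  have finY: "finite (Y - T)" using Y V by (meson finite_Diff finite_subset)
  have finS: "finite ?S" by (rule finite_subset [of _ "Pow V"]) (use V in auto)
  have "(\<lambda>f. {x\<in>Y. f x}) ` K \<subseteq> ?m ` (Pow (Y - T) \<times> ?S)"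
  proof (rule image_subsetI)
    fix f assume f: "f \<in> K"
    have "{x\<in>Y. f x} = ?m ({x\<in>Y - T. f x}, {x\<in>T. f x \<noteq> maj x})" by auto
    moreover have "({x\<in>Y - T. f x}, {x\<in>T. f x \<noteq> maj x}) \<in> Pow (Y - T) \<times> ?S"
      using K [OF f] T by auto
    ultimately show "{x\<in>Y. f x} \<in> ?m ` (Pow (Y - T) \<times> ?S)" by (rule image_eqI)
  qed
  then have "card ((\<lambda>f. {x\<in>Y. f x}) ` K) \<le> card (?m ` (Pow (Y - T) \<times> ?S))"
    using finY finS by (intro card_mono) auto
  also have "\<dots> \<le> card (Pow (Y - T) \<times> ?S)"
    using finY finS by (intro card_image_le) auto
  finally show ?thesis using finY by (simp add: card_cartesian_product card_Pow)
qed

text \<open>\<open>\<pi>\<close> is a quotient map by \<open>W\<close>. The identity of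
  \<open>W\<close> is extended to an embedding of \<open>F2_pow n\<close> whose new directions use
  the fresh coordinates \<open>n..<n + k\<close>; reading off these coordinates gives
  \<open>\<pi>\<close>.\<close>

lemma subspace_functional:
  assumes W: "F2.subspace W" "W \<subseteq> F2_pow n" "card W * 2 ^ k = 2 ^ n"
  obtains \<pi> where "lin \<pi>" "\<And>x. \<pi> x \<in> F2_pow k" "\<And>x. x \<in> F2_pow n \<Longrightarrow> \<pi> x = 0 \<longleftrightarrow> x \<in> W"
proof -
  let ?C = "{v :: vec. \<forall>i. i \<notin> {n..<n + k} \<longrightarrow> v i = 0}"
  have C: "F2.subspace ?C" by (auto simp: subspace_iff plus_fun_apply)
  have finC: "finite ?C" "card ?C = 2 ^ k" using card_vec_support [of "{n..<n + k}"] by auto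
  have CW: "?C \<inter> W \<subseteq> {0}"
  proof
    fix x assume x: "x \<in> ?C \<inter> W"
    then have "x \<in> F2_pow n" using W(2) by blast
    then have "x i = 0" for i using x by (cases "i < n") (auto simp: F2_pow_def)
    then show "x \<in> {0}" by (simp add: fun_eq_iff)
  qed
  obtain \<psi> where \<psi>: "lin \<psi>" "\<And>x. x \<in> W \<Longrightarrow> \<psi> x = id x" "\<And>x. x \<in> F2_pow n - W \<Longrightarrow> \<psi> x \<notin> W"
    "\<And>x. x \<in> F2_pow n \<Longrightarrow> \<exists>c\<in>?C. \<exists>u\<in>W. \<psi> x = c + u"
    by (rule extend_embedding [OF subspace_F2_pow finite_F2_pow W(1,2) F2.linear_id _ _ W(1) C finC(1) CW])
      (use W(3) finC in auto)
  define \<pi> where "\<pi> = (\<lambda>x i. if i < k then \<psi> x (n + i) else 0)"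
  show thesis
  proof (rule that)
    have "\<psi> (x + y) = \<psi> x + \<psi> y" for x y by (rule lin_add [OF \<psi>(1)])
    then show "lin \<pi>" by (auto simp: lin_iff \<pi>_def fun_eq_iff plus_fun_apply)
    show "\<pi> x \<in> F2_pow k" for x by (auto simp: \<pi>_def F2_pow_def)
    fix x assume x: "x \<in> F2_pow n"
    show "\<pi> x = 0 \<longleftrightarrow> x \<in> W"
    proof
      assume "x \<in> W"
      then have "\<psi> x = x" using \<psi>(2) by simp
      then show "\<pi> x = 0" using x by (auto simp: \<pi>_def fun_eq_iff F2_pow_def)
    next
      assume 0: "\<pi> x = 0"
      obtain c u where cu: "c \<in> ?C" "u \<in> W" "\<psi> x = c + u" using \<psi>(4) [OF x] by blast
      have "c i = 0" for i
      proof (cases "i \<in> {n..<n + k}")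
        case True
        have "u \<in> F2_pow n" using cu W by blast
        then have u0: "u i = 0" using True by (auto simp: F2_pow_def)
        have "\<pi> x (i - n) = 0" using 0 by simp
        moreover have "i - n < k" "n + (i - n) = i" using True by auto
        ultimately have "\<psi> x i = 0" by (simp add: \<pi>_def)
        with u0 show ?thesis using cu(3) by (simp add: plus_fun_apply)
      qed (use cu in auto)
      then have "c = 0" by (simp add: fun_eq_iff)
      then have "\<psi> x \<in> W" using cu by simp
      then show "x \<in> W" using \<psi>(3) x by blast
    qed
  qed
qed

text \<open>Many translates of the embedding, with disjoint images of \<open>A - E\<close>, come from a maximal
  conflict-free family of linear shifts.\<close>

lemma disjoint_extensions:
  assumes A: "F2.subspace A" "finite A" and E: "F2.subspace E" "E \<subseteq> A" "E \<noteq> A" "card A \<le> 2 ^ k * card E"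
    and W: "F2.subspace W" "W \<subseteq> F2_pow n" "card W * 2 ^ k = 2 ^ n"
    and \<theta>0: "lin \<theta>0" "inj_on \<theta>0 E" "\<theta>0 ` E \<subseteq> W"
  obtains I :: "(nat \<Rightarrow> vec) set" and \<Theta> where "finite I" "card W \<le> card I * (card A)\<^sup>2"
    "\<And>v. v \<in> I \<Longrightarrow> lin (\<Theta> v) \<and> inj_on (\<Theta> v) A \<and> \<Theta> v ` A \<subseteq> F2_pow n \<and> (\<forall>p\<in>E. \<Theta> v p = \<theta>0 p) \<and>
      \<Theta> v ` (A - E) \<inter> W = {}"
    "\<And>v w. v \<in> I \<Longrightarrow> w \<in> I \<Longrightarrow> v \<noteq> w \<Longrightarrow> \<Theta> v ` (A - E) \<inter> \<Theta> w ` (A - E) = {}"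
proof -
  let ?V = "F2_pow n"
  obtain C where C: "F2.subspace C" "C \<subseteq> ?V" "C \<inter> W \<subseteq> {0}" "card ?V = card W * card C"
    by (rule complement_exists [OF subspace_F2_pow finite_F2_pow W(1,2)])
  have finW: "finite W" and finC: "finite C" using W(2) C(2) by (auto intro: finite_subset)
  have W0: "card W > 0" using finW F2.subspace_0 [OF W(1)] by (auto simp: card_gt_0_iff)
  have "card W * card C = card W * 2 ^ k" using W(3) C(4) by (simp only: card_F2_pow)
  then have cC: "card C = 2 ^ k" using nat_mult_eq_cancel1 [OF W0] by blast
  obtain \<theta> where \<theta>: "lin \<theta>" "inj_on \<theta> A" "\<And>x. x \<in> E \<Longrightarrow> \<theta> x = \<theta>0 x"
    "\<And>x. x \<in> A - E \<Longrightarrow> \<theta> x \<notin> W" "\<And>x. x \<in> A \<Longrightarrow> \<exists>c\<in>C. \<exists>u\<in>W. \<theta> x = c + u"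
    by (rule extend_embedding [OF A E(1,2) \<theta>0 W(1) C(1) finC C(3)]) (use E(4) cC in \<open>auto simp: mult.commute\<close>)
  have \<theta>V: "\<theta> x \<in> ?V" if "x \<in> A" for x
  proof -
    obtain c u where "c \<in> C" "u \<in> W" "\<theta> x = c + u" using \<theta>(5) [OF \<open>x \<in> A\<close>] by blast
    then show ?thesis using C(2) W(2) F2.subspace_add [OF subspace_F2_pow, of c n u] by auto
  qed
  obtain \<pi> where \<pi>: "lin \<pi>" "\<And>x. \<pi> x \<in> F2_pow k" "\<And>x. x \<in> ?V \<Longrightarrow> \<pi> x = 0 \<longleftrightarrow> x \<in> W"
    by (rule subspace_functional [OF W]) blast
  define \<kappa> where "\<kappa> = (\<lambda>p. \<pi> (\<theta> p))"
  have \<kappa>: "lin \<kappa>" using \<pi>(1) \<theta>(1) by (simp add: lin_iff \<kappa>_def)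
  have \<kappa>E: "\<kappa> p = 0" if "p \<in> E" for p
    using \<pi>(3) [OF \<theta>V, of p] \<theta>(3) [OF that] \<theta>0(3) that E(2) by (auto simp: \<kappa>_def)
  have \<kappa>A: "\<kappa> p \<noteq> 0" if "p \<in> A - E" for p
    using \<pi>(3) [OF \<theta>V, of p] \<theta>(4) [OF that] that by (auto simp: \<kappa>_def)
  \<comment> \<open>\<open>\<kappa>\<close> vanishes on \<open>E\<close> and nowhere on
    \<open>A - E\<close>. So the shift leaves the copy of \<open>E\<close> alone, while for random
    \<open>v\<close> the image of any other point is uniform in a coset of \<open>W\<close>.\<close>
  define \<Theta> where "\<Theta> = (\<lambda>v p. \<theta> p + lc k v (\<kappa> p))"
  have lcW: "lc k v c \<in> W" if "v \<in> tup k W" for v c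
    by (rule lc_in [OF W(1)]) (use that PiE_mem in blast)
  have good: "lin (\<Theta> v) \<and> inj_on (\<Theta> v) A \<and> \<Theta> v ` A \<subseteq> ?V \<and> (\<forall>p\<in>E. \<Theta> v p = \<theta>0 p) \<and>
      \<Theta> v ` (A - E) \<inter> W = {}" if v: "v \<in> tup k W" for v
  proof -
    have l: "lin (\<Theta> v)"
      using lin_add [OF \<theta>(1)] lin_add [OF \<kappa>] lin_add [OF lin_lc, of k v] by (simp add: lin_iff \<Theta>_def ac_simps)
    have e: "\<Theta> v p = \<theta>0 p" if "p \<in> E" for p using \<kappa>E [OF that] \<theta>(3) [OF that] by (simp add: \<Theta>_def)
    have nW: "\<Theta> v p \<notin> W" if "p \<in> A - E" for p
    proof
      assume "\<Theta> v p \<in> W"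
      then have "\<Theta> v p + lc k v (\<kappa> p) \<in> W" using lcW [OF v] by (rule F2.subspace_add [OF W(1)])
      moreover have "\<Theta> v p + lc k v (\<kappa> p) = \<theta> p" by (simp add: \<Theta>_def add.assoc)
      ultimately show False using \<theta>(4) [OF that] by simp
    qed
    have "p = 0" if "p \<in> A" "\<Theta> v p = 0" for p
    proof -
      have pE: "p \<in> E" using nW [of p] that F2.subspace_0 [OF W(1)] by auto
      then have "\<theta>0 p = 0" using e that by simp
      then show ?thesis using \<theta>0(2) pE lin_inj_on_iff [OF \<theta>0(1) E(1)] by blast
    qed
    then have "inj_on (\<Theta> v) A" using lin_inj_on_iff [OF l A(1)] by blast
    moreover have "\<Theta> v p \<in> ?V" if "p \<in> A" for p
      unfolding \<Theta>_def using \<theta>V [OF that] lcW [OF v] W(2) by (intro F2.subspace_add) auto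
    ultimately show ?thesis using l e nW by blast
  qed
  define conf where "conf = (\<lambda>v w. \<exists>p\<in>A - E. \<exists>q\<in>A - E. \<Theta> v p = \<Theta> w q)"
  define \<I> where "\<I> = {I. I \<subseteq> tup k W \<and> (\<forall>v\<in>I. \<forall>w\<in>I. v \<noteq> w \<longrightarrow> \<not> conf v w)}"
  have fint: "finite (tup k W)" using finW by (rule finite_tup)
  have "finite \<I>" by (rule finite_subset [of _ "Pow (tup k W)"]) (use fint in \<open>auto simp: \<I>_def\<close>)
  moreover have "{} \<in> \<I>" by (simp add: \<I>_def)
  ultimately obtain I where I: "I \<in> \<I>" "\<And>J. J \<in> \<I> \<Longrightarrow> I \<subseteq> J \<Longrightarrow> I = J"
    using finite_has_maximal [of \<I>] by blast
  have It: "I \<subseteq> tup k W" "\<And>v w. v \<in> I \<Longrightarrow> w \<in> I \<Longrightarrow> v \<noteq> w \<Longrightarrow> \<not> conf v w" using I(1) by (auto simp: \<I>_def)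
  have finI: "finite I" using It(1) fint by (rule finite_subset)
  have sym: "conf v w \<Longrightarrow> conf w v" for v w unfolding conf_def by metis
  have cov: "\<exists>v\<in>I. conf v w" if w: "w \<in> tup k W" for w
  proof (cases "w \<in> I")
    case True
    have "A - E \<noteq> {}" using E by blast
    then have "conf w w" by (auto simp: conf_def)
    with True show ?thesis by blast
  next
    case False
    show ?thesis
    proof (rule ccontr)
      assume "\<not> ?thesis"
      then have "insert w I \<in> \<I>" using It w sym by (auto simp: \<I>_def)
      from I(2) [OF this] False show False by blast
    qed
  qed
  \<comment> \<open>A conflict for given \<open>v\<close>, \<open>p\<close>, \<open>q\<close>
    prescribes the value of \<open>lc k w\<close> at the nonzero vector \<open>\<kappa> q\<close>,
    which at most one in \<open>card W\<close> of the tuples \<open>w\<close> has. By maximality the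
    conflicts with \<open>I\<close> exhaust all tuples, so \<open>I\<close> is large.\<close>
  let ?Z = "\<lambda>v p q. {w\<in>tup k W. \<Theta> v p = \<Theta> w q}"
  have Z: "card (?Z v p q) * card W \<le> card W ^ k" if v: "v \<in> I" and p: "p \<in> A - E" and q: "q \<in> A - E" for v p q
  proof -
    define y where "y = \<Theta> v p + \<theta> q"
    have "?Z v p q = {w\<in>tup k W. lc k w (\<kappa> q) = y}"
    proof -
      have "\<Theta> v p = \<Theta> w q \<longleftrightarrow> lc k w (\<kappa> q) = y" for w
      proof -
        have "\<Theta> w q = \<theta> q + lc k w (\<kappa> q)" by (simp add: \<Theta>_def)
        then show ?thesis unfolding y_def by (metis add.commute vec_add_cancel(1))
      qed
      then show ?thesis by simp
    qed
    then have "card (?Z v p q) * card W = card {x\<in>W. x = y} * card W ^ k"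
      using count_single [OF W(1) finW _ \<kappa>A [OF q], of k "\<lambda>x. x = y"] \<pi>(2) by (simp add: \<kappa>_def)
    moreover have "card {x\<in>W. x = y} \<le> card {y}" by (rule card_mono) auto
    ultimately show ?thesis by simp
  qed
  have "tup k W \<subseteq> (\<Union>t\<in>I \<times> ((A - E) \<times> (A - E)). ?Z (fst t) (fst (snd t)) (snd (snd t)))"
  proof
    fix w assume w: "w \<in> tup k W"
    then obtain v p q where "v \<in> I" "p \<in> A - E" "q \<in> A - E" "\<Theta> v p = \<Theta> w q" using cov [OF w] unfolding conf_def by blast
    with w show "w \<in> (\<Union>t\<in>I \<times> ((A - E) \<times> (A - E)). ?Z (fst t) (fst (snd t)) (snd (snd t)))"
      by (intro UN_I [of "(v, p, q)"]) auto
  qed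
  then have "card (tup k W) \<le> card (\<Union>t\<in>I \<times> ((A - E) \<times> (A - E)). ?Z (fst t) (fst (snd t)) (snd (snd t)))"
    using finI A(2) fint by (intro card_mono) auto
  also have "\<dots> \<le> (\<Sum>t\<in>I \<times> ((A - E) \<times> (A - E)). card (?Z (fst t) (fst (snd t)) (snd (snd t))))"
    using finI A(2) by (intro card_UN_le) auto
  finally have "card W ^ k * card W \<le> (\<Sum>t\<in>I \<times> ((A - E) \<times> (A - E)). card (?Z (fst t) (fst (snd t)) (snd (snd t)))) * card W"
    by (simp add: card_tup)
  also have "\<dots> = (\<Sum>t\<in>I \<times> ((A - E) \<times> (A - E)). card (?Z (fst t) (fst (snd t)) (snd (snd t))) * card W)"
    by (rule sum_distrib_right)
  also have "\<dots> \<le> (\<Sum>t\<in>I \<times> ((A - E) \<times> (A - E)). card W ^ k)"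
    by (rule sum_mono) (use Z in auto)
  also have "\<dots> = card I * (card (A - E))\<^sup>2 * card W ^ k"
    by (simp add: card_cartesian_product power2_eq_square)
  also have "\<dots> \<le> card I * (card A)\<^sup>2 * card W ^ k"
    using A(2) by (intro mult_right_mono mult_left_mono power_mono card_mono) auto
  finally have "card W \<le> card I * (card A)\<^sup>2" using W0 by (simp add: mult.commute)
  show thesis
  proof (rule that [OF finI \<open>card W \<le> card I * (card A)\<^sup>2\<close>])
    show "\<And>v. v \<in> I \<Longrightarrow> lin (\<Theta> v) \<and> inj_on (\<Theta> v) A \<and> \<Theta> v ` A \<subseteq> ?V \<and> (\<forall>p\<in>E. \<Theta> v p = \<theta>0 p) \<and>
      \<Theta> v ` (A - E) \<inter> W = {}" using good It(1) by blast
    fix v w assume "v \<in> I" "w \<in> I" "v \<noteq> w"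
    then have "\<not> conf v w" by (rule It(2))
    then show "\<Theta> v ` (A - E) \<inter> \<Theta> w ` (A - E) = {}" by (auto simp: conf_def)
  qed
qed

text \<open>The members of \<open>G\<close> differ only outside \<open>W\<close>. On each of the
  disjoint images of \<open>A - E\<close>, one of the \<open>2 ^ q\<close> patterns would complete a
  copy and is excluded. This saves a factor \<open>1 - 1 / 2 ^ q\<close> each time, and the number
  of images is proportional to \<open>2 ^ n\<close>.\<close>

lemma extension_count:
  fixes \<nu> :: "vec \<Rightarrow> bool"
  assumes A: "F2.subspace A" "finite A" and E: "F2.subspace E" "E \<subseteq> A" "card A \<le> 2 ^ k * card E"
  shows "\<exists>\<delta>>0. \<forall>n W \<theta>0 G. F2.subspace W \<and> W \<subseteq> F2_pow n \<and> card W * 2 ^ k = 2 ^ n \<and>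
    lin \<theta>0 \<and> inj_on \<theta>0 E \<and> \<theta>0 ` E \<subseteq> W \<and> (\<forall>f\<in>G. \<forall>x. x \<notin> F2_pow n - {0} \<longrightarrow> \<not> f x) \<and>
    (\<forall>f\<in>G. \<forall>p\<in>E - {0}. f (\<theta>0 p) = \<nu> p) \<and> (\<forall>f\<in>G. \<forall>g\<in>G. \<forall>x\<in>W. f x = g x) \<and>
    (\<forall>f\<in>G. \<forall>\<theta>. \<not> (lin \<theta> \<and> inj_on \<theta> A \<and> \<theta> ` A \<subseteq> F2_pow n \<and> (\<forall>p\<in>A - {0}. f (\<theta> p) = \<nu> p))) \<longrightarrow>
    real (card G) \<le> 2 powr (2 ^ n - 2 ^ n / 2 ^ k - \<delta> * 2 ^ n)"
proof (cases "E = A")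
  case True
  \<comment> \<open>The copy in \<open>W\<close> is already complete, so \<open>G\<close> is empty
    and any \<open>\<delta>\<close> serves.\<close>
  show ?thesis
  proof (rule exI[of _ 1], intro conjI allI impI)
    fix n W \<theta>0 and G :: "(vec \<Rightarrow> bool) set"
    assume H: "F2.subspace W \<and> W \<subseteq> F2_pow n \<and> card W * 2 ^ k = 2 ^ n \<and>
    lin \<theta>0 \<and> inj_on \<theta>0 E \<and> \<theta>0 ` E \<subseteq> W \<and> (\<forall>f\<in>G. \<forall>x. x \<notin> F2_pow n - {0} \<longrightarrow> \<not> f x) \<and>
    (\<forall>f\<in>G. \<forall>p\<in>E - {0}. f (\<theta>0 p) = \<nu> p) \<and> (\<forall>f\<in>G. \<forall>g\<in>G. \<forall>x\<in>W. f x = g x) \<and>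
    (\<forall>f\<in>G. \<forall>\<theta>. \<not> (lin \<theta> \<and> inj_on \<theta> A \<and> \<theta> ` A \<subseteq> F2_pow n \<and> (\<forall>p\<in>A - {0}. f (\<theta> p) = \<nu> p)))"
    have "f \<notin> G" for f
    proof
      assume f: "f \<in> G"
      have no: "\<not> (lin \<theta>0 \<and> inj_on \<theta>0 A \<and> \<theta>0 ` A \<subseteq> F2_pow n \<and> (\<forall>p\<in>A - {0}. f (\<theta>0 p) = \<nu> p))"
        using H f by simp
      have "lin \<theta>0" "inj_on \<theta>0 A" "\<theta>0 ` A \<subseteq> W" "W \<subseteq> F2_pow n" "\<forall>p\<in>A - {0}. f (\<theta>0 p) = \<nu> p"
        using H f True by simp_all
      with no show False by (meson order_trans)
    qed
    then have "G = {}" by blast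
    then show "real (card G) \<le> 2 powr (2 ^ n - 2 ^ n / 2 ^ k - 1 * 2 ^ n)" by simp
  qed simp
next
  case False
  define q where "q = card (A - E)"
  have finE: "finite E" using E(2) A(2) by (rule finite_subset)
  have q: "q \<ge> 1" using False E(2) A(2) by (auto simp: q_def Suc_le_eq card_gt_0_iff)
  define r where "r = 1 - 1 / (2::real) ^ q"
  have "(2::real) ^ 1 \<le> 2 ^ q" using q by (intro power_increasing) auto
  then have r: "0 < r" "r < 1" by (auto simp: r_def)
  define a where "a = real (card A)"
  have "0 \<in> A" using A(1) by (rule F2.subspace_0)
  then have a: "a > 0" using A(2) by (auto simp: a_def card_gt_0_iff)
  \<comment> \<open>There are at least \<open>card W / a ^ 2\<close>, that is
    \<open>2 ^ n / (2 ^ k * a ^ 2)\<close>, disjoint images, and each contributes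
    \<open>log 2 r\<close> to the exponent.\<close>
  define \<delta> where "\<delta> = - log 2 r / (2 ^ k * a\<^sup>2)"
  have lr: "log 2 r < 0" using r by simp
  have \<delta>: "\<delta> > 0" unfolding \<delta>_def using lr a by (intro divide_pos_pos) auto
  show ?thesis
  proof (rule exI[of _ \<delta>], intro conjI \<delta> allI impI)
    fix n W \<theta>0 and G :: "(vec \<Rightarrow> bool) set"
    assume H: "F2.subspace W \<and> W \<subseteq> F2_pow n \<and> card W * 2 ^ k = 2 ^ n \<and>
    lin \<theta>0 \<and> inj_on \<theta>0 E \<and> \<theta>0 ` E \<subseteq> W \<and> (\<forall>f\<in>G. \<forall>x. x \<notin> F2_pow n - {0} \<longrightarrow> \<not> f x) \<and>
    (\<forall>f\<in>G. \<forall>p\<in>E - {0}. f (\<theta>0 p) = \<nu> p) \<and> (\<forall>f\<in>G. \<forall>g\<in>G. \<forall>x\<in>W. f x = g x) \<and>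
    (\<forall>f\<in>G. \<forall>\<theta>. \<not> (lin \<theta> \<and> inj_on \<theta> A \<and> \<theta> ` A \<subseteq> F2_pow n \<and> (\<forall>p\<in>A - {0}. f (\<theta> p) = \<nu> p)))"
    then have W: "F2.subspace W" "W \<subseteq> F2_pow n" "card W * 2 ^ k = 2 ^ n"
      and \<theta>0: "lin \<theta>0" "inj_on \<theta>0 E" "\<theta>0 ` E \<subseteq> W"
      and G1: "\<forall>f\<in>G. \<forall>x. x \<notin> F2_pow n - {0} \<longrightarrow> \<not> f x" and G2: "\<forall>f\<in>G. \<forall>p\<in>E - {0}. f (\<theta>0 p) = \<nu> p"
      and G3: "\<forall>f\<in>G. \<forall>g\<in>G. \<forall>x\<in>W. f x = g x"
      and G4: "\<forall>f\<in>G. \<forall>\<theta>. \<not> (lin \<theta> \<and> inj_on \<theta> A \<and> \<theta> ` A \<subseteq> F2_pow n \<and> (\<forall>p\<in>A - {0}. f (\<theta> p) = \<nu> p))"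
      by - (elim conjE, assumption)+
    let ?V = "F2_pow n"
    obtain I :: "(nat \<Rightarrow> vec) set" and \<Theta> where I: "finite I" "card W \<le> card I * (card A)\<^sup>2"
      and \<Theta>: "\<And>v. v \<in> I \<Longrightarrow> lin (\<Theta> v) \<and> inj_on (\<Theta> v) A \<and> \<Theta> v ` A \<subseteq> ?V \<and> (\<forall>p\<in>E. \<Theta> v p = \<theta>0 p) \<and>
        \<Theta> v ` (A - E) \<inter> W = {}"
      and disj: "\<And>v w. v \<in> I \<Longrightarrow> w \<in> I \<Longrightarrow> v \<noteq> w \<Longrightarrow> \<Theta> v ` (A - E) \<inter> \<Theta> w ` (A - E) = {}"
      by (rule disjoint_extensions [OF A E(1,2) False E(3) W \<theta>0]) blast
    define Q where "Q = (\<Union>v\<in>I. \<Theta> v ` (A - E))"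
    define Rest where "Rest = ?V - W - Q"
    have finW: "finite W" using W(2) by (rule finite_subset) simp
    have cQ: "card Q = card I * q"
    proof -
      have "card Q = (\<Sum>v\<in>I. card (\<Theta> v ` (A - E)))"
        unfolding Q_def using I(1) A(2) disj by (intro card_UN_disjoint) auto
      also have "\<dots> = (\<Sum>v\<in>I. q)"
      proof (rule sum.cong [OF refl])
        fix v assume "v \<in> I"
        then have "inj_on (\<Theta> v) (A - E)" using \<Theta> by (meson Diff_subset inj_on_subset)
        then show "card (\<Theta> v ` (A - E)) = q" by (simp add: card_image q_def)
      qed
      finally show ?thesis by simp
    qed
    have QV: "Q \<subseteq> ?V - W" unfolding Q_def using \<Theta> by blast
    have finQ: "finite Q" using I(1) A(2) by (simp add: Q_def)
    have cR: "card Rest + card I * q + card W = 2 ^ n"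
    proof -
      have "card Rest = card (?V - W) - card Q" unfolding Rest_def using finQ QV by (intro card_Diff_subset)
      moreover have "card (?V - W) = 2 ^ n - card W" using finW W(2) by (simp add: card_Diff_subset)
      moreover have "card Q \<le> card (?V - W)" using QV by (intro card_mono) auto
      moreover have "card W \<le> 2 ^ n" using card_mono [OF finite_F2_pow W(2)] by simp
      ultimately show ?thesis using cQ by linarith
    qed
    define Pat where "Pat = Pow (A - E) - {{p\<in>A - E. \<nu> p}}"
    have cPat: "card Pat = 2 ^ q - 1"
      unfolding Pat_def q_def using A(2) by (subst card_Diff_subset) (auto simp: card_Pow)
    let ?m = "\<lambda>f. ({x\<in>Rest. f x}, \<lambda>v\<in>I. {p\<in>A - E. f (\<Theta> v p)})"
    have "card G \<le> card (Pow Rest \<times> (I \<rightarrow>\<^sub>E Pat))"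
    proof (rule card_inj_on_le [where f = ?m])
      show "finite (Pow Rest \<times> (I \<rightarrow>\<^sub>E Pat))"
        using I(1) A(2) by (auto simp: Rest_def Pat_def intro!: finite_PiE)
      show "?m ` G \<subseteq> Pow Rest \<times> (I \<rightarrow>\<^sub>E Pat)"
      proof (rule image_subsetI)
        fix f assume f: "f \<in> G"
        have "{p\<in>A - E. f (\<Theta> v p)} \<noteq> {p\<in>A - E. \<nu> p}" if v: "v \<in> I" for v
        proof
          assume eq: "{p\<in>A - E. f (\<Theta> v p)} = {p\<in>A - E. \<nu> p}"
          have "f (\<Theta> v p) = \<nu> p" if p: "p \<in> A - {0}" for p
          proof (cases "p \<in> E")
            case True
            then show ?thesis using G2 f \<Theta> [OF v] p by simp
          next
            case False
            then show ?thesis using eq p by blast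
          qed
          moreover have "lin (\<Theta> v)" "inj_on (\<Theta> v) A" "\<Theta> v ` A \<subseteq> ?V" using \<Theta> [OF v] by simp_all
          moreover note spec [OF bspec [OF G4 f], of "\<Theta> v"]
          ultimately show False by blast
        qed
        then show "?m f \<in> Pow Rest \<times> (I \<rightarrow>\<^sub>E Pat)" by (auto simp: Pat_def)
      qed
      show "inj_on ?m G"
      proof (rule inj_onI)
        fix f g assume fg: "f \<in> G" "g \<in> G" and eq: "?m f = ?m g"
        have e1: "{x\<in>Rest. f x} = {x\<in>Rest. g x}"
          and e2: "(\<lambda>v\<in>I. {p\<in>A - E. f (\<Theta> v p)}) = (\<lambda>v\<in>I. {p\<in>A - E. g (\<Theta> v p)})" using eq by simp_all
        show "f = g"
        proof
          fix x
          consider "x \<notin> ?V - {0}" | "x \<in> W" | "x \<in> Rest" | "x \<in> Q" unfolding Rest_def by blast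
          then show "f x = g x"
          proof cases
            case 1 then show ?thesis using G1 fg by blast
          next
            case 2 then show ?thesis using G3 fg by blast
          next
            case 3 then show ?thesis using e1 by blast
          next
            case 4
            then obtain v p where vp: "v \<in> I" "p \<in> A - E" "x = \<Theta> v p" by (auto simp: Q_def)
            have "{p\<in>A - E. f (\<Theta> v p)} = {p\<in>A - E. g (\<Theta> v p)}" using fun_cong [OF e2, of v] vp(1) by simp
            then show ?thesis using vp by blast
          qed
        qed
      qed
    qed
    also have "\<dots> = 2 ^ card Rest * (2 ^ q - 1) ^ card I"
      using I(1) by (simp add: card_cartesian_product card_Pow Rest_def card_PiE cPat)
    finally have "real (card G) \<le> real (2 ^ card Rest * (2 ^ q - 1) ^ card I)" by (rule of_nat_mono)
    also have "\<dots> = 2 ^ card Rest * (2 ^ q * r) ^ card I" by (simp add: r_def of_nat_diff right_diff_distrib)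
    also have "\<dots> = 2 ^ (card Rest + card I * q) * r ^ card I"
      by (simp add: power_mult_distrib power_add mult.commute flip: power_mult)
    also have "\<dots> = 2 powr (2 ^ n - 2 ^ n / 2 ^ k) * r ^ card I"
    proof -
      have rW: "real (card W) = 2 ^ n / 2 ^ k"
      proof -
        have "real (card W * 2 ^ k) = real (2 ^ n)" using W(3) by simp
        then show ?thesis by (simp add: field_simps)
      qed
      have "real (card Rest + card I * q) = 2 ^ n - 2 ^ n / 2 ^ k"
      proof -
        have "real (card Rest + card I * q + card W) = real (2 ^ n)" using cR by simp
        then show ?thesis using rW by simp
      qed
      then have "(2::real) ^ (card Rest + card I * q) = 2 powr (2 ^ n - 2 ^ n / 2 ^ k)"
        using powr_realpow [of 2 "card Rest + card I * q"] by simp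
      then show ?thesis by simp
    qed
    also have "r ^ card I \<le> 2 powr (- \<delta> * 2 ^ n)"
    proof -
      have "real (card W) \<le> real (card I * (card A)\<^sup>2)" using I(2) by (rule of_nat_mono)
      then have "real (card W) \<le> real (card I) * a\<^sup>2" by (simp add: a_def)
      moreover have "real (card W * 2 ^ k) = real (2 ^ n)" using W(3) by simp
      ultimately have "2 ^ n \<le> real (card I) * (2 ^ k * a\<^sup>2)"
        using mult_right_mono [of "real (card W)" "real (card I) * a\<^sup>2" "2 ^ k"] by (simp add: ac_simps)
      then have "2 ^ n * (- log 2 r / (2 ^ k * a\<^sup>2)) \<le> real (card I) * (2 ^ k * a\<^sup>2) * (- log 2 r / (2 ^ k * a\<^sup>2))"
        using \<delta> unfolding \<delta>_def by (intro mult_right_mono) auto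
      also have "\<dots> = - real (card I) * log 2 r" using a by simp
      finally have "real (card I) * log 2 r \<le> - \<delta> * 2 ^ n" by (simp add: \<delta>_def mult.commute)
      have "r ^ card I = (2 powr log 2 r) ^ card I" using r by simp
      also have "\<dots> = 2 powr (real (card I) * log 2 r)" by (simp add: powr_power mult.commute)
      also have "\<dots> \<le> 2 powr (- \<delta> * 2 ^ n)" using \<open>real (card I) * log 2 r \<le> - \<delta> * 2 ^ n\<close> by (rule powr_mono) simp
      finally show ?thesis .
    qed
    finally have "real (card G) \<le> 2 powr (2 ^ n - 2 ^ n / 2 ^ k) * 2 powr (- \<delta> * 2 ^ n)" by simp
    then show "real (card G) \<le> 2 powr (2 ^ n - 2 ^ n / 2 ^ k - \<delta> * 2 ^ n)"
      by (simp flip: powr_add)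
  qed
qed

section \<open>Functions avoiding two patterns\<close>

text \<open>Copies of a restriction of \<open>N c\<close> in terms of indicator functions, so that
  the counting deals with total functions into \<open>bool\<close> instead of partial maps.\<close>

definition embeds :: "vec set \<Rightarrow> vec set \<Rightarrow> (vec \<Rightarrow> bool) \<Rightarrow> (vec \<Rightarrow> bool) \<Rightarrow> (vec \<Rightarrow> vec) \<Rightarrow> bool" where
  "embeds A V \<nu> f \<theta> \<longleftrightarrow> lin \<theta> \<and> inj_on \<theta> A \<and> \<theta> ` A \<subseteq> V \<and> (\<forall>p\<in>A - {0}. f (\<theta> p) = \<nu> p)"

text \<open>The number of restrictions to \<open>U\<close> times the largest number of extensions.
  It is applied to a subspace of codimension \<open>k\<close>, and to the whole space, where
  extensions are trivial.\<close>

lemma typical_fibre_count: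
  fixes l :: real and K :: "('a \<Rightarrow> bool) set"
  assumes K: "finite K" and V: "finite V" and T: "T \<subseteq> V" and U: "U \<subseteq> V"
    and maj: "\<And>f. f \<in> K \<Longrightarrow> real (card {x\<in>T. f x \<noteq> maj x}) \<le> l * real (card V)"
    and small: "real (card {X. X \<subseteq> V \<and> real (card X) \<le> l * real (card V)}) \<le> s"
    and fibre: "\<And>g. g \<in> K \<Longrightarrow> real (card {f\<in>K. \<forall>x\<in>U. f x = g x}) \<le> M" and M: "M \<ge> 0"
  shows "real (card K) \<le> 2 ^ card (U - T) * s * M"
proof -
  let ?r = "\<lambda>f. {x\<in>U. f x}"
  have "card K = (\<Sum>X\<in>?r ` K. card {f\<in>K. ?r f = X})"
    unfolding card_eq_sum by (rule sum.group [symmetric]) (use K in auto)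
  then have "real (card K) = (\<Sum>X\<in>?r ` K. real (card {f\<in>K. ?r f = X}))" by simp
  also have "\<dots> \<le> (\<Sum>X\<in>?r ` K. M)"
  proof (rule sum_mono)
    fix X assume "X \<in> ?r ` K"
    then obtain g where g: "g \<in> K" "X = ?r g" by blast
    have "{f\<in>K. ?r f = X} = {f\<in>K. \<forall>x\<in>U. f x = g x}" unfolding g(2) by auto
    then show "real (card {f\<in>K. ?r f = X}) \<le> M" using fibre [OF g(1)] by simp
  qed
  also have "\<dots> = real (card (?r ` K)) * M" by simp
  also have "\<dots> \<le> real (2 ^ card (U - T) * card {X. X \<subseteq> V \<and> real (card X) \<le> l * real (card V)}) * M"
    using restriction_count [OF V T U maj] M by (intro mult_right_mono of_nat_mono)
  also have "\<dots> \<le> (2 ^ card (U - T) * s) * M"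
    using small M by (intro mult_right_mono) auto
  finally show ?thesis .
qed

text \<open>The majority values on \<open>W\<close> are constant on a large subspace of \<open>W\<close>, and outside \<open>W\<close> all values
  occur.\<close>

lemma pattern_from_configuration:
  fixes \<epsilon> \<beta> :: real and A U :: "bool \<Rightarrow> vec set" and \<nu> :: "bool \<Rightarrow> vec \<Rightarrow> bool"
  assumes A: "\<And>c. F2.subspace (A c)" "\<And>c. finite (A c)" and U: "\<And>c. F2.subspace (U c)" "\<And>c. U c \<subseteq> A c"
    and card: "\<And>c. card (A c) \<le> 2 ^ (k + 1) * card (U c)" and const: "\<And>c p. p \<in> U c - {0} \<Longrightarrow> \<nu> c p = c"
    and ramsey: "\<forall>W g. F2.subspace W \<and> finite W \<and> card W \<ge> 2 ^ m \<longrightarrow>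
      (\<exists>W'. F2.subspace W' \<and> W' \<subseteq> W \<and> ((card W' = 2 ^ a \<and> (\<forall>x\<in>W' - {0}. \<not> g x)) \<or>
         (card W' = 2 ^ b \<and> (\<forall>x\<in>W' - {0}. g x))))"
    and ab: "card (U False) \<le> 2 ^ a" "card (U True) \<le> 2 ^ b"
    and K: "finite K" "K \<noteq> {}" and \<epsilon>: "0 < \<epsilon>" "\<epsilon> \<le> 1 / 4" and \<beta>: "\<beta> \<le> \<epsilon> ^ 2 ^ D"
    and v: "v \<in> tup D (F2_pow n)"
      "sees_bb k m D {x\<in>F2_pow n - {0}. 2 * \<epsilon> \<le> pr K x \<and> pr K x \<le> 1 - 2 * \<epsilon>} v" "\<not> bad_tuple \<epsilon> \<beta> D K v"
  shows "\<exists>f\<in>K. \<exists>c \<theta>. embeds (A c) (F2_pow n) (\<nu> c) f \<theta>"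
proof -
  define S where "S = {x\<in>F2_pow n - {0}. 2 * \<epsilon> \<le> pr K x \<and> pr K x \<le> 1 - 2 * \<epsilon>}"
  let ?F = "F2_pow D" and ?l = "lc D v"
  obtain C W where inj: "inj_on ?l ?F" and CW: "C \<subseteq> ?F" "W \<subseteq> ?F" "bose_burton {c\<in>?F. ?l c \<in> S} C W"
    "card C = 2 ^ (k + 1)" "card W = 2 ^ m"
    using v(2) unfolding sees_bb_def S_def [symmetric] by blast
  have sub: "F2.subspace C" "F2.subspace W" and bb: "\<And>c w. c \<in> C \<Longrightarrow> c \<noteq> 0 \<Longrightarrow> w \<in> W \<Longrightarrow> ?l (c + w) \<in> S"
    using CW(3) by (auto simp: bose_burton_def)
  have fin: "finite W" "finite C" using CW(1,2) by (auto intro: finite_subset)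
  have card_ge: "card W \<ge> 2 ^ m" using CW(5) by simp
  \<comment> \<open>Ramsey's theorem is used in coefficient space with the majority value in
    \<open>K\<close> as colour. The colour \<open>c\<close> found decides which of the two patterns
    is built.\<close>
  obtain W' c where W': "F2.subspace W'" "W' \<subseteq> W" "card (U c) \<le> card W'"
    "\<And>x. x \<in> W' - {0} \<Longrightarrow> (1 / 2 \<le> pr K (?l x)) = c"
  proof -
    obtain W' where W': "F2.subspace W'" "W' \<subseteq> W"
      "(card W' = 2 ^ a \<and> (\<forall>x\<in>W' - {0}. \<not> (1 / 2 \<le> pr K (?l x)))) \<or> (card W' = 2 ^ b \<and> (\<forall>x\<in>W' - {0}. 1 / 2 \<le> pr K (?l x)))"
      using ramsey [rule_format, of W "\<lambda>x. 1 / 2 \<le> pr K (?l x)"] sub(2) fin(1) card_ge by blast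
    from W'(3) show thesis
    proof (elim disjE conjE)
      assume "card W' = 2 ^ a" "\<forall>x\<in>W' - {0}. \<not> (1 / 2 \<le> pr K (?l x))"
      then show thesis using that [of W' False] W'(1,2) ab(1) by simp
    next
      assume "card W' = 2 ^ b" "\<forall>x\<in>W' - {0}. 1 / 2 \<le> pr K (?l x)"
      then show thesis using that [of W' True] W'(1,2) ab(2) by simp
    qed
  qed
  have finW': "finite W'" using W'(2) fin(1) by (rule finite_subset)
  have CW': "C \<inter> W' \<subseteq> {0}"
  proof
    fix x assume x: "x \<in> C \<inter> W'"
    show "x \<in> {0}"
    proof (rule ccontr)
      assume "x \<notin> {0}"
      then have "?l (x + x) \<in> S" using x W'(2) by (intro bb) auto
      then show False by (simp add: S_def)
    qed
  qed
  have finU: "finite (U c)" using U(2) A(2) by (rule finite_subset)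
  have sub0: "F2.subspace {0}" by simp
  \<comment> \<open>A plain embedding of \<open>U c\<close> into \<open>W'\<close>, extended from
    \<open>{0}\<close>.\<close>
  obtain \<theta>1 where \<theta>1: "lin \<theta>1" "inj_on \<theta>1 (U c)" "\<And>x. x \<in> U c \<Longrightarrow> \<exists>w\<in>W'. \<exists>u\<in>{0}. \<theta>1 x = w + u"
    by (rule extend_embedding [OF U(1) [of c] finU sub0 _ F2.linear_id _ _ sub0 W'(1) finW'])
      (use W'(3) F2.subspace_0 [OF U(1)] in auto)
  have \<theta>1W: "\<theta>1 ` U c \<subseteq> W'" using \<theta>1(3) by auto
  obtain \<theta>2 where \<theta>2: "lin \<theta>2" "inj_on \<theta>2 (A c)" "\<And>x. x \<in> U c \<Longrightarrow> \<theta>2 x = \<theta>1 x"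
    "\<And>x. x \<in> A c - U c \<Longrightarrow> \<theta>2 x \<notin> W'" "\<And>x. x \<in> A c \<Longrightarrow> \<exists>d\<in>C. \<exists>w\<in>W'. \<theta>2 x = d + w"
    by (rule extend_embedding [OF A(1,2) [of c] U(1,2) [of c] \<theta>1(1,2) \<theta>1W W'(1) sub(1) fin(2) CW'])
      (use card [of c] CW(4) in \<open>auto simp: mult.commute\<close>)
  have \<theta>2F: "\<theta>2 x \<in> ?F" if "x \<in> A c" for x
  proof -
    obtain d w where "d \<in> C" "w \<in> W'" "\<theta>2 x = d + w" using \<theta>2(5) [OF \<open>x \<in> A c\<close>] by blast
    then show ?thesis using CW(1,2) W'(2) F2.subspace_add [OF subspace_F2_pow, of d D w] by auto
  qed
  define \<Theta> where "\<Theta> = (\<lambda>x. ?l (\<theta>2 x))"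
  have \<Theta>: "lin \<Theta>" using lin_add [OF lin_lc, of D v] lin_add [OF \<theta>2(1)] by (simp add: lin_iff \<Theta>_def)
  have \<Theta>inj: "inj_on \<Theta> (A c)"
    using \<theta>2(2) \<theta>2F inj unfolding \<Theta>_def inj_on_def by blast
  have \<Theta>V: "\<Theta> ` A c \<subseteq> F2_pow n" using lc_tup [OF v(1)] by (auto simp: \<Theta>_def)
  have \<Theta>S: "\<Theta> x \<in> S" if x: "x \<in> A c - U c" for x
  proof -
    obtain d w where dw: "d \<in> C" "w \<in> W'" "\<theta>2 x = d + w" using \<theta>2(5) x by blast
    have "d \<noteq> 0" using \<theta>2(4) [OF x] dw by auto
    then show ?thesis using bb [of d w] dw W'(2) by (auto simp: \<Theta>_def)
  qed
  define B where "B = ?l ` (?F - {0})"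
  \<comment> \<open>\<open>realize_pattern\<close> prescribes a value at every sample point. Off the
    copy the majority value is taken, whose probability is at least 1/2 and so at least
    \<open>2 * \<epsilon>\<close>.\<close>
  define h where "h = (\<lambda>x. if x \<in> \<Theta> ` (A c - {0}) then \<nu> c (inv_into (A c) \<Theta> x) else 1 / 2 \<le> pr K x)"
  have h\<Theta>: "h (\<Theta> p) = \<nu> c p" if "p \<in> A c - {0}" for p
  proof -
    have "inv_into (A c) \<Theta> (\<Theta> p) = p" using \<Theta>inj that by (intro inv_into_f_f) auto
    moreover have "\<Theta> p \<in> \<Theta> ` (A c - {0})" using that by (rule imageI)
    ultimately show ?thesis unfolding h_def by simp
  qed
  have default: "2 * \<epsilon> \<le> (if 1 / 2 \<le> pr K x then pr K x else 1 - pr K x)" for x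
    using \<epsilon> by auto
  have "\<exists>f\<in>K. \<forall>x\<in>B. f x = h x"
  proof (rule realize_pattern [OF K _ _ \<epsilon>(1) _ \<beta>])
    show "finite B" by (simp add: B_def)
    have "card B \<le> card (?F - {0})" unfolding B_def by (rule card_image_le) simp
    also have "\<dots> \<le> card ?F" by (rule card_mono) auto
    finally show "card B \<le> 2 ^ D" by simp
    show "\<epsilon> \<le> 1" using \<epsilon> by simp
  next
    fix x assume "x \<in> B"
    then obtain d where d: "d \<in> ?F - {0}" "x = ?l d" by (auto simp: B_def)
    have "B - {x} = ?l ` (?F - {0, d})"
      unfolding B_def d(2) using inj d(1) by (auto simp: inj_on_def)
    moreover have "\<not> dep \<epsilon> \<beta> K (?l d) (?l ` (?F - {0, d}))"
      using v(3) inj d(1) unfolding bad_tuple_def by blast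
    ultimately show "\<not> dep \<epsilon> \<beta> K x (B - {x})" using d(2) by simp
  next
    fix x assume "x \<in> B"
    show "2 * \<epsilon> \<le> (if h x then pr K x else 1 - pr K x)"
    proof (cases "x \<in> \<Theta> ` (A c - {0})")
      case True
      then obtain p where p: "p \<in> A c - {0}" "x = \<Theta> p" by blast
      show ?thesis
      proof (cases "p \<in> U c")
        case True
        have w: "\<theta>2 p \<in> W'" using \<theta>2(3) [OF True] \<theta>1W True by auto
        have "\<theta>2 p \<noteq> 0"
          using p(1) \<theta>2(2) lin_inj_on_iff [OF \<theta>2(1) A(1) [of c]] by blast
        then have "(1 / 2 \<le> pr K x) = c" using W'(4) w p(2) by (simp add: \<Theta>_def)
        moreover have "h x = c" using h\<Theta> [OF p(1)] const [of p c] True p by simp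
        ultimately show ?thesis using default [of x] by simp
      next
        case False
        then have "x \<in> S" using \<Theta>S p by blast
        then show ?thesis by (auto simp: S_def)
      qed
    next
      case False
      then have "h x = (1 / 2 \<le> pr K x)" unfolding h_def by (rule if_not_P)
      then show ?thesis using default [of x] by simp
    qed
  qed
  then obtain f where f: "f \<in> K" "\<forall>x\<in>B. f x = h x" by blast
  have "f (\<Theta> p) = \<nu> c p" if p: "p \<in> A c - {0}" for p
  proof -
    have "\<theta>2 p \<noteq> 0" using p \<theta>2(2) lin_inj_on_iff [OF \<theta>2(1) A(1) [of c]] by blast
    then have "\<Theta> p \<in> B" using \<theta>2F p by (auto simp: B_def \<Theta>_def)
    then show ?thesis using f(2) h\<Theta> [OF p] by simp
  qed
  then have "embeds (A c) (F2_pow n) (\<nu> c) f \<Theta>"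
    unfolding embeds_def using \<Theta> \<Theta>inj \<Theta>V by blast
  then show ?thesis using f(1) by blast
qed

text \<open>Everything depends on the set \<open>T\<close> of points that are nearly determined in
  the subfamily \<open>K\<close> from \<open>container\<close>. If \<open>T\<close> is well above
  the critical size, too few points are free. If it is near or below that size, it must be close to
  a subspace of codimension \<open>k\<close>, as otherwise a pattern appears; on that subspace the
  last hypothesis supplies the copy from which \<open>extension_count\<close> starts.\<close>

theorem avoiding_count:
  fixes A U E :: "bool \<Rightarrow> vec set" and \<nu> :: "bool \<Rightarrow> vec \<Rightarrow> bool"
  assumes A: "\<And>c. F2.subspace (A c)" "\<And>c. finite (A c)" and U: "\<And>c. F2.subspace (U c)" "\<And>c. U c \<subseteq> A c"
    and cardU: "\<And>c. card (A c) \<le> 2 ^ (k + 1) * card (U c)" and const: "\<And>c p. p \<in> U c - {0} \<Longrightarrow> \<nu> c p = c"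
    and E: "\<And>c. F2.subspace (E c)" "\<And>c. E c \<subseteq> A c" and cardE: "\<And>c. card (A c) \<le> 2 ^ k * card (E c)"
    and k: "k \<ge> 1"
  shows "\<exists>\<delta>>0. \<exists>n0. \<forall>n F. n \<ge> n0 \<and> (\<forall>f\<in>F. \<forall>x. x \<notin> F2_pow n - {0} \<longrightarrow> \<not> f x) \<and>
    (\<forall>f\<in>F. \<forall>c \<theta>. \<not> embeds (A c) (F2_pow n) (\<nu> c) f \<theta>) \<and>
    (\<forall>f\<in>F. \<forall>W. F2.subspace W \<and> W \<subseteq> F2_pow n \<and> card W * 2 ^ k = 2 ^ n \<longrightarrow>
       (\<exists>c \<theta>. embeds (E c) W (\<nu> c) f \<theta>)) \<longrightarrow>
    real (card F) \<le> 2 powr (2 ^ n - 2 ^ n / 2 ^ k - \<delta> * 2 ^ n)"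
proof -
  have "\<forall>c. \<exists>\<delta>>0. \<forall>n W \<theta>0 G. F2.subspace W \<and> W \<subseteq> F2_pow n \<and> card W * 2 ^ k = 2 ^ n \<and>
    lin \<theta>0 \<and> inj_on \<theta>0 (E c) \<and> \<theta>0 ` E c \<subseteq> W \<and> (\<forall>f\<in>G. \<forall>x. x \<notin> F2_pow n - {0} \<longrightarrow> \<not> f x) \<and>
    (\<forall>f\<in>G. \<forall>p\<in>E c - {0}. f (\<theta>0 p) = \<nu> c p) \<and> (\<forall>f\<in>G. \<forall>g\<in>G. \<forall>x\<in>W. f x = g x) \<and>
    (\<forall>f\<in>G. \<forall>\<theta>. \<not> (lin \<theta> \<and> inj_on \<theta> (A c) \<and> \<theta> ` A c \<subseteq> F2_pow n \<and> (\<forall>p\<in>A c - {0}. f (\<theta> p) = \<nu> c p))) \<longrightarrow>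
    real (card G) \<le> 2 powr (2 ^ n - 2 ^ n / 2 ^ k - \<delta> * 2 ^ n)" (is "\<forall>c. \<exists>\<delta>>0. ?ext c \<delta>")
  proof
    fix c show "\<exists>\<delta>>0. ?ext c \<delta>"
      by (rule extension_count [OF A(1,2) [of c] E(1,2) [of c] cardE [of c]])
  qed
  from choice [OF this] obtain d where dd: "\<forall>c. d c > 0 \<and> ?ext c (d c)"
    by (elim exE) (rule that)
  have d0: "d c > 0" for c using dd by (elim allE conjE)
  have d: "?ext c (d c)" for c using spec [OF dd, of c] by (rule conjunct2)
  define \<delta> where "\<delta> = min (d False) (d True)"
  have \<delta>: "\<delta> > 0" "\<And>c. \<delta> \<le> d c"
  proof -
    show "\<delta> > 0" using d0 by (simp add: \<delta>_def)
    show "\<delta> \<le> d c" for c by (cases c) (simp_all add: \<delta>_def)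
  qed
  \<comment> \<open>\<open>1 / 10\<close> is demanded by \<open>near_subspace\<close>;
    \<open>\<delta> / 32\<close> keeps the number of free points in the subspace, at most
    \<open>4 * \<eta> * N\<close>, within \<open>\<delta> / 8 * N\<close>.\<close>
  define \<eta> where "\<eta> = min (1 / 10) (\<delta> / 32)"
  have \<eta>: "0 < \<eta>" "\<eta> \<le> 1 / 10" "\<eta> \<le> \<delta> / 32" using \<delta>(1) by (auto simp: \<eta>_def)
  \<comment> \<open>With \<open>2 ^ k * card T \<ge> N / 2\<close> this turns the bound
    \<open>\<rho> * N ^ 2\<close> on additive pairs into the bound
    \<open>\<eta> ^ 2 * card T ^ 2\<close>.\<close>
  define \<rho> where "\<rho> = min (1 / 10) (\<eta>\<^sup>2 / (4 * 4 ^ k))"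
  have \<rho>: "0 < \<rho>" "\<rho> \<le> 1 / 10" "\<rho> \<le> \<eta>\<^sup>2 / (4 * 4 ^ k)" using \<eta>(1) by (auto simp: \<rho>_def)
  \<comment> \<open>As \<open>512 = 4 * 128\<close>, a \<open>T\<close> that exceeds the critical
    size by a factor \<open>1 + \<rho> / 128\<close> saves at least \<open>4 * \<xi> * N\<close> in
    the exponent.\<close>
  define \<xi> where "\<xi> = min (\<delta> / 8) (\<rho> / (512 * 2 ^ k))"
  have \<xi>: "0 < \<xi>" "\<xi> \<le> \<delta> / 8" "\<xi> \<le> \<rho> / (512 * 2 ^ k)" using \<delta>(1) \<rho>(1) by (auto simp: \<xi>_def)
  define a where "a = card (U False)"
  define b where "b = card (U True)"
  have ab: "card (U False) \<le> 2 ^ a" "card (U True) \<le> 2 ^ b"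
    using less_exp [of a] less_exp [of b] by (simp_all add: a_def b_def)
  obtain m where m: "\<forall>W g. F2.subspace W \<and> finite W \<and> card W \<ge> m \<longrightarrow>
      (\<exists>W'. F2.subspace W' \<and> W' \<subseteq> W \<and> ((card W' = 2 ^ a \<and> (\<forall>x\<in>W' - {0}. \<not> g x)) \<or>
         (card W' = 2 ^ b \<and> (\<forall>x\<in>W' - {0}. g x))))"
    using subspace_ramsey [of a b] by (elim exE) (rule that)
  have mm: "m \<le> 2 ^ m" using less_exp [of m] by simp
  have ramsey: "\<forall>W g. F2.subspace W \<and> finite W \<and> card W \<ge> 2 ^ m \<longrightarrow>
      (\<exists>W'. F2.subspace W' \<and> W' \<subseteq> W \<and> ((card W' = 2 ^ a \<and> (\<forall>x\<in>W' - {0}. \<not> g x)) \<or>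
         (card W' = 2 ^ b \<and> (\<forall>x\<in>W' - {0}. g x))))"
  proof (rule allI, rule allI, rule impI)
    fix W and g :: "vec \<Rightarrow> bool"
    assume W: "F2.subspace W \<and> finite W \<and> card W \<ge> 2 ^ m"
    have "F2.subspace W \<and> finite W \<and> card W \<ge> m" using W le_trans [OF mm, of "card W"] by auto
    from m [rule_format, OF this] show "\<exists>W'. F2.subspace W' \<and> W' \<subseteq> W \<and>
      ((card W' = 2 ^ a \<and> (\<forall>x\<in>W' - {0}. \<not> g x)) \<or> (card W' = 2 ^ b \<and> (\<forall>x\<in>W' - {0}. g x)))" .
  qed
  have \<rho>1: "\<rho> \<le> 1" using \<rho>(2) by simp
  obtain D0 n1 where D: "D0 \<ge> 1" and D0: "\<forall>V S. F2.subspace V \<and> finite V \<and> card V \<ge> n1 \<and> S \<subseteq> V - {0} \<and>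
    2 ^ k * real (card (V - S)) \<le> (1 + \<rho> / 128) * real (card V) \<and>
    (\<rho> * (real (card V))\<^sup>2 \<le> (\<Sum>u\<in>S. real (card {t\<in>V - S. u + t \<in> V - S})) \<or>
     2 ^ k * real (card (V - S)) \<le> (1 - \<rho>) * real (card V)) \<longrightarrow>
    \<rho> / 16 * real (card V) ^ D0 \<le> real (card {v\<in>tup D0 V. sees_bb k m D0 S v})"
    using many_bose_burton [OF \<rho>(1) \<rho>1 k, of m] by (elim exE conjE) (rule that)
  obtain l where l: "l > 0" and small: "\<forall>A :: vec set. finite A \<longrightarrow>
      real (card {X. X \<subseteq> A \<and> real (card X) \<le> l * real (card A)}) \<le> 2 powr (\<xi> * real (card A))"
    using small_subsets [OF \<xi>(1)] by (elim exE conjE) (rule that)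
  define \<epsilon> where "\<epsilon> = min (1 / 4) (l / 4)"
  have \<epsilon>: "0 < \<epsilon>" "\<epsilon> \<le> 1 / 4" "4 * \<epsilon> \<le> l" using l by (auto simp: \<epsilon>_def)
  \<comment> \<open>One factor \<open>\<epsilon>\<close> for each point of a sample, as
    \<open>realize_pattern\<close> requires.\<close>
  define \<beta> where "\<beta> = \<epsilon> ^ 2 ^ D0"
  have \<beta>: "0 < \<beta>" "\<beta> \<le> 1" using \<epsilon> by (auto simp: \<beta>_def power_le_one)
  obtain n2 where n2: "\<forall>n F. n \<ge> n2 \<and> finite F \<and> F \<noteq> {} \<longrightarrow> (\<exists>K\<subseteq>F. K \<noteq> {} \<and>
    real (card {v\<in>tup D0 (F2_pow n). bad_tuple \<epsilon> \<beta> D0 K v}) < \<rho> / 16 * (2 ^ n) ^ D0 \<and>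
    2 powr (- \<xi> * 2 ^ n) * real (card F) \<le> real (card K))"
    using container [OF \<epsilon>(1) \<beta>(1) _ _ \<beta>(2) _ \<xi>(1) D, of "\<rho> / 16"] \<rho> \<epsilon> by auto
  \<comment> \<open>Ensures \<open>1 \<le> \<xi> * N\<close>, so that the factor 2 from
    \<open>typical_members\<close> can be absorbed.\<close>
  obtain n3 where n3: "1 / \<xi> < 2 ^ n3" using real_arch_pow [of 2 "1 / \<xi>"] by auto
  show ?thesis
  proof (rule exI[of _ \<xi>], intro conjI \<xi>(1), rule exI[of _ "n1 + n2 + n3 + k"], intro allI impI)
    fix n and F :: "(vec \<Rightarrow> bool) set"
    assume H: "n \<ge> n1 + n2 + n3 + k \<and> (\<forall>f\<in>F. \<forall>x. x \<notin> F2_pow n - {0} \<longrightarrow> \<not> f x) \<and>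
      (\<forall>f\<in>F. \<forall>c \<theta>. \<not> embeds (A c) (F2_pow n) (\<nu> c) f \<theta>) \<and>
      (\<forall>f\<in>F. \<forall>W. F2.subspace W \<and> W \<subseteq> F2_pow n \<and> card W * 2 ^ k = 2 ^ n \<longrightarrow>
        (\<exists>c \<theta>. embeds (E c) W (\<nu> c) f \<theta>))"
    have n: "n \<ge> n1 + n2 + n3 + k" using H by (rule conjunct1)
    have F1: "\<forall>f\<in>F. \<forall>x. x \<notin> F2_pow n - {0} \<longrightarrow> \<not> f x"
      using H by (elim conjE)
    have F2: "\<forall>f\<in>F. \<forall>c \<theta>. \<not> embeds (A c) (F2_pow n) (\<nu> c) f \<theta>"
      using H by (elim conjE)
    have F3: "\<forall>f\<in>F. \<forall>W. F2.subspace W \<and> W \<subseteq> F2_pow n \<and> card W * 2 ^ k = 2 ^ n \<longrightarrow>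
        (\<exists>c \<theta>. embeds (E c) W (\<nu> c) f \<theta>)"
      using H by (elim conjE)
    define N where "N = (2 :: real) ^ n"
    have N: "N > 0" by (simp add: N_def)
    have "(2::real) ^ n3 \<le> N" unfolding N_def using n by (intro power_increasing) auto
    then have "1 / \<xi> \<le> N" using n3 by linarith
    then have \<xi>N: "1 \<le> \<xi> * N" using \<xi>(1) by (simp add: field_simps)
    have "real (card F) \<le> 2 powr (N - N / 2 ^ k - \<xi> * N)"
    proof (cases "finite F \<and> F \<noteq> {}")
      case False
      then have "card F = 0" by auto
      then show ?thesis by simp
    next
      case True
      let ?V = "F2_pow n"
      obtain K where K: "K \<subseteq> F" "K \<noteq> {}" "real (card {v\<in>tup D0 ?V. bad_tuple \<epsilon> \<beta> D0 K v}) < \<rho> / 16 * (2 ^ n) ^ D0"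
        "2 powr (- \<xi> * 2 ^ n) * real (card F) \<le> real (card K)"
        using n2 [rule_format, of n F] True n by auto
      have finK: "finite K" using K(1) True finite_subset by blast
      define S where "S = {x\<in>?V - {0}. 2 * \<epsilon> \<le> pr K x \<and> pr K x \<le> 1 - 2 * \<epsilon>}"
      define T where "T = ?V - S"
      have SV: "S \<subseteq> ?V - {0}" "S \<subseteq> ?V" "?V - S = T" "?V - T = S" by (auto simp: S_def T_def)
      have T: "T \<subseteq> ?V" "0 \<in> T" "finite T" by (auto simp: T_def S_def)
      have cST: "real (card S) = N - real (card T)"
      proof -
        have "card T = card ?V - card S" unfolding T_def by (rule card_Diff_subset) (auto simp: S_def)
        moreover have "card S \<le> card ?V" using SV(2) by (intro card_mono) auto
        ultimately show ?thesis by (simp add: N_def of_nat_diff)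
      qed
      have not_b: "\<not> (2 ^ k * real (card T) \<le> (1 + \<rho> / 128) * N \<and>
        (\<rho> * N\<^sup>2 \<le> (\<Sum>u\<in>S. real (card {t\<in>T. u + t \<in> T})) \<or> 2 ^ k * real (card T) \<le> (1 - \<rho>) * N))"
      proof
        assume b: "2 ^ k * real (card T) \<le> (1 + \<rho> / 128) * N \<and>
          (\<rho> * N\<^sup>2 \<le> (\<Sum>u\<in>S. real (card {t\<in>T. u + t \<in> T})) \<or> 2 ^ k * real (card T) \<le> (1 - \<rho>) * N)"
        have "n1 \<le> 2 ^ n" using less_exp [of n] n by linarith
        then have "\<rho> / 16 * real (card ?V) ^ D0 \<le> real (card {v\<in>tup D0 ?V. sees_bb k m D0 S v})"
          using b SV by (intro D0 [rule_format]) (simp add: N_def)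
        \<comment> \<open>More samples see a configuration than are bad. Some sample thus sees one
          without being bad, and yields a forbidden copy in a member of \<open>K\<close>.\<close>
        then have more: "real (card {v\<in>tup D0 ?V. bad_tuple \<epsilon> \<beta> D0 K v}) < real (card {v\<in>tup D0 ?V. sees_bb k m D0 S v})"
          using K(3) by simp
        have "\<not> {v\<in>tup D0 ?V. sees_bb k m D0 S v} \<subseteq> {v\<in>tup D0 ?V. bad_tuple \<epsilon> \<beta> D0 K v}"
          proof
          assume sub: "{v\<in>tup D0 ?V. sees_bb k m D0 S v} \<subseteq> {v\<in>tup D0 ?V. bad_tuple \<epsilon> \<beta> D0 K v}"
          have "finite {v\<in>tup D0 ?V. bad_tuple \<epsilon> \<beta> D0 K v}"
            using finite_tup [OF finite_F2_pow, of D0 n] by simp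
          from card_mono [OF this sub] show False
            using more by simp
        qed
        then obtain v where v: "v \<in> tup D0 ?V" "sees_bb k m D0 S v" "\<not> bad_tuple \<epsilon> \<beta> D0 K v" by blast
        have "\<exists>f\<in>K. \<exists>c \<theta>. embeds (A c) ?V (\<nu> c) f \<theta>"
          by (rule pattern_from_configuration [OF A U cardU const ramsey ab finK K(2) \<epsilon>(1,2) _ v(1) v(2) [unfolded S_def] v(3)])
            (simp_all add: \<beta>_def)
        then show False using F2 K(1) by blast
      qed
      define maj where "maj = (\<lambda>x. 1 / 2 \<le> pr K x)"
      \<comment> \<open>0 belongs to \<open>T\<close> by definition only; it is determined as well,
        because all members are false there.\<close>
      have pr0: "pr K 0 = 0"
      proof -
        have "{f\<in>K. f 0} = {}" using F1 K(1) by blast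
        then have "card {f\<in>K. f 0} = 0" by (simp only: card.empty)
        then show ?thesis by (simp add: pr_def)
      qed
      have maj_bound: "real (card {f\<in>K. f x \<noteq> maj x}) \<le> 2 * \<epsilon> * real (card K)" if x: "x \<in> T" for x
      proof -
        have cK: "real (card K) > 0" using finK K(2) by (simp add: card_gt_0_iff)
        have "x = 0 \<or> pr K x < 2 * \<epsilon> \<or> pr K x > 1 - 2 * \<epsilon>" using x by (auto simp: T_def S_def)
        then have alt: "pr K x < 2 * \<epsilon> \<or> pr K x > 1 - 2 * \<epsilon>" using pr0 \<epsilon>(1) by auto
        have s: "card {f\<in>K. f x} + card {f\<in>K. \<not> f x} = card K"
        proof -
          have "card ({f\<in>K. f x} \<union> {f\<in>K. \<not> f x}) = card {f\<in>K. f x} + card {f\<in>K. \<not> f x}"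
            using finK by (intro card_Un_disjoint) auto
          moreover have "{f\<in>K. f x} \<union> {f\<in>K. \<not> f x} = K" by auto
          ultimately show ?thesis by simp
        qed
        have p: "real (card {f\<in>K. f x}) = pr K x * real (card K)" using card_pr [OF finK, of x] by (simp add: mult.commute)
        have s': "real (card {f\<in>K. \<not> f x}) = (1 - pr K x) * real (card K)"
        proof -
          have "real (card {f\<in>K. f x}) + real (card {f\<in>K. \<not> f x}) = real (card K)" using s by (simp flip: of_nat_add)
          then show ?thesis using p by (simp add: left_diff_distrib)
        qed
        show ?thesis
        proof (cases "maj x")
          case True
          then have "1 - pr K x \<le> 2 * \<epsilon>" using alt \<epsilon> by (auto simp: maj_def)
          then have "(1 - pr K x) * real (card K) \<le> 2 * \<epsilon> * real (card K)" by (rule mult_right_mono) simp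
          with True show ?thesis by (simp only: s' simp_thms)
        next
          case False
          then have "pr K x \<le> 2 * \<epsilon>" using alt \<epsilon> by (auto simp: maj_def)
          then have "pr K x * real (card K) \<le> 2 * \<epsilon> * real (card K)" by (rule mult_right_mono) simp
          with False show ?thesis by (simp only: p simp_thms)
        qed
      qed
      define K' where "K' = {f\<in>K. real (card {x\<in>T. f x \<noteq> maj x}) \<le> 4 * \<epsilon> * real (card ?V)}"
      have V0: "?V \<noteq> {}" using zero_in_F2_pow by blast
      have KK': "real (card K) \<le> 2 * real (card K')"
        unfolding K'_def by (rule typical_members [OF finK finite_F2_pow V0 T(1) \<epsilon>(1) maj_bound])
      have K': "finite K'" "K' \<subseteq> F" using finK K(1) by (auto simp: K'_def)
      have K'maj: "real (card {x\<in>T. f x \<noteq> maj x}) \<le> l * real (card ?V)" if "f \<in> K'" for f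
      proof -
        have "real (card {x\<in>T. f x \<noteq> maj x}) \<le> 4 * \<epsilon> * real (card ?V)" using that by (simp add: K'_def)
        also have "\<dots> \<le> l * real (card ?V)" using \<epsilon>(3) by (rule mult_right_mono) simp
        finally show ?thesis .
      qed
      have sm: "real (card {X. X \<subseteq> ?V \<and> real (card X) \<le> l * real (card ?V)}) \<le> 2 powr (\<xi> * N)"
        using small [rule_format, of ?V] by (simp add: N_def)
      have claim: "real (card K) \<le> 2 powr (1 + N - N / 2 ^ k - 3 * \<xi> * N)"
      proof (cases "2 ^ k * real (card T) \<le> (1 + \<rho> / 128) * N")
        case False
        \<comment> \<open>With the whole space in the role of \<open>U\<close>, a fibre is a single
          function, and only the points of \<open>S\<close> are free.\<close>
        have "real (card K') \<le> 2 ^ card (?V - T) * 2 powr (\<xi> * N) * 1"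
        proof (rule typical_fibre_count [OF K'(1) finite_F2_pow T(1) order_refl K'maj sm])
          fix g assume g: "g \<in> K'"
          have "{f\<in>K'. \<forall>x\<in>?V. f x = g x} \<subseteq> {g}"
          proof
            fix f assume f: "f \<in> {f\<in>K'. \<forall>x\<in>?V. f x = g x}"
            have "f x = g x" for x
            proof (cases "x \<in> ?V")
              case True then show ?thesis using f by blast
            next
              case False
              then have "x \<notin> ?V - {0}" by blast
              then show ?thesis using F1 f g K'(2) by blast
            qed
            then show "f \<in> {g}" by (simp add: fun_eq_iff)
          qed
          then have "card {f\<in>K'. \<forall>x\<in>?V. f x = g x} \<le> card {g}" by (intro card_mono) auto
          then show "real (card {f\<in>K'. \<forall>x\<in>?V. f x = g x}) \<le> 1" by simp
        qed auto
        also have "\<dots> = 2 powr (real (card S) + \<xi> * N)"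
          unfolding SV(4) powr_add using powr_realpow [of 2 "card S"] by simp
        finally have 1: "real (card K') \<le> 2 powr (real (card S) + \<xi> * N)" .
        have "real (card S) \<le> N - N / 2 ^ k - 4 * \<xi> * N"
        proof -
          have "N / 2 ^ k + \<rho> / 128 * N / 2 ^ k \<le> real (card T)" using False by (simp add: field_simps)
          moreover have "4 * \<xi> * N \<le> 4 * (\<rho> / (512 * 2 ^ k)) * N" using \<xi>(3) N by (intro mult_right_mono) auto
          moreover have "4 * (\<rho> / (512 * 2 ^ k)) * N = \<rho> / 128 * N / 2 ^ k" by simp
          ultimately show ?thesis using cST by linarith
        qed
        then have "2 powr (real (card S) + \<xi> * N) \<le> 2 powr (N - N / 2 ^ k - 3 * \<xi> * N)" by (intro powr_mono) linarith+
        with 1 KK' have "real (card K) \<le> 2 * 2 powr (N - N / 2 ^ k - 3 * \<xi> * N)" by linarith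
        also have "\<dots> = 2 powr (1 + (N - N / 2 ^ k - 3 * \<xi> * N))" unfolding powr_add by simp
        finally show ?thesis by (simp add: algebra_simps)
      next
        case True
        with not_b have few: "(\<Sum>u\<in>S. real (card {t\<in>T. u + t \<in> T})) < \<rho> * N\<^sup>2"
          and big: "(1 - \<rho>) * N < 2 ^ k * real (card T)" by auto
        have T_big: "N / 2 \<le> 2 ^ k * real (card T)"
        proof -
          have "1 / 2 * N \<le> (1 - \<rho>) * N" using \<rho>(2) N by (intro mult_right_mono) auto
          then show ?thesis using big by simp
        qed
        have "\<rho> * N\<^sup>2 \<le> \<eta>\<^sup>2 * (real (card T))\<^sup>2"
        proof -
          have "(N / 2)\<^sup>2 \<le> (2 ^ k * real (card T))\<^sup>2" using T_big N by (intro power_mono) auto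
          moreover have "(N / 2)\<^sup>2 = N\<^sup>2 / 4" by (simp add: power_divide)
          moreover have "(2 ^ k * real (card T))\<^sup>2 = (2 ^ k)\<^sup>2 * (real (card T))\<^sup>2" by (rule power_mult_distrib)
          moreover have "(2 ^ k)\<^sup>2 = (4::real) ^ k" by (simp add: power2_eq_square flip: power_mult_distrib)
          ultimately have "N\<^sup>2 \<le> 4 * 4 ^ k * (real (card T))\<^sup>2" by simp
          then have "\<eta>\<^sup>2 / (4 * 4 ^ k) * N\<^sup>2 \<le> \<eta>\<^sup>2 / (4 * 4 ^ k) * (4 * 4 ^ k * (real (card T))\<^sup>2)"
            by (rule mult_left_mono) simp
          moreover have "\<rho> * N\<^sup>2 \<le> \<eta>\<^sup>2 / (4 * 4 ^ k) * N\<^sup>2" using \<rho>(3) by (rule mult_right_mono) simp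
          ultimately show ?thesis by simp
        qed
        with few have few': "(\<Sum>u\<in>?V - T. real (card {t\<in>T. u + t \<in> T})) \<le> \<eta>\<^sup>2 * (real (card T))\<^sup>2"
          unfolding SV(4) by linarith
        obtain X where X: "F2.subspace X" "X \<subseteq> ?V" "9 / 10 * real (card T) \<le> real (card X)"
          "real (card X) \<le> 5 / 4 * real (card T)" "real (card (X - T)) \<le> 4 * \<eta> * real (card T)"
          using near_subspace [OF subspace_F2_pow finite_F2_pow T(1,2) \<eta>(1,2) few'] by blast
        have finX: "finite X" using X(2) by (rule finite_subset) simp
        \<comment> \<open>\<open>card X\<close> is a power of two, and the bounds
          \<open>81 / 100 * N\<close> and \<open>15 / 8 * N\<close> for
          \<open>2 ^ k * card X\<close> lie strictly between \<open>N / 2\<close> and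
          \<open>2 * N\<close>.\<close>
        have cX: "card X * 2 ^ k = 2 ^ n"
        proof -
          obtain j where j: "card X = 2 ^ j" using card_subspace_power [OF X(1) finX] by blast
          have lo: "2 ^ k * (9 / 10 * real (card T)) \<le> 2 ^ k * real (card X)" using X(3) by (rule mult_left_mono) simp
          have lo': "2 ^ k * (9 / 10 * real (card T)) = 9 / 10 * (2 ^ k * real (card T))" by simp
          have hi: "2 ^ k * real (card X) \<le> 2 ^ k * (5 / 4 * real (card T))" using X(4) by (rule mult_left_mono) simp
          have hi': "2 ^ k * (5 / 4 * real (card T)) = 5 / 4 * (2 ^ k * real (card T))" by simp
          have "9 / 10 * N \<le> (1 - \<rho>) * N" using \<rho>(2) N by (intro mult_right_mono) auto
          then have "81 / 100 * N \<le> 2 ^ k * real (card X)" using lo lo' big by linarith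
          then have 1: "N < 2 * (2 ^ k * real (card X))" using N by linarith
          have "(1 + \<rho> / 128) * N \<le> 3 / 2 * N" using \<rho>(2) N by (intro mult_right_mono) auto
          then have "2 ^ k * real (card X) \<le> 15 / 8 * N" using hi hi' True by linarith
          then have 2: "2 ^ k * real (card X) < 2 * N" using N by linarith
          have "(2::real) ^ n < 2 ^ (k + j + 1)" "(2::real) ^ (k + j) < 2 ^ (n + 1)"
            using 1 2 by (simp_all add: N_def j power_add)
          then have "n < k + j + 1" "k + j < n + 1" by (simp_all only: power_strict_increasing_iff)
          then have "n = j + k" by simp
          then show ?thesis by (simp add: j power_add)
        qed
        let ?M = "2 powr (N - N / 2 ^ k - \<delta> * N)"
        have "real (card K') \<le> 2 ^ card (X - T) * 2 powr (\<xi> * N) * ?M"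
        proof (rule typical_fibre_count [OF K'(1) finite_F2_pow T(1) X(2) K'maj sm])
          fix g assume g: "g \<in> K'"
          then have gF: "g \<in> F" using K'(2) by blast
          \<comment> \<open>All functions in the fibre agree with \<open>g\<close> on
            \<open>X\<close>, so one copy of \<open>E c\<close> in \<open>X\<close> serves for all
            of them.\<close>
          obtain c \<theta> where c: "embeds (E c) X (\<nu> c) g \<theta>" using F3 gF X(1,2) cX by blast
          let ?G = "{f\<in>K'. \<forall>x\<in>X. f x = g x}"
          have GF: "?G \<subseteq> F" using K'(2) by blast
          have th: "lin \<theta>" "inj_on \<theta> (E c)" "\<theta> ` E c \<subseteq> X" "\<forall>p\<in>E c - {0}. g (\<theta> p) = \<nu> c p"
            using c by (auto simp: embeds_def)
          have G1: "\<forall>f\<in>?G. \<forall>x. x \<notin> ?V - {0} \<longrightarrow> \<not> f x" using F1 GF by blast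
          have G2: "\<forall>f\<in>?G. \<forall>p\<in>E c - {0}. f (\<theta> p) = \<nu> c p" using th(3,4) by auto
          have G3: "\<forall>f\<in>?G. \<forall>h\<in>?G. \<forall>x\<in>X. f x = h x" by auto
          have G4: "\<forall>f\<in>?G. \<forall>\<theta>. \<not> (lin \<theta> \<and> inj_on \<theta> (A c) \<and> \<theta> ` A c \<subseteq> ?V \<and> (\<forall>p\<in>A c - {0}. f (\<theta> p) = \<nu> c p))"
            using F2 GF unfolding embeds_def by blast
          have "real (card ?G) \<le> 2 powr (2 ^ n - 2 ^ n / 2 ^ k - d c * 2 ^ n)"
            by (rule d [of c, rule_format, of X n \<theta> ?G], intro conjI X(1,2) cX th(1-3) G1 G2 G3 G4)
          also have "\<dots> \<le> ?M"
            using mult_right_mono [OF \<delta>(2) [of c], of N] N by (intro powr_mono) (auto simp: N_def)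
          finally show "real (card ?G) \<le> ?M" .
        qed auto
        also have "\<dots> = 2 powr (real (card (X - T)) + \<xi> * N + (N - N / 2 ^ k - \<delta> * N))"
          unfolding powr_add using powr_realpow [of 2 "card (X - T)"] by simp
        finally have 1: "real (card K') \<le> 2 powr (real (card (X - T)) + \<xi> * N + (N - N / 2 ^ k - \<delta> * N))" .
        have "real (card (X - T)) \<le> \<delta> / 8 * N"
        proof -
          have "card T \<le> card ?V" using T(1) by (intro card_mono) auto
          from of_nat_mono [OF this, where 'a = real] have "real (card T) \<le> N" by (simp add: N_def)
          then have "4 * \<eta> * real (card T) \<le> 4 * (\<delta> / 32) * N" using \<eta> N \<delta>(1) by (intro mult_mono) auto
          then show ?thesis using X(5) by simp
        qed
        moreover have "\<xi> * N \<le> \<delta> / 8 * N" using \<xi>(2) N by (intro mult_right_mono) auto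
        \<comment> \<open>The free points of \<open>X\<close> and the exceptions cost at most
          \<open>\<delta> / 8\<close> each; three quarters of \<open>\<delta>\<close> remain and
          cover \<open>3 * \<xi>\<close>.\<close>
        ultimately have "real (card (X - T)) + \<xi> * N + (N - N / 2 ^ k - \<delta> * N) \<le> N - N / 2 ^ k - 3 * \<xi> * N"
          using mult_pos_pos [OF \<delta>(1) N] by linarith
        then have "2 powr (real (card (X - T)) + \<xi> * N + (N - N / 2 ^ k - \<delta> * N)) \<le> 2 powr (N - N / 2 ^ k - 3 * \<xi> * N)"
          by (rule powr_mono) simp
        with 1 KK' have "real (card K) \<le> 2 * 2 powr (N - N / 2 ^ k - 3 * \<xi> * N)" by linarith
        also have "\<dots> = 2 powr (1 + (N - N / 2 ^ k - 3 * \<xi> * N))" unfolding powr_add by simp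
        finally show ?thesis by (simp add: algebra_simps)
      qed
      \<comment> \<open>Of the saving \<open>3 * \<xi> * N\<close>, the return from \<open>K\<close>
        to \<open>F\<close> uses one third and the factor 2 another; the last third remains.\<close>
      have "2 powr (- \<xi> * N) * real (card F) \<le> 2 powr (1 + N - N / 2 ^ k - 3 * \<xi> * N)"
        using K(4) claim by (simp add: N_def)
      then have "2 powr (\<xi> * N) * (2 powr (- \<xi> * N) * real (card F)) \<le> 2 powr (\<xi> * N) * 2 powr (1 + N - N / 2 ^ k - 3 * \<xi> * N)"
        by (rule mult_left_mono) simp
      moreover have "2 powr (\<xi> * N) * (2 powr (- \<xi> * N) * real (card F)) = real (card F)"
        by (simp add: powr_minus)
      moreover have "2 powr (\<xi> * N) * 2 powr (1 + N - N / 2 ^ k - 3 * \<xi> * N) = 2 powr (1 + N - N / 2 ^ k - 2 * \<xi> * N)"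
      proof -
        have "\<xi> * N + (1 + N - N / 2 ^ k - 3 * \<xi> * N) = 1 + N - N / 2 ^ k - 2 * \<xi> * N" by linarith
        then show ?thesis by (simp only: powr_add [symmetric])
      qed
      moreover have "(2::real) powr (1 + N - N / 2 ^ k - 2 * \<xi> * N) \<le> 2 powr (N - N / 2 ^ k - \<xi> * N)"
        using \<xi>N by (intro powr_mono) linarith+
      ultimately show ?thesis by linarith
    qed
    then show "real (card F) \<le> 2 powr (2 ^ n - 2 ^ n / 2 ^ k - \<xi> * 2 ^ n)" by (simp add: N_def)
  qed
qed

section \<open>Matroids\<close>

abbreviation ground :: "matroid \<Rightarrow> vec set" where
  "ground M \<equiv> insert 0 (dom M)"

lemma fin_dim_space_iff: "fin_dim_space W \<longleftrightarrow> F2.subspace W \<and> finite W"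
proof
  assume "fin_dim_space W"
  then obtain B where B: "F2.subspace W" "finite B" "F2.span B = W" by (auto simp: fin_dim_space_def)
  obtain B' where B': "B' \<subseteq> B" "F2.independent B'" "B \<subseteq> F2.span B'"
    by (rule F2.maximal_independent_subset)
  have "F2.span B \<subseteq> F2.span B'" using B'(3) by (rule F2.span_minimal) simp
  moreover have "finite (F2.span B')"
    using card_span_independent [of B'] B' B(2) finite_subset by blast
  ultimately show "F2.subspace W \<and> finite W" using B finite_subset by blast
next
  assume W: "F2.subspace W \<and> finite W"
  obtain B where "finite B" "F2.span B = W" by (rule subspace_basis) (use W in auto)
  then show "fin_dim_space W" using W by (auto simp: fin_dim_space_def)
qed

lemma projective_space_iff: "projective_space V \<longleftrightarrow> (\<exists>W. F2.subspace W \<and> finite W \<and> V = W - {0})"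
  by (auto simp: projective_space_def fin_dim_space_iff)

lemma projective_spaceI: "F2.subspace W \<Longrightarrow> finite W \<Longrightarrow> projective_space (W - {0})"
  by (auto simp: projective_space_iff)

lemma insert_0_subspace:
  assumes "F2.subspace W" shows "insert 0 (W - {0}) = W" "insert 0 W = W"
  using F2.subspace_0 [OF assms] by auto

lemma projective_spaceD:
  assumes "projective_space V"
  shows "F2.subspace (insert 0 V)" "finite (insert 0 V)" "V = insert 0 V - {0}" "0 \<notin> V"
proof -
  obtain W where W: "F2.subspace W" "finite W" "V = W - {0}" using assms by (auto simp: projective_space_iff)
  then have "insert 0 V = W" using insert_0_subspace(1) [OF W(1)] by simp
  with W show "F2.subspace (insert 0 V)" "finite (insert 0 V)" "V = insert 0 V - {0}" "0 \<notin> V" by auto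
qed

lemma card_proj_dim:
  assumes "projective_space V" shows "card (insert 0 V) = 2 ^ proj_dim V"
  unfolding proj_dim_def using projective_spaceD [OF assms] by (intro card_subspace_dim)

lemma is_matroidD:
  assumes "is_matroid M"
  shows "F2.subspace (ground M)" "finite (ground M)" "0 \<notin> dom M" "card (ground M) = 2 ^ mdim M"
proof -
  have p: "projective_space (dom M)" using assms by (simp add: is_matroid_def)
  show "F2.subspace (ground M)" "finite (ground M)" "0 \<notin> dom M" using projective_spaceD [OF p] by blast+
  show "card (ground M) = 2 ^ mdim M" using card_proj_dim [OF p] by (simp add: mdim_def)
qed

lemma is_matroid_restrict:
  assumes "projective_space U" "U \<subseteq> dom M" shows "is_matroid (M |` U)"
  using assms by (simp add: is_matroid_def Int_absorb1)

lemma matroid_iso_refl: "matroid_iso M M"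
  unfolding matroid_iso_def by (rule exI[of _ id]) (auto simp: F2.linear_id)

text \<open>Over F_2 a codimension is a ratio of sizes; this is the form in which all counts use
  \<open>Ext1\<close>.\<close>

lemma Ext1_restrict:
  assumes M: "is_matroid M" and U: "projective_space U" "U \<subseteq> dom M" and card: "card (ground M) \<le> 2 ^ k * card (insert 0 U)"
  shows "M \<in> Ext1 k (M |` U)"
proof -
  have "(2::nat) ^ mdim M \<le> 2 ^ (k + proj_dim U)"
    using card is_matroidD(4) [OF M] card_proj_dim [OF U(1)] by (simp add: power_add)
  then have "mdim M \<le> k + proj_dim U" by simp
  then show ?thesis
    using M U matroid_iso_refl [of "M |` U"]
    by (auto simp: Ext1_def proj_subspace_def codim_def mdim_def Int_absorb1 intro!: exI[of _ U])
qed

text \<open>With \<open>ext_constI\<close> this describes \<open>ext_const\<close> without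
  isomorphisms: constancy is transported along the isomorphism, so a subspace of \<open>M\<close>
  itself replaces the copy.\<close>

lemma Ext1_const:
  assumes "M \<in> ext_const k c"
  obtains U where "is_matroid M" "projective_space U" "U \<subseteq> dom M" "\<And>x. x \<in> U \<Longrightarrow> M x = Some c"
    "card (ground M) \<le> 2 ^ k * card (insert 0 U)"
proof -
  obtain M0 U where M0: "M0 \<in> const_matroids c" and M: "is_matroid M" and U: "proj_subspace U (dom M)"
    "codim (dom M) U \<le> k" "matroid_iso M0 (M |` U)"
    using assms by (auto simp: ext_const_def Ext_def Ext1_def)
  have U': "projective_space U" "U \<subseteq> dom M" using U by (auto simp: proj_subspace_def)
  obtain \<phi> where \<phi>: "lin \<phi>" "bij_betw \<phi> (ground M0) (ground (M |` U))" "\<forall>x\<in>dom M0. M0 x = (M |` U) (\<phi> x)"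
    using U(3) by (auto simp: matroid_iso_def)
  have dU: "dom (M |` U) = U" using U'(2) by auto
  show thesis
  proof (rule that [OF M U'])
    fix x assume x: "x \<in> U"
    then have "x \<in> \<phi> ` ground M0" using \<phi>(2) dU by (simp add: bij_betw_def)
    then obtain y where y: "y \<in> ground M0" "x = \<phi> y" by blast
    have "x \<noteq> 0" using x projective_spaceD(4) [OF U'(1)] by blast
    then have "y \<in> dom M0" using y lin_0 [OF \<phi>(1)] by auto
    then have "M0 y = (M |` U) x" "M0 y = Some c" using \<phi>(3) y M0 by (auto simp: const_matroids_def)
    then show "M x = Some c" using x by simp
  next
    have "mdim M \<le> k + proj_dim U" using U(2) by (simp add: codim_def mdim_def)
    then have "(2::nat) ^ mdim M \<le> 2 ^ (k + proj_dim U)" by simp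
    then show "card (ground M) \<le> 2 ^ k * card (insert 0 U)"
      using is_matroidD(4) [OF M] card_proj_dim [OF U'(1)] by (simp add: power_add)
  qed
qed

lemma ext_constI:
  assumes "is_matroid M" "projective_space U" "U \<subseteq> dom M" "\<And>x. x \<in> U \<Longrightarrow> M x = Some c"
    "card (ground M) \<le> 2 ^ k * card (insert 0 U)"
  shows "M \<in> ext_const k c"
proof -
  have "M |` U \<in> const_matroids c"
    using assms is_matroid_restrict [OF assms(2,3)] by (auto simp: const_matroids_def)
  then show ?thesis using Ext1_restrict [OF assms(1-3,5)] by (auto simp: ext_const_def Ext_def)
qed

lemma const_in_ext_const:
  assumes "is_matroid M" "\<And>x. x \<in> dom M \<Longrightarrow> M x = Some c"
  shows "M \<in> ext_const k c"
  by (rule ext_constI [of M "dom M"]) (use assms in \<open>auto simp: is_matroid_def\<close>)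

definition contains_copy :: "matroid \<Rightarrow> vec set \<Rightarrow> matroid \<Rightarrow> (vec \<Rightarrow> vec) \<Rightarrow> bool" where
  "contains_copy N E M \<theta> \<longleftrightarrow> lin \<theta> \<and> inj_on \<theta> E \<and> \<theta> ` E \<subseteq> ground M \<and> (\<forall>p\<in>E - {0}. M (\<theta> p) = N p)"

text \<open>The image of the copy is a subspace of \<open>M\<close> on which \<open>M\<close>
  restricts to an isomorphic copy of \<open>N\<close>; \<open>P\<close> is closed under both
  operations.\<close>

lemma contains_copy_closed:
  assumes P: "matroid_property P" "hereditary P" and M: "M \<in> P" and N: "is_matroid N"
    and \<theta>: "contains_copy N (ground N) M \<theta>"
  shows "N \<in> P"
proof -
  have th: "lin \<theta>" "inj_on \<theta> (ground N)" "\<theta> ` ground N \<subseteq> ground M" "\<And>p. p \<in> ground N - {0} \<Longrightarrow> M (\<theta> p) = N p"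
    using \<theta> by (auto simp: contains_copy_def)
  define U where "U = \<theta> ` ground N - {0}"
  have sub: "F2.subspace (\<theta> ` ground N)" using subspace_image [OF th(1)] is_matroidD(1) [OF N] .
  have pU: "projective_space U" unfolding U_def using sub is_matroidD(2) [OF N] by (intro projective_spaceI) auto
  have UM: "U \<subseteq> dom M" using th(3) by (auto simp: U_def)
  have dU: "dom (M |` U) = U" using UM by auto
  have "insert 0 U = \<theta> ` ground N" unfolding U_def using sub by (rule insert_0_subspace)
  then have gU: "ground (M |` U) = \<theta> ` ground N" unfolding dU .
  have "M |` U \<in> P" using P(2) M pU UM by (auto simp: hereditary_def proj_subspace_def)
  moreover have "matroid_iso N (M |` U)"
    unfolding matroid_iso_def
  proof (intro exI conjI ballI)
    show "lin \<theta>" by (rule th(1))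
    show "bij_betw \<theta> (ground N) (ground (M |` U))" unfolding gU using th(2) by (simp add: bij_betw_def)
    fix x assume x: "x \<in> dom N"
    then have x0: "x \<in> ground N - {0}" using is_matroidD(3) [OF N] by auto
    then have "\<theta> x \<noteq> 0" using th(2) lin_inj_on_iff [OF th(1) is_matroidD(1) [OF N]] by blast
    then have "\<theta> x \<in> U" using x by (auto simp: U_def)
    then show "N x = (M |` U) (\<theta> x)" using th(4) [OF x0] by simp
  qed
  ultimately show "N \<in> P" using P(1) N unfolding matroid_property_def by blast
qed

text \<open>This is the property \<open>T\<close> of the overview; \<open>b\<close> stands for the
  constant value that \<open>N b\<close> takes on a large subspace.\<close>

definition avoiders :: "(bool \<Rightarrow> matroid) \<Rightarrow> (bool \<Rightarrow> vec set) \<Rightarrow> matroid set" where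
  "avoiders N E = {M. is_matroid M \<and> (\<forall>b \<theta>. \<not> contains_copy (N b) (E b) M \<theta>)}"

lemma contains_copy_mono:
  assumes "contains_copy N E M \<theta>" "F2.subspace E" "lin \<phi>" "inj_on \<phi> (ground M)" "\<phi> ` ground M \<subseteq> ground M'"
    "\<And>x. x \<in> dom M \<Longrightarrow> M x = M' (\<phi> x)"
  shows "contains_copy N E M' (\<lambda>x. \<phi> (\<theta> x))"
proof -
  have th: "lin \<theta>" "inj_on \<theta> E" "\<theta> ` E \<subseteq> ground M" "\<And>p. p \<in> E - {0} \<Longrightarrow> M (\<theta> p) = N p"
    using assms(1) by (auto simp: contains_copy_def)
  have "M' (\<phi> (\<theta> p)) = N p" if p: "p \<in> E - {0}" for p
  proof -
    have "\<theta> p \<noteq> 0" using p th(2) lin_inj_on_iff [OF th(1) assms(2)] by blast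
    then have "\<theta> p \<in> dom M" using p th(3) by auto
    then show ?thesis using assms(6) th(4) [OF p] by simp
  qed
  moreover have "lin (\<lambda>x. \<phi> (\<theta> x))" using lin_add [OF th(1)] lin_add [OF assms(3)] by (simp add: lin_iff)
  moreover have "inj_on (\<lambda>x. \<phi> (\<theta> x)) E"
    using comp_inj_on [OF th(2) inj_on_subset [OF assms(4) th(3)]] by (simp add: comp_def)
  moreover have "(\<lambda>x. \<phi> (\<theta> x)) ` E \<subseteq> ground M'" using th(3) assms(5) by blast
  ultimately show ?thesis by (simp add: contains_copy_def)
qed

text \<open>By \<open>nonconst\<close> neither forbidden restriction embeds in a matroid that is
  constantly \<open>cc\<close>; all of these remain, which gives non-triviality and critical number
  at least 0. Conversely the restriction of \<open>N b\<close> to \<open>E b\<close> is constant on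
  \<open>U b\<close>, of codimension at most 1, and contains itself. So no
  \<open>ext_const j c\<close> with \<open>j \<ge> 1\<close> survives.\<close>

lemma thin_avoiders:
  fixes N :: "bool \<Rightarrow> matroid"
  assumes N: "\<And>b. is_matroid (N b)" and U: "\<And>b. F2.subspace (U b)" "\<And>b. U b \<subseteq> E b"
    "\<And>b p. p \<in> U b - {0} \<Longrightarrow> N b p = Some (if b then 1 else 0)"
    and E: "\<And>b. F2.subspace (E b)" "\<And>b. E b \<subseteq> ground (N b)" "\<And>b. card (E b) \<le> 2 * card (U b)"
    and nonconst: "\<And>b. \<exists>p\<in>E b - {0}. N b p \<noteq> Some cc"
  shows "thin (avoiders N E)"
proof -
  have isoc: "matroid_property (avoiders N E)"
    unfolding matroid_property_def
  proof (intro conjI ballI allI impI)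
    fix M assume M: "M \<in> avoiders N E"
    then show "is_matroid M" by (simp add: avoiders_def)
    fix M' assume M': "is_matroid M' \<and> matroid_iso M' M"
    then obtain \<phi> where \<phi>: "lin \<phi>" "bij_betw \<phi> (ground M') (ground M)" "\<forall>x\<in>dom M'. M' x = M (\<phi> x)"
      by (auto simp: matroid_iso_def)
    have "\<not> contains_copy (N b) (E b) M' \<theta>" for b \<theta>
    proof
      assume "contains_copy (N b) (E b) M' \<theta>"
      then have "contains_copy (N b) (E b) M (\<lambda>x. \<phi> (\<theta> x))"
        by (rule contains_copy_mono) (use \<phi> E(1) in \<open>auto simp: bij_betw_def\<close>)
      then show False using M by (auto simp: avoiders_def)
    qed
    then show "M' \<in> avoiders N E" using M' by (simp add: avoiders_def)
  qed
  have her: "hereditary (avoiders N E)"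
    unfolding hereditary_def
  proof (intro ballI allI impI)
    fix M X assume M: "M \<in> avoiders N E" and X: "proj_subspace X (dom M)"
    have dX: "dom (M |` X) = X" using X by (auto simp: proj_subspace_def)
    have "\<not> contains_copy (N b) (E b) (M |` X) \<theta>" for b \<theta>
    proof
      assume "contains_copy (N b) (E b) (M |` X) \<theta>"
      then have "contains_copy (N b) (E b) M (\<lambda>x. id (\<theta> x))"
        by (rule contains_copy_mono) (use X dX E(1) in \<open>auto simp: proj_subspace_def lin_iff\<close>)
      then show False using M by (auto simp: avoiders_def)
    qed
    moreover have "is_matroid (M |` X)" using X by (intro is_matroid_restrict) (auto simp: proj_subspace_def)
    ultimately show "M |` X \<in> avoiders N E" by (simp add: avoiders_def)
  qed
  have const: "M \<in> avoiders N E" if M: "is_matroid M" "\<And>x. x \<in> dom M \<Longrightarrow> M x = Some cc" for M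
  proof -
    have "\<not> contains_copy (N b) (E b) M \<theta>" for b \<theta>
    proof
      assume c: "contains_copy (N b) (E b) M \<theta>"
      obtain p where p: "p \<in> E b - {0}" "N b p \<noteq> Some cc" using nonconst by blast
      have "\<theta> p \<noteq> 0" using p(1) c lin_inj_on_iff [OF _ E(1)] unfolding contains_copy_def by blast
      then have "\<theta> p \<in> dom M" using p(1) c by (auto simp: contains_copy_def)
      then have "M (\<theta> p) = Some cc" by (rule M(2))
      moreover have "M (\<theta> p) = N b p" using c p(1) by (simp add: contains_copy_def)
      ultimately show False using p(2) by simp
    qed
    then show ?thesis using M(1) by (simp add: avoiders_def)
  qed
  have "nontrivial (avoiders N E)"
    unfolding nontrivial_def
  proof
    fix d
    let ?M = "(\<lambda>x. if x \<in> F2_pow d - {0} then Some cc else None) :: matroid"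
    have dom: "dom ?M = F2_pow d - {0}" by (auto split: if_splits)
    have m: "is_matroid ?M" unfolding is_matroid_def dom by (intro projective_spaceI) auto
    have "(2::nat) ^ mdim ?M = 2 ^ d"
      using is_matroidD(4) [OF m] unfolding dom by (simp add: insert_0_subspace)
    then have "mdim ?M = d" by simp
    moreover have "?M x = Some cc" if "x \<in> dom ?M" for x using that unfolding dom by simp
    with m have "?M \<in> avoiders N E" by (rule const)
    ultimately show "\<exists>M\<in>avoiders N E. d \<le> mdim M" by (metis order_refl)
  qed
  moreover have "critical_number (avoiders N E) 0"
    unfolding critical_number_def
  proof (intro conjI allI impI)
    show "\<exists>c. ext_const 0 c \<subseteq> avoiders N E"
    proof (intro exI[of _ cc] subsetI)
      fix M assume "M \<in> ext_const 0 cc"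
      then obtain X where X: "is_matroid M" "projective_space X" "X \<subseteq> dom M" "\<And>x. x \<in> X \<Longrightarrow> M x = Some cc"
        "card (ground M) \<le> 2 ^ 0 * card (insert 0 X)" by (rule Ext1_const) blast
      \<comment> \<open>Codimension 0 leaves no room: \<open>X\<close> is the whole ground space and
        \<open>M\<close> is constant.\<close>
      have "insert 0 X = ground M"
        using X(3,5) is_matroidD(2) [OF X(1)] by (intro card_seteq) auto
      then have "dom M = X"
        using insert_ident [OF projective_spaceD(4) [OF X(2)] is_matroidD(3) [OF X(1)]] by simp
      then show "M \<in> avoiders N E" using X by (intro const) auto
    qed
    fix j assume "\<exists>c. ext_const j c \<subseteq> avoiders N E"
    then obtain c where c: "ext_const j c \<subseteq> avoiders N E" by blast
    show "j \<le> 0"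
    proof (rule ccontr)
      assume j: "\<not> j \<le> 0"
      define b where "b = (c = 1)"
      have cb: "c = (if b then 1 else 0)" by (simp add: b_def)
      define H where "H = N b |` (E b - {0})"
      have finE: "finite (E b)" using E(2) is_matroidD(2) [OF N] by (rule finite_subset)
      have EN: "E b - {0} \<subseteq> dom (N b)" using E(2) [of b] by auto
      have dH: "dom H = E b - {0}" unfolding H_def using EN by auto
      have gH: "ground H = E b" unfolding dH using E(1) by (rule insert_0_subspace)
      have finU: "finite (U b)" using U(2) finE by (rule finite_subset)
      have "H \<in> ext_const j c"
      proof (rule ext_constI [of H "U b - {0}"])
        show "is_matroid H" unfolding H_def by (rule is_matroid_restrict [OF projective_spaceI [OF E(1) finE] EN])
        show "projective_space (U b - {0})" by (rule projective_spaceI [OF U(1) finU])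
        show "U b - {0} \<subseteq> dom H" unfolding dH using U(2) [of b] by auto
        show "H x = Some c" if "x \<in> U b - {0}" for x
          using that U(2) [of b] U(3) [of x b] cb by (auto simp: H_def)
        have "2 * card (U b) \<le> 2 ^ j * card (U b)"
          using j power_increasing [of 1 j "2::nat"] by (intro mult_right_mono) auto
        then show "card (ground H) \<le> 2 ^ j * card (insert 0 (U b - {0}))"
          unfolding gH insert_0_subspace [OF U(1)] using E(3) [of b] by linarith
      qed
      moreover have "contains_copy (N b) (E b) H id"
        using EN gH by (auto simp: contains_copy_def lin_iff H_def)
      ultimately show False using c by (auto simp: avoiders_def)
    qed
  qed
  ultimately show ?thesis using isoc her by (simp add: thin_def)
qed

section \<open>Members of a property in a fixed dimension\<close>

lemma matroid_eqI:
  assumes "dom M = dom M'" "\<And>x. M x = Some 1 \<longleftrightarrow> M' x = Some (1 :: bit)"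
  shows "M = M'"
proof
  fix x
  show "M x = M' x"
  proof (cases "x \<in> dom M")
    case True
    then obtain u v where uv: "M x = Some u" "M' x = Some v" using assms(1) by blast
    then have "u = 1 \<longleftrightarrow> v = 1" using assms(2) [of x] by simp
    then have "u = v" by (cases u; cases v) auto
    then show ?thesis using uv by simp
  next
    case False
    then show ?thesis using assms(1) by (metis domIff)
  qed
qed

lemma finite_on_dim: "finite (on_dim P n)"
proof (rule finite_imageD)
  show "finite ((\<lambda>M. {x. M x = Some 1}) ` on_dim P n)"
    by (rule finite_subset [of _ "Pow (F2_pow n)"]) (auto simp: on_dim_def)
  show "inj_on (\<lambda>M. {x. M x = Some 1}) (on_dim P n)"
    by (intro inj_onI matroid_eqI) (auto simp: on_dim_def set_eq_iff)
qed

text \<open>Take the value \<open>cc\<close> on \<open>F2_pow (n - k)\<close> and arbitrary values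
  elsewhere. Matroids are counted as functions, not up to isomorphism, so every choice
  counts.\<close>

lemma card_on_dim_ge:
  assumes P: "ext_const k cc \<subseteq> P" and n: "k \<le> n"
  shows "2 ^ (2 ^ n - 2 ^ (n - k)) \<le> card (on_dim P n)"
proof -
  let ?V = "F2_pow n" and ?W = "F2_pow (n - k)"
  have WV: "?W \<subseteq> ?V" by (auto simp: F2_pow_def)
  define mt where "mt = (\<lambda>X x. if x \<in> ?V - {0} then Some (if x \<in> ?W then cc else if x \<in> X then 1 else (0::bit)) else None)"
  have dom: "dom (mt X) = ?V - {0}" for X by (auto simp: mt_def split: if_splits)
  have "mt ` Pow (?V - ?W) \<subseteq> on_dim P n"
  proof (rule image_subsetI)
    fix X assume "X \<in> Pow (?V - ?W)"
    have m: "is_matroid (mt X)" unfolding is_matroid_def dom by (intro projective_spaceI) auto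
    have "mt X \<in> ext_const k cc"
    proof (rule ext_constI [OF m, of "?W - {0}"])
      have "(2::nat) ^ n = 2 ^ k * 2 ^ (n - k)" using n by (simp flip: power_add)
      then show "card (ground (mt X)) \<le> 2 ^ k * card (insert 0 (?W - {0}))"
        unfolding dom by (simp add: insert_0_subspace)
    qed (use WV dom projective_spaceI in \<open>auto simp: mt_def\<close>)
    then show "mt X \<in> on_dim P n" using P dom by (auto simp: on_dim_def)
  qed
  moreover have "inj_on mt (Pow (?V - ?W))"
  proof (rule inj_onI)
    fix X Y assume XY: "X \<in> Pow (?V - ?W)" "Y \<in> Pow (?V - ?W)" "mt X = mt Y"
    have "x \<in> X \<longleftrightarrow> x \<in> Y" for x
    proof (cases "x \<in> ?V - ?W")
      case True
      then have "x \<noteq> 0" by auto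
      then show ?thesis using fun_cong [OF XY(3), of x] True by (auto simp: mt_def split: if_splits)
    qed (use XY in blast)
    then show "X = Y" by blast
  qed
  ultimately have "card (Pow (?V - ?W)) \<le> card (on_dim P n)"
    by (intro card_inj_on_le [of mt]) (auto simp: finite_on_dim)
  moreover have "card (?V - ?W) = 2 ^ n - 2 ^ (n - k)" using WV by (subst card_Diff_subset) auto
  ultimately show ?thesis by (simp add: card_Pow)
qed

theorem theorem1p8:
  fixes P :: "matroid set" and k :: nat
  assumes "matroid_property P" and "hereditary P" and "nontrivial P"
    and "critical_number P k"
  shows "\<exists>T. thin T \<and>
    (\<lambda>n. real (card (on_dim P n \<inter> Ext k T)) / real (card (on_dim P n))) \<longlonglongrightarrow> 1"
proof -
  obtain cc where cc: "ext_const k cc \<subseteq> P" using assms(4) by (auto simp: critical_number_def)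
  have mat: "is_matroid M" if "M \<in> P" for M using assms(1) that by (simp add: matroid_property_def)
  have pos: "card (on_dim P n) > 0" if "k \<le> n" for n
    using card_on_dim_ge [OF cc that] by (metis neq0_conv not_le power_not_zero zero_neq_numeral le_zero_eq)
  show ?thesis
  proof (cases "k = 0")
    case True
    \<comment> \<open>With critical number 0 the property \<open>P\<close> is thin itself, and
      \<open>T = P\<close> is taken; \<open>avoiding_count\<close> needs
      \<open>k \<ge> 1\<close>.\<close>
    have "P \<subseteq> Ext 0 P"
    proof
      fix M assume M: "M \<in> P"
      have "M \<in> Ext1 0 (M |` dom M)"
        using mat [OF M] by (intro Ext1_restrict) (auto simp: is_matroid_def)
      moreover have "M |` dom M = M" by (rule ext) (auto simp: restrict_map_def domIff)
      ultimately show "M \<in> Ext 0 P" using M by (auto simp: Ext_def)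
    qed
    then have "on_dim P n \<inter> Ext k P = on_dim P n" for n using True by (auto simp: on_dim_def)
    moreover have "thin P" using assms True by (simp add: thin_def)
    moreover have "(\<lambda>n. real (card (on_dim P n)) / real (card (on_dim P n))) = (\<lambda>_. 1)"
      using pos True by (intro ext) force
    ultimately show ?thesis by (intro exI[of _ P]) simp
  next
    case False
    then have k: "k \<ge> 1" by simp
    define bt where "bt = (\<lambda>b. if b then 1 else (0::bit))"
    have "\<exists>N X. is_matroid N \<and> N \<notin> P \<and> projective_space X \<and> X \<subseteq> dom N \<and> (\<forall>x\<in>X. N x = Some (bt b)) \<and>
      card (ground N) \<le> 2 ^ (k + 1) * card (insert 0 X)" for b
    proof -
      have "\<not> ext_const (k + 1) (bt b) \<subseteq> P" using assms(4) unfolding critical_number_def by (metis Suc_eq_plus1 not_less_eq_eq order_refl)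
      then obtain N where N: "N \<in> ext_const (k + 1) (bt b)" "N \<notin> P" by blast
      from N(1) show ?thesis by (rule Ext1_const) (use N(2) in blast)
    qed
    then obtain N X where NX: "\<And>b. is_matroid (N b)" "\<And>b. N b \<notin> P" "\<And>b. projective_space (X b)" "\<And>b. X b \<subseteq> dom (N b)"
      "\<And>b x. x \<in> X b \<Longrightarrow> N b x = Some (bt b)" "\<And>b. card (ground (N b)) \<le> 2 ^ (k + 1) * card (insert 0 (X b))"
      by metis
    define A where "A = (\<lambda>b. ground (N b))"
    define U where "U = (\<lambda>b. insert 0 (X b))"
    have A: "F2.subspace (A b)" "finite (A b)" for b using is_matroidD [OF NX(1)] by (simp_all add: A_def)
    have U: "F2.subspace (U b)" "U b \<subseteq> A b" "finite (U b)" for b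
      using projective_spaceD [OF NX(3)] NX(4) [of b] by (auto simp: A_def U_def)
    have UN: "N b p = Some (bt b)" if "p \<in> U b - {0}" for b p using that NX(5) by (auto simp: U_def)
    have cU: "card (A b) \<le> 2 ^ (k + 1) * card (U b)" for b using NX(6) by (simp add: A_def U_def)
    \<comment> \<open>One more dimension than \<open>U b\<close>, unless that is everything, lowers
      the codimension from \<open>k + 1\<close> to \<open>k\<close>; this dimension is also what
      makes room for a point with value other than \<open>cc\<close>.\<close>
    have "\<exists>E. F2.subspace E \<and> U b \<subseteq> E \<and> E \<subseteq> A b \<and> card E \<le> 2 * card (U b) \<and> card (A b) \<le> 2 ^ k * card E \<and>
      (\<exists>p\<in>E - {0}. N b p \<noteq> Some cc)" for b
    proof -
      \<comment> \<open>A constant \<open>N b\<close> of value \<open>cc\<close> would lie in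
        \<open>ext_const k cc\<close> and so in \<open>P\<close>.\<close>
      have "\<exists>p\<in>dom (N b). N b p \<noteq> Some cc"
      proof (rule ccontr)
        assume "\<not> ?thesis"
        then have "N b \<in> ext_const k cc" using NX(1) by (intro const_in_ext_const) auto
        then show False using cc NX(2) by blast
      qed
      then obtain p where "p \<in> dom (N b)" "N b p \<noteq> Some cc" by blast
      then have p: "p \<in> A b - {0}" "N b p \<noteq> Some cc" using is_matroidD(3) [OF NX(1)] by (auto simp: A_def)
      show ?thesis
      proof (cases "U b = A b")
        case True
        show ?thesis by (rule exI[of _ "A b"]) (use A True p in auto)
      next
        case neq: False
        \<comment> \<open>If \<open>p\<close> already lies in \<open>U b\<close>, any new direction
          will do; otherwise \<open>p\<close> itself is adjoined.\<close>
        obtain y where y: "y \<in> A b" "y \<notin> U b" "p \<in> adjoin y (U b)"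
        proof (cases "p \<in> U b")
          case True
          obtain y where "y \<in> A b" "y \<notin> U b" using neq U(2) by blast
          then show thesis using that True by (auto simp: adjoin_def)
        next
          case False
          then show thesis using that [of p] p F2.subspace_0 [OF U(1)] by (auto simp: adjoin_iff)
        qed
        have ca: "card (adjoin y (U b)) = 2 * card (U b)" by (rule card_adjoin [OF U(1,3) y(2)])
        have "adjoin y (U b) \<subseteq> A b"
          using U(2) [of b] y(1) F2.subspace_add [OF A(1) y(1)] by (auto simp: adjoin_def)
        then show ?thesis
          using subspace_adjoin [OF U(1)] ca cU [of b] y(3) p by (intro exI[of _ "adjoin y (U b)"]) (auto simp: adjoin_def)
      qed
    qed
    then obtain E where E: "\<And>b. F2.subspace (E b)" "\<And>b. U b \<subseteq> E b" "\<And>b. E b \<subseteq> A b" "\<And>b. card (E b) \<le> 2 * card (U b)"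
      "\<And>b. card (A b) \<le> 2 ^ k * card (E b)" "\<And>b. \<exists>p\<in>E b - {0}. N b p \<noteq> Some cc"
      by metis
    define \<nu> where "\<nu> = (\<lambda>b p. N b p = Some 1)"
    have \<nu>: "\<nu> b p = b" if "p \<in> U b - {0}" for b p using UN [OF that] by (simp add: \<nu>_def bt_def)
    define T where "T = avoiders N E"
    have thinT: "thin T"
      unfolding T_def by (rule thin_avoiders [OF NX(1) U(1) E(2) _ E(1) _ E(4,6)]) (use UN E(3) in \<open>auto simp: bt_def A_def\<close>)
    have "\<exists>\<delta>>0. \<exists>n0. \<forall>n F. n \<ge> n0 \<and> (\<forall>f\<in>F. \<forall>x. x \<notin> F2_pow n - {0} \<longrightarrow> \<not> f x) \<and>
      (\<forall>f\<in>F. \<forall>c \<theta>. \<not> embeds (A c) (F2_pow n) (\<nu> c) f \<theta>) \<and>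
      (\<forall>f\<in>F. \<forall>W. F2.subspace W \<and> W \<subseteq> F2_pow n \<and> card W * 2 ^ k = 2 ^ n \<longrightarrow>
         (\<exists>c \<theta>. embeds (E c) W (\<nu> c) f \<theta>)) \<longrightarrow>
      real (card F) \<le> 2 powr (2 ^ n - 2 ^ n / 2 ^ k - \<delta> * 2 ^ n)" (is "\<exists>\<delta>>0. \<exists>n0. ?main \<delta> n0")
      by (rule avoiding_count [where A = A and U = U and E = E and \<nu> = \<nu>, OF A U(1,2) cU _ E(1,3,5) k]) (rule \<nu>)
    then obtain \<delta> n0 where \<delta>: "\<delta> > 0" and main: "?main \<delta> n0"
      by (elim exE conjE) (rule that)
    have lower: "1 - 2 powr (- \<delta> * 2 ^ n) \<le> real (card (on_dim P n \<inter> Ext k T)) / real (card (on_dim P n))"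
      if n: "n \<ge> n0 + k" for n
    proof -
      let ?V = "F2_pow n"
      define Bad where "Bad = on_dim P n - Ext k T"
      \<comment> \<open>The ground space is fixed, so a matroid is recovered from the points with
        value 1 and the exceptional ones can be counted as functions into
        \<open>bool\<close>.\<close>
      define ev where "ev = (\<lambda>(M :: matroid) x. M x = Some 1)"
      have evinj: "inj_on ev Bad"
        by (intro inj_onI matroid_eqI) (auto simp: Bad_def on_dim_def ev_def fun_eq_iff)
      have dom: "dom M = ?V - {0}" "M \<in> P" if "M \<in> Bad" for M using that by (auto simp: Bad_def on_dim_def)
      have gr: "ground M = ?V" if "M \<in> Bad" for M using dom(1) [OF that] by (simp add: insert_0_subspace)
      have val: "M x = N b p \<longleftrightarrow> (ev M x = \<nu> b p)" if "x \<in> dom M" "p \<in> dom (N b)" for M x b p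
      proof -
        obtain u w where uw: "M x = Some u" "N b p = Some w" using \<open>x \<in> dom M\<close> \<open>p \<in> dom (N b)\<close> by blast
        then show ?thesis by (cases u; cases w) (auto simp: ev_def \<nu>_def)
      qed
      have copy: "contains_copy (N b) Y (M |` (W - {0})) \<theta> \<longleftrightarrow> embeds Y W (\<nu> b) (ev M) \<theta>"
        if M: "M \<in> Bad" and W: "F2.subspace W" "W \<subseteq> ?V" and Y: "F2.subspace Y" "Y \<subseteq> A b" for b Y M W \<theta>
      proof -
        have dW: "dom (M |` (W - {0})) = W - {0}" using dom(1) [OF M] W(2) by auto
        have gW: "ground (M |` (W - {0})) = W" unfolding dW using W(1) by (rule insert_0_subspace)
        have "(M |` (W - {0})) (\<theta> p) = N b p \<longleftrightarrow> ev M (\<theta> p) = \<nu> b p"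
          if "lin \<theta>" "inj_on \<theta> Y" "\<theta> ` Y \<subseteq> W" "p \<in> Y - {0}" for p
        proof -
          have "\<theta> p \<noteq> 0" using that lin_inj_on_iff [OF that(1) Y(1)] by blast
          then have "\<theta> p \<in> W - {0}" using that by auto
          moreover have "p \<in> dom (N b)" using that(4) Y(2) by (auto simp: A_def)
          ultimately show ?thesis using val [of "\<theta> p" M p b] dom(1) [OF M] W(2) by auto
        qed
        then show ?thesis unfolding contains_copy_def embeds_def gW by blast
      qed
      have "real (card (ev ` Bad)) \<le> 2 powr (2 ^ n - 2 ^ n / 2 ^ k - \<delta> * 2 ^ n)"
      proof (rule main [rule_format], intro conjI ballI allI impI)
        show "n0 \<le> n" using n by simp
        fix f assume "f \<in> ev ` Bad"
        then obtain M where M: "M \<in> Bad" "f = ev M" by blast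
        show "\<not> f x" if "x \<notin> ?V - {0}" for x
          using that dom(1) [OF M(1)] unfolding M(2) ev_def by auto
        show "\<not> embeds (A c) ?V (\<nu> c) f \<theta>" for c \<theta>
        proof
          assume "embeds (A c) ?V (\<nu> c) f \<theta>"
          then have "contains_copy (N c) (A c) (M |` (?V - {0})) \<theta>"
            using copy [OF M(1) subspace_F2_pow order_refl A(1) order_refl] M(2) by blast
          moreover have "M |` dom M = M" by (rule ext) (simp add: restrict_map_def domIff)
          then have "M |` (?V - {0}) = M" unfolding dom(1) [OF M(1)] .
          ultimately have "contains_copy (N c) (ground (N c)) M \<theta>" by (simp add: A_def)
          then have "N c \<in> P" by (rule contains_copy_closed [OF assms(1,2) dom(2) [OF M(1)] NX(1)])
          then show False using NX(2) by blast
        qed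
        fix W assume W: "F2.subspace W \<and> W \<subseteq> ?V \<and> card W * 2 ^ k = 2 ^ n"
        let ?R = "M |` (W - {0})"
        have finW: "finite W" using W finite_subset [OF _ finite_F2_pow] by blast
        have WM: "W - {0} \<subseteq> dom M" using W dom(1) [OF M(1)] by auto
        have pW: "projective_space (W - {0})" using W finW by (intro projective_spaceI) auto
        \<comment> \<open>If the restriction \<open>?R\<close> were in \<open>T\<close>, then
          \<open>M\<close> would be in \<open>Ext k T\<close> and not exceptional; so
          \<open>?R\<close> contains a forbidden copy.\<close>
        have "M \<in> Ext1 k ?R"
        proof (rule Ext1_restrict [OF mat [OF dom(2) [OF M(1)]] pW WM])
          show "card (ground M) \<le> 2 ^ k * card (insert 0 (W - {0}))"
            using W by (simp add: gr [OF M(1)] insert_0_subspace mult.commute)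
        qed
        then have "?R \<notin> T" using M(1) by (auto simp: Bad_def Ext_def)
        moreover have "is_matroid ?R" by (rule is_matroid_restrict [OF pW WM])
        ultimately obtain b \<theta> where "contains_copy (N b) (E b) ?R \<theta>" by (auto simp: T_def avoiders_def)
        then show "\<exists>c \<theta>. embeds (E c) W (\<nu> c) f \<theta>"
          using copy [OF M(1) _ _ E(1,3)] W M(2) by blast
      qed
      then have cBad: "real (card Bad) \<le> 2 powr (2 ^ n - 2 ^ n / 2 ^ k - \<delta> * 2 ^ n)"
        by (simp add: card_image [OF evinj])
      have kn: "k \<le> n" using n by simp
      define Q where "Q = real (card (on_dim P n))"
      have Q: "Q > 0" using pos [OF kn] by (simp add: Q_def)
      have "2 powr (2 ^ n - 2 ^ n / 2 ^ k) \<le> Q"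
      proof -
        have "(2::nat) ^ (n - k) \<le> 2 ^ n" by (rule power_increasing) auto
        then have "real (2 ^ n - 2 ^ (n - k)) = 2 ^ n - 2 ^ n / 2 ^ k"
          using kn by (simp add: of_nat_diff) (simp add: power_diff)
        then have "2 powr (2 ^ n - 2 ^ n / 2 ^ k) = (2::real) ^ (2 ^ n - 2 ^ (n - k))"
          using powr_realpow [of 2 "2 ^ n - 2 ^ (n - k)"] by simp
        also have "\<dots> = real (2 ^ (2 ^ n - 2 ^ (n - k)))" by simp
        also have "\<dots> \<le> Q" unfolding Q_def using card_on_dim_ge [OF cc kn] by (rule of_nat_mono)
        finally show ?thesis .
      qed
      then have "2 powr (2 ^ n - 2 ^ n / 2 ^ k) * 2 powr (- \<delta> * 2 ^ n) \<le> Q * 2 powr (- \<delta> * 2 ^ n)"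
        by (rule mult_right_mono) simp
      moreover have "2 powr (2 ^ n - 2 ^ n / 2 ^ k) * 2 powr (- \<delta> * 2 ^ n) = 2 powr (2 ^ n - 2 ^ n / 2 ^ k - \<delta> * 2 ^ n)"
        by (simp flip: powr_add)
      \<comment> \<open>The lower bound for \<open>on_dim P n\<close> cancels the main term, and a
        doubly exponentially small share of exceptions remains.\<close>
      ultimately have B: "real (card Bad) \<le> Q * 2 powr (- \<delta> * 2 ^ n)" using cBad by linarith
      have "card (on_dim P n) = card (on_dim P n \<inter> Ext k T) + card Bad"
        unfolding Bad_def using finite_on_dim by (metis card_Int_Diff)
      then have "real (card (on_dim P n \<inter> Ext k T)) = Q - real (card Bad)" by (simp add: Q_def)
      then have "Q * (1 - 2 powr (- \<delta> * 2 ^ n)) \<le> real (card (on_dim P n \<inter> Ext k T))"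
        using B by (simp add: right_diff_distrib)
      then show ?thesis using Q by (simp add: pos_le_divide_eq mult.commute flip: Q_def)
    qed
    have upper: "real (card (on_dim P n \<inter> Ext k T)) / real (card (on_dim P n)) \<le> 1" for n
      using card_mono [OF finite_on_dim, of "on_dim P n \<inter> Ext k T" P n] by (simp add: divide_le_eq)
    have "(\<lambda>n. 2 powr (- \<delta> * 2 ^ n)) \<longlonglongrightarrow> 0"
    proof (rule tendsto_sandwich [of "\<lambda>_. 0" _ _ "\<lambda>n. (2 powr (- \<delta>)) ^ n"])
      have "2 powr (- \<delta>) < 2 powr 0" using \<delta> by (intro powr_less_mono) auto
      then show "(\<lambda>n. (2 powr (- \<delta>)) ^ n) \<longlonglongrightarrow> 0" by (intro LIMSEQ_realpow_zero) auto
      show "\<forall>\<^sub>F n in sequentially. 2 powr (- \<delta> * 2 ^ n) \<le> (2 powr (- \<delta>)) ^ n"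
      proof (rule always_eventually, rule allI)
        fix n :: nat
        have "real n \<le> 2 ^ n" using of_nat_mono [OF less_imp_le [OF less_exp [of n]], where 'a = real] by simp
        then have "- \<delta> * 2 ^ n \<le> - \<delta> * real n" using \<delta> by simp
        then have "2 powr (- \<delta> * 2 ^ n) \<le> 2 powr (- \<delta> * real n)" by (rule powr_mono) simp
        also have "\<dots> = (2 powr (- \<delta>)) ^ n" by (simp add: powr_power mult.commute)
        finally show "2 powr (- \<delta> * 2 ^ n) \<le> (2 powr (- \<delta>)) ^ n" .
      qed
    qed auto
    then have lim: "(\<lambda>n. 1 - 2 powr (- \<delta> * 2 ^ n)) \<longlonglongrightarrow> 1" using tendsto_diff [OF tendsto_const, of _ 0 sequentially 1] by simp
    have "(\<lambda>n. real (card (on_dim P n \<inter> Ext k T)) / real (card (on_dim P n))) \<longlonglongrightarrow> 1"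
    proof (rule tendsto_sandwich [OF _ _ lim tendsto_const])
      show "\<forall>\<^sub>F n in sequentially. 1 - 2 powr (- \<delta> * 2 ^ n) \<le> real (card (on_dim P n \<inter> Ext k T)) / real (card (on_dim P n))"
        using eventually_ge_at_top [of "n0 + k"] by eventually_elim (rule lower)
    qed (use upper in auto)
    then show ?thesis using thinT by blast
  qed
qed

end
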